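(* Let $(M,J)$ be an almost complex manifold. The Aeppli cohomology $H^\bullet_{dd^c}$ has the structure of a module over the Bott-Chern cohomology $H^\bullet_{d+d^c}$. In particular, for all $k,\ell$ there is a well-defined pairing $$H^k_{d+d^c}\times H^\ell_{dd^c}\longrightarrow H^{k+\ell}_{dd^c},\qquad ([\alpha]_{d+d^c},[\gamma]_{dd^c})\longmapsto[\alpha\wedge\gamma]_{dd^c}.$$
   Context: An almost complex manifold $(M,J)$ is a smooth $2m$-manifold with a smooth $(1,1)$-tensor field $J$, $J^2=-\mathrm{Id}$. $A^k$ is the space of smooth complex $k$-forms, with bigrading $A^k=\bigoplus_{p+q=k}A^{p,q}$ induced by $J$. $J$ acts on forms by duality, as an algebra automorphism: $J\alpha=i^{p-q}\alpha$ for $\alpha\in A^{p,q}$. Set $d^c:=J^{-1}dJ$. Let $B^\bullet:=\{\alpha\in A^\bullet:(dd^c+d^cd)\alpha=0\}$ and $C^\bullet:=A^\bullet/\operatorname{Im}(dd^c+d^cd)$ (graded by degree of forms); $d$ and $d^c$ act on both. The Bott-Chern cohomology is $$H^k_{d+d^c}:=\frac{\ker(d\colon B^k\to B^{k+1})\cap\ker(d^c\colon B^k\to B^{k+1})}{\operatorname{Im}(dd^c\colon B^{k-2}\to B^k)},$$ an algebra under the wedge product of representatives, and the Aeppli cohomology is $$H^k_{dd^c}:=\frac{\ker(dd^c\colon C^k\to C^{k+2})}{\operatorname{Im}(d\colon C^{k-1}\to C^k)+\operatorname{Im}(d^c\colon C^{k-1}\to C^k)}.$$ *)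

theory Defs
  imports
    "HOL-Algebra.Module"
    "HOL-Analysis.Analysis"
    "HOL-Library.Function_Algebras"
begin

section \<open>Smooth manifolds and almost complex structures\<close>

text \<open>
  Only used for open \<open>S\<close> in a finite-dimensional space, where it means \<open>C\<^sup>\<infinity>\<close>: all iterated
  directional derivatives of \<open>f\<close> exist and are Frechet differentiable on \<open>S\<close>.
\<close>

coinductive smooth_on :: "'a::real_normed_vector set \<Rightarrow> ('a \<Rightarrow> 'b::real_normed_vector) \<Rightarrow> bool"
  where
    "\<lbrakk>\<forall>x\<in>S. f differentiable (at x);
      \<forall>v. smooth_on S (\<lambda>x. frechet_derivative f (at x) v)\<rbrakk> \<Longrightarrow> smooth_on S f"

text \<open>A chart is a coordinate domain together with its coordinate map; the values of the
  coordinate map outside the domain are irrelevant.\<close>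

type_synonym ('m, 'e) chart = "'m set \<times> ('m \<Rightarrow> 'e)"

definition chart_range :: "('m, 'e) chart \<Rightarrow> 'e set"
  where "chart_range c = snd c ` fst c"

definition is_chart :: "'m topology \<Rightarrow> ('m, 'e::real_normed_vector) chart \<Rightarrow> bool"
  where "is_chart X c \<longleftrightarrow>
    openin X (fst c) \<and> open (chart_range c) \<and>
    homeomorphic_map (subtopology X (fst c)) (top_of_set (chart_range c)) (snd c)"

definition overlap :: "('m, 'e) chart \<Rightarrow> ('m, 'e) chart \<Rightarrow> 'e set"
  where "overlap c c' = snd c ` (fst c \<inter> fst c')"

definition transition :: "('m, 'e) chart \<Rightarrow> ('m, 'e) chart \<Rightarrow> 'e \<Rightarrow> 'e"
  where "transition c c' = (\<lambda>x. snd c' (inv_into (fst c) (snd c) x))"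

abbreviation transition_deriv ::
    "('m, 'e::real_normed_vector) chart \<Rightarrow> ('m, 'e) chart \<Rightarrow> 'e \<Rightarrow> 'e \<Rightarrow> 'e"
  where "transition_deriv c c' x \<equiv> frechet_derivative (transition c c') (at x)"

text \<open>
  The model space is a real inner product space with a basis of \<open>n\<close> elements, that is,
  Euclidean \<open>n\<close>-space. The class \<open>real_inner\<close> is used rather than \<open>euclidean_space\<close> because
  the latter excludes \<open>n = 0\<close>. The atlas need not be maximal.
\<close>

definition smooth_manifold :: "nat \<Rightarrow> 'm topology \<Rightarrow> ('m, 'e::real_inner) chart set \<Rightarrow> bool"
  where "smooth_manifold n X \<A> \<longleftrightarrow>
    (\<exists>B::'e set. finite B \<and> independent B \<and> span B = UNIV \<and> card B = n) \<and>
    Hausdorff_space X \<and> second_countable X \<and>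
    (\<forall>c\<in>\<A>. is_chart X c) \<and> \<Union>(fst ` \<A>) = topspace X \<and>
    (\<forall>c\<in>\<A>. \<forall>c'\<in>\<A>. smooth_on (overlap c c') (transition c c'))"

text \<open>
  Tensor fields are given by their representatives in the charts of the atlas, which have to
  correspond to each other under the transition maps. In a chart, a \<open>(1,1)\<close>-tensor field is a
  field of endomorphisms of the model space.
\<close>

type_synonym ('m, 'e) endo_field = "('m, 'e) chart \<Rightarrow> 'e \<Rightarrow> 'e \<Rightarrow> 'e"

definition smooth_endo_field ::
    "('m, 'e::real_inner) chart set \<Rightarrow> ('m, 'e) endo_field \<Rightarrow> bool"
  where "smooth_endo_field \<A> J \<longleftrightarrow>
    (\<forall>c\<in>\<A>. (\<forall>x\<in>chart_range c. linear (J c x)) \<and>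
            (\<forall>v. smooth_on (chart_range c) (\<lambda>x. J c x v))) \<and>
    (\<forall>c\<in>\<A>. \<forall>c'\<in>\<A>. \<forall>x\<in>overlap c c'. \<forall>v.
       transition_deriv c c' x (J c x v) = J c' (transition c c' x) (transition_deriv c c' x v))"

definition almost_complex_manifold ::
    "nat \<Rightarrow> 'm topology \<Rightarrow> ('m, 'e::real_inner) chart set \<Rightarrow> ('m, 'e) endo_field \<Rightarrow> bool"
  where "almost_complex_manifold m X \<A> J \<longleftrightarrow>
    smooth_manifold (2 * m) X \<A> \<and> smooth_endo_field \<A> J \<and>
    (\<forall>c\<in>\<A>. \<forall>x\<in>chart_range c. \<forall>v. J c x (J c x v) = - v)"


section \<open>Complex differential forms\<close>

text \<open>
  A \<open>k\<close>-form is a compatible family of \<open>k\<close>-forms on the chart ranges. The value at a point is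
  a real-multilinear alternating function of the list of tangent vectors. Forms
  are extended by \<open>0\<close> to arguments of no significance (charts outside the atlas, points outside
  the chart range, lists of the wrong length), so that equality of forms is equality of functions.
  The degree is an integer, with only the zero form in negative degrees.
\<close>

type_synonym ('m, 'e) form = "('m, 'e) chart \<Rightarrow> 'e \<Rightarrow> 'e list \<Rightarrow> complex"

definition forms :: "('m, 'e::real_inner) chart set \<Rightarrow> int \<Rightarrow> ('m, 'e) form set"
  where "forms \<A> k = {\<alpha>.
    (\<forall>c x vs. c \<notin> \<A> \<or> x \<notin> chart_range c \<or> int (length vs) \<noteq> k \<longrightarrow> \<alpha> c x vs = 0) \<and>
    (\<forall>c\<in>\<A>. \<forall>x\<in>chart_range c. \<forall>vs.
       (\<forall>i<length vs. linear (\<lambda>v. \<alpha> c x (vs[i := v]))) \<and>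
       (\<forall>i j. i < j \<and> j < length vs \<and> vs ! i = vs ! j \<longrightarrow> \<alpha> c x vs = 0)) \<and>
    (\<forall>c\<in>\<A>. \<forall>vs. smooth_on (chart_range c) (\<lambda>x. \<alpha> c x vs)) \<and>
    (\<forall>c\<in>\<A>. \<forall>c'\<in>\<A>. \<forall>x\<in>overlap c c'. \<forall>vs.
       \<alpha> c x vs = \<alpha> c' (transition c c' x) (map (transition_deriv c c' x) vs))}"

definition scale :: "complex \<Rightarrow> ('m, 'e) form \<Rightarrow> ('m, 'e) form"
  where "scale z \<alpha> = (\<lambda>c x vs. z * \<alpha> c x vs)"

definition one_form0 :: "('m, 'e) chart set \<Rightarrow> ('m, 'e) form"
  where "one_form0 \<A> = (\<lambda>c x vs. if c \<in> \<A> \<and> x \<in> chart_range c \<and> vs = [] then 1 else 0)"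

text \<open>
  Wedge product as a sum over shuffles, with \<open>S\<close> the set of positions of the arguments passed
  to \<open>\<alpha>\<close>; the exponent is the number of inversions of the shuffle. No factorials are needed.
\<close>

definition wedge :: "('m, 'e) form \<Rightarrow> ('m, 'e) form \<Rightarrow> ('m, 'e) form"
  where "wedge \<alpha> \<beta> = (\<lambda>c x vs. \<Sum>S\<in>Pow {..<length vs}.
    (-1) ^ card {(i, j). i \<in> {..<length vs} - S \<and> j \<in> S \<and> i < j} *
    \<alpha> c x (nths vs S) * \<beta> c x (nths vs (- S)))"

text \<open>
  In a chart, \<open>(d\<alpha>)(v\<^sub>0, \<dots>, v\<^sub>k) = (\<Sum>i. (-1)\<^sup>i D\<^bsub>v\<^sub>i\<^esub> \<alpha>(v\<^sub>0, \<dots>, v\<^sub>i omitted, \<dots>, v\<^sub>k))\<close> for constant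
  vector fields \<open>v\<^sub>i\<close>.
\<close>

definition ext_d :: "('m, 'e::real_normed_vector) form \<Rightarrow> ('m, 'e) form"
  where "ext_d \<alpha> = (\<lambda>c x vs. if x \<in> chart_range c
    then \<Sum>i<length vs. (-1) ^ i *
      frechet_derivative (\<lambda>y. \<alpha> c y (take i vs @ drop (Suc i) vs)) (at x) (vs ! i)
    else 0)"

text \<open>
  The dual action \<open>(L\<alpha>)(v\<^sub>1, \<dots>, v\<^sub>k) = \<alpha>(L v\<^sub>1, \<dots>, L v\<^sub>k)\<close>. On a form of type \<open>(p,q)\<close> the action
  of \<open>J\<close> is multiplication by \<open>\<i>\<^sup>p\<^sup>-\<^sup>q\<close>, since \<open>\<alpha>(J v) = \<i> \<alpha>(v)\<close> for \<open>\<alpha>\<close> of type \<open>(1,0)\<close>.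
  The inverse action is that of the pointwise inverse of \<open>J\<close>.
\<close>

definition dual_act :: "('m, 'e) endo_field \<Rightarrow> ('m, 'e) form \<Rightarrow> ('m, 'e) form"
  where "dual_act L \<alpha> = (\<lambda>c x vs. \<alpha> c x (map (L c x) vs))"

definition ext_dc ::
    "('m, 'e::real_normed_vector) endo_field \<Rightarrow> ('m, 'e) form \<Rightarrow> ('m, 'e) form"
  where "ext_dc J \<alpha> = dual_act (\<lambda>c x. inv_into UNIV (J c x)) (ext_d (dual_act J \<alpha>))"

definition ddc ::
    "('m, 'e::real_normed_vector) endo_field \<Rightarrow> ('m, 'e) form \<Rightarrow> ('m, 'e) form"
  where "ddc J \<alpha> = ext_d (ext_dc J \<alpha>)"

definition ddc_plus_dcd ::
    "('m, 'e::real_normed_vector) endo_field \<Rightarrow> ('m, 'e) form \<Rightarrow> ('m, 'e) form"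
  where "ddc_plus_dcd J \<alpha> = ext_d (ext_dc J \<alpha>) + ext_dc J (ext_d \<alpha>)"


section \<open>Graded algebras and graded modules\<close>

definition complex_ring :: "complex ring"
  where "complex_ring = \<lparr>carrier = UNIV, monoid.mult = (*), one = 1, zero = 0, add = (+)\<rparr>"

text \<open>The multiplicative fields of a record representing a module play no role.\<close>

definition bilinear_pairing ::
    "('a, 'x) ring_scheme \<Rightarrow> ('a, 'u, 'y) module_scheme \<Rightarrow> ('a, 'v, 'z) module_scheme \<Rightarrow>
     ('a, 'w, 't) module_scheme \<Rightarrow> ('u \<Rightarrow> 'v \<Rightarrow> 'w) \<Rightarrow> bool"
  where "bilinear_pairing K U V W f \<longleftrightarrow>
    (\<forall>x\<in>carrier U. \<forall>y\<in>carrier V. f x y \<in> carrier W) \<and>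
    (\<forall>x\<in>carrier U. \<forall>x'\<in>carrier U. \<forall>y\<in>carrier V.
       f (x \<oplus>\<^bsub>U\<^esub> x') y = f x y \<oplus>\<^bsub>W\<^esub> f x' y) \<and>
    (\<forall>x\<in>carrier U. \<forall>y\<in>carrier V. \<forall>y'\<in>carrier V.
       f x (y \<oplus>\<^bsub>V\<^esub> y') = f x y \<oplus>\<^bsub>W\<^esub> f x y') \<and>
    (\<forall>a\<in>carrier K. \<forall>x\<in>carrier U. \<forall>y\<in>carrier V.
       f (a \<odot>\<^bsub>U\<^esub> x) y = a \<odot>\<^bsub>W\<^esub> f x y \<and> f x (a \<odot>\<^bsub>V\<^esub> y) = a \<odot>\<^bsub>W\<^esub> f x y)"

locale graded_algebra =
  fixes K :: "('a, 'x) ring_scheme"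
    and R :: "int \<Rightarrow> ('a, 'r) module"
    and mul :: "int \<Rightarrow> int \<Rightarrow> 'r \<Rightarrow> 'r \<Rightarrow> 'r"
    and e :: 'r
  assumes component_module: "Module.module K (R k)"
    and mul_bilinear: "bilinear_pairing K (R k) (R l) (R (k + l)) (mul k l)"
    and mul_assoc: "\<lbrakk>x \<in> carrier (R k); y \<in> carrier (R l); z \<in> carrier (R n)\<rbrakk> \<Longrightarrow>
      mul (k + l) n (mul k l x y) z = mul k (l + n) x (mul l n y z)"
    and unit_closed: "e \<in> carrier (R 0)"
    and unit_left: "x \<in> carrier (R k) \<Longrightarrow> mul 0 k e x = x"
    and unit_right: "x \<in> carrier (R k) \<Longrightarrow> mul k 0 x e = x"

locale graded_module = graded_algebra K R mul e
  for K :: "('a, 'x) ring_scheme"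
    and R :: "int \<Rightarrow> ('a, 'r) module"
    and mul :: "int \<Rightarrow> int \<Rightarrow> 'r \<Rightarrow> 'r \<Rightarrow> 'r"
    and e :: 'r +
  fixes M :: "int \<Rightarrow> ('a, 's) module"
    and act :: "int \<Rightarrow> int \<Rightarrow> 'r \<Rightarrow> 's \<Rightarrow> 's"
  assumes act_component_module: "Module.module K (M k)"
    and act_bilinear: "bilinear_pairing K (R k) (M l) (M (k + l)) (act k l)"
    and act_assoc: "\<lbrakk>x \<in> carrier (R k); y \<in> carrier (R l); u \<in> carrier (M n)\<rbrakk> \<Longrightarrow>
      act (k + l) n (mul k l x y) u = act k (l + n) x (act l n y u)"
    and act_unit: "u \<in> carrier (M k) \<Longrightarrow> act 0 k e u = u"


section \<open>Bott-Chern and Aeppli cohomology\<close>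

text \<open>
  Elements of a quotient by a subgroup \<open>N\<close> are the cosets \<open>x +o N\<close>. Their sum is the sum of sets
  \<open>P + Q = {p + q | p \<in> P, q \<in> Q}\<close>, and \<open>N\<close> is the zero element. If \<open>f\<close> is additive and maps
  \<open>N'\<close> to \<open>N\<close>, then \<open>induced N f\<close> maps \<open>x +o N'\<close> to \<open>f x +o N\<close>.
\<close>

definition induced :: "'b::plus set \<Rightarrow> ('a \<Rightarrow> 'b) \<Rightarrow> 'a set \<Rightarrow> 'b set"
  where "induced N f P = f ` P + N"

context
  fixes \<A> :: "('m, 'e::real_inner) chart set" and J :: "('m, 'e) endo_field"
begin

definition B_space :: "int \<Rightarrow> ('m, 'e) form set"
  where "B_space k = {\<alpha> \<in> forms \<A> k. ddc_plus_dcd J \<alpha> = 0}"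

definition BC_cocycles :: "int \<Rightarrow> ('m, 'e) form set"
  where "BC_cocycles k = {\<alpha> \<in> B_space k. ext_d \<alpha> = 0} \<inter> {\<alpha> \<in> B_space k. ext_dc J \<alpha> = 0}"

definition BC_boundaries :: "int \<Rightarrow> ('m, 'e) form set"
  where "BC_boundaries k = ddc J ` B_space (k - 2)"

definition BC_class :: "int \<Rightarrow> ('m, 'e) form \<Rightarrow> ('m, 'e) form set"
  where "BC_class k \<alpha> = \<alpha> +o BC_boundaries k"

definition BC_cohomology :: "int \<Rightarrow> (complex, ('m, 'e) form set) module"
  where "BC_cohomology k =
    \<lparr>carrier = BC_class k ` BC_cocycles k, monoid.mult = undefined, one = undefined,
     zero = BC_boundaries k, add = (+), module.smult = (\<lambda>z. induced (BC_boundaries k) (scale z))\<rparr>"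

definition C_zero :: "int \<Rightarrow> ('m, 'e) form set"
  where "C_zero k = ddc_plus_dcd J ` forms \<A> (k - 2)"

definition C_class :: "int \<Rightarrow> ('m, 'e) form \<Rightarrow> ('m, 'e) form set"
  where "C_class k \<gamma> = \<gamma> +o C_zero k"

definition C_space :: "int \<Rightarrow> ('m, 'e) form set set"
  where "C_space k = C_class k ` forms \<A> k"

definition A_cocycles :: "int \<Rightarrow> ('m, 'e) form set set"
  where "A_cocycles k = {P \<in> C_space k. induced (C_zero (k + 2)) (ddc J) P = C_zero (k + 2)}"

text \<open>The sum of the two images, as a set of elements of \<open>C_space k\<close>.\<close>

definition A_boundaries :: "int \<Rightarrow> ('m, 'e) form set set"
  where "A_boundaries k =
    induced (C_zero k) ext_d ` C_space (k - 1) + induced (C_zero k) (ext_dc J) ` C_space (k - 1)"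

definition A_class :: "int \<Rightarrow> ('m, 'e) form \<Rightarrow> ('m, 'e) form set set"
  where "A_class k \<gamma> = C_class k \<gamma> +o A_boundaries k"

definition A_cohomology :: "int \<Rightarrow> (complex, ('m, 'e) form set set) module"
  where "A_cohomology k =
    \<lparr>carrier = (\<lambda>P. P +o A_boundaries k) ` A_cocycles k, monoid.mult = undefined, one = undefined,
     zero = A_boundaries k, add = (+),
     module.smult = (\<lambda>z. induced (A_boundaries k) (induced (C_zero k) (scale z)))\<rparr>"

end

end

theory Submission
  imports Defs
begin

text \<open>
  The operators \<open>d\<close> and \<open>d\<^sup>c\<close> are odd derivations of square zero, so their graded commutator
  \<open>D = dd\<^sup>c + d\<^sup>cd\<close> is an even derivation commuting with both. If \<open>d\<alpha> = d\<^sup>c\<alpha> = 0\<close> and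
  \<open>dd\<^sup>c\<gamma> = D\<xi>\<close>, then \<open>dd\<^sup>c(\<alpha> \<and> \<gamma>) = \<alpha> \<and> dd\<^sup>c\<gamma> = D(\<alpha> \<and> \<xi>)\<close>, and \<open>\<alpha> \<and> d\<mu> = \<plusminus>d(\<alpha> \<and> \<mu>)\<close>, likewise
  for \<open>d\<^sup>c\<close>. If moreover \<open>\<alpha> = dd\<^sup>c\<eta>\<close> with \<open>D\<eta> = 0\<close>, then \<open>\<alpha> \<and> \<gamma>\<close> differs from \<open>- \<eta> \<and> d\<^sup>cd\<gamma>\<close> by an
  element of \<open>Im d + Im d\<^sup>c\<close>, and \<open>\<eta> \<and> d\<^sup>cd\<gamma> = \<eta> \<and> D(\<gamma> - \<xi>) = D(\<eta> \<and> (\<gamma> - \<xi>))\<close>.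

  The identities for \<open>d\<close> and \<open>\<and>\<close> in a chart are proved by induction on the list of tangent vectors,
  using that contraction with a vector is an antiderivation of the wedge product and Cartan's formula
  for constant vector fields.
\<close>

section \<open>Shuffle products of functions of lists\<close>

text \<open>Nothing makes \<open>D\<close> vanish, since \<open>J\<close> need not be integrable; so
  an Aeppli cocycle has \<open>dd\<^sup>c\<gamma>\<close> equal to some \<open>D\<xi>\<close> rather
  than \<open>0\<close>, and each step must absorb such a term. This works because \<open>D\<close>
  is a derivation that kills Bott-Chern cocycles and elements of \<open>B_space\<close>, so wedging
  with these maps the image of \<open>D\<close> to itself. The image of \<open>D\<close> also lies
  in \<open>Im d + Im d\<^sup>c\<close>. Hence the quotient of a quotient that defines the Aeppli
  groups can be described by forms alone: those with \<open>dd\<^sup>c\<gamma>\<close> in the image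
  of \<open>D\<close>, modulo \<open>Im d + Im d\<^sup>c\<close>.

  A form is a family of chart representatives, so \<open>d\<close> must be shown to respect changes
  of charts. This is where alternation and the symmetry of second derivatives enter. The tangent
  vectors cannot be held fixed there, as the transition derivative varies with the point; the same
  happens with \<open>J\<close>. Only \<open>d\<close> is studied in charts;
  \<open>d\<^sup>c\<close> is its conjugate by an automorphism of the wedge algebra and inherits its
  rules.\<close>

definition contract :: "'v \<Rightarrow> ('v list \<Rightarrow> 'r) \<Rightarrow> 'v list \<Rightarrow> 'r"
  where "contract v f = (\<lambda>vs. f (v # vs))"

text \<open>The parity involution. Reading the sign off the length of the list makes sense for
  functions of mixed degree.\<close>

definition grade :: "('v list \<Rightarrow> 'r::comm_ring_1) \<Rightarrow> 'v list \<Rightarrow> 'r"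
  where "grade f = (\<lambda>vs. (-1) ^ length vs * f vs)"

text \<open>The second equation is the antiderivation rule for \<open>contract v\<close>, read as a
  definition. Identities below are proved for all \<open>f\<close> and \<open>g\<close> at once, so
  that the induction hypothesis applies to contracted and graded factors.\<close>

fun shuffle_prod :: "('v list \<Rightarrow> 'r::comm_ring_1) \<Rightarrow> ('v list \<Rightarrow> 'r) \<Rightarrow> 'v list \<Rightarrow> 'r"
  where
    "shuffle_prod f g [] = f [] * g []"
  | "shuffle_prod f g (v # vs) =
      shuffle_prod (contract v f) g vs + shuffle_prod (grade f) (contract v g) vs"

lemma contract_apply: "contract v f vs = f (v # vs)"
  by (simp add: contract_def)

lemma contract_add [simp]: "contract v (f + g) = contract v f + contract v g"
  and contract_zero [simp]: "contract v 0 = 0"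
  and contract_cmult [simp]: "contract v (\<lambda>vs. z * f vs) = (\<lambda>vs. z * contract v f vs)"
  by (auto simp: fun_eq_iff contract_apply)

lemma contract_map [simp]: "contract v (\<lambda>vs. f (map L vs)) = (\<lambda>vs. contract (L v) f (map L vs))"
  by (auto simp: fun_eq_iff contract_apply)

lemma grade_Nil [simp]: "grade f [] = f []"
  and grade_grade [simp]: "grade (grade f) = f"
  and grade_add [simp]: "grade (f + g) = grade f + grade g"
  and grade_uminus [simp]: "grade (- f) = - grade f"
  and grade_zero [simp]: "grade 0 = 0"
  and grade_cmult [simp]: "grade (\<lambda>vs. z * f vs) = (\<lambda>vs. z * grade f vs)"
  and contract_grade [simp]: "contract v (grade f) = - grade (contract v f)"
  by (auto simp: fun_eq_iff grade_def contract_apply algebra_simps simp flip: power_add mult.assoc mult_2)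

lemma grade_map [simp]: "grade (\<lambda>vs. f (map L vs)) = (\<lambda>vs. grade f (map L vs))"
  by (auto simp: fun_eq_iff grade_def)

lemma shuffle_prod_Cons:
  "contract v (shuffle_prod f g) = shuffle_prod (contract v f) g + shuffle_prod (grade f) (contract v g)"
  by (simp add: fun_eq_iff contract_apply)

lemma shuffle_prod_zero_left [simp]: "shuffle_prod 0 g = 0"
proof
  show "shuffle_prod 0 g vs = 0 vs" for vs
    by (induction vs arbitrary: g) auto
qed

lemma shuffle_prod_zero_right [simp]: "shuffle_prod f 0 = 0"
proof
  show "shuffle_prod f 0 vs = 0 vs" for vs
    by (induction vs arbitrary: f) auto
qed

lemma shuffle_prod_add_left: "shuffle_prod (f + f') g = shuffle_prod f g + shuffle_prod f' g"
proof
  show "shuffle_prod (f + f') g vs = (shuffle_prod f g + shuffle_prod f' g) vs" for vs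
    by (induction vs arbitrary: f f' g) (auto simp: algebra_simps)
qed

lemma shuffle_prod_add_right: "shuffle_prod f (g + g') = shuffle_prod f g + shuffle_prod f g'"
proof
  show "shuffle_prod f (g + g') vs = (shuffle_prod f g + shuffle_prod f g') vs" for vs
    by (induction vs arbitrary: f g g') (auto simp: algebra_simps)
qed

lemma shuffle_prod_cmult_left: "shuffle_prod (\<lambda>vs. z * f vs) g = (\<lambda>vs. z * shuffle_prod f g vs)"
proof
  show "shuffle_prod (\<lambda>vs. z * f vs) g vs = z * shuffle_prod f g vs" for vs
    by (induction vs arbitrary: f g) (auto simp: algebra_simps)
qed

lemma shuffle_prod_cmult_right: "shuffle_prod f (\<lambda>vs. z * g vs) = (\<lambda>vs. z * shuffle_prod f g vs)"
proof
  show "shuffle_prod f (\<lambda>vs. z * g vs) vs = z * shuffle_prod f g vs" for vs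
    by (induction vs arbitrary: f g) (auto simp: algebra_simps)
qed

lemma shuffle_prod_uminus_left: "shuffle_prod (- f) g = - shuffle_prod f g"
  using shuffle_prod_cmult_left[of "-1" f g] by (simp add: fun_Compl_def)

lemma shuffle_prod_uminus_right: "shuffle_prod f (- g) = - shuffle_prod f g"
  using shuffle_prod_cmult_right[of f "-1" g] by (simp add: fun_Compl_def)

text \<open>Contraction anticommutes with \<open>grade\<close>, which puts the same sign on both
  sides after the head has been contracted.\<close>

lemma grade_shuffle_prod: "grade (shuffle_prod f g) = shuffle_prod (grade f) (grade g)"
proof
  show "grade (shuffle_prod f g) vs = shuffle_prod (grade f) (grade g) vs" for vs
  proof (induction vs arbitrary: f g)
    case (Cons v vs)
    have "grade (shuffle_prod f g) (v # vs) = - grade (contract v (shuffle_prod f g)) vs"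
      by (simp add: grade_def contract_apply)
    then show ?case
      by (simp add: shuffle_prod_Cons Cons shuffle_prod_uminus_left shuffle_prod_uminus_right)
  qed simp
qed

text \<open>After contraction both sides have three terms, with \<open>v\<close> passed to
  \<open>f\<close>, \<open>g\<close> or \<open>h\<close>. In the third, the left side carries
  \<open>grade\<close> of a product, which \<open>grade_shuffle_prod\<close> distributes over the
  factors.\<close>

lemma shuffle_prod_assoc:
  "shuffle_prod (shuffle_prod f g) h = shuffle_prod f (shuffle_prod g h)"
proof
  show "shuffle_prod (shuffle_prod f g) h vs = shuffle_prod f (shuffle_prod g h) vs" for vs
  proof (induction vs arbitrary: f g h)
    case (Cons v vs)
    then show ?case
      by (simp add: shuffle_prod_Cons shuffle_prod_add_left shuffle_prod_add_right grade_shuffle_prod)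
  qed simp
qed

text \<open>The recursion sees vectors only through contraction, and contracting a substituted
  function with \<open>v\<close> is contracting the original one with \<open>L v\<close>. This
  serves both for changes of charts and for the action of \<open>J\<close>.\<close>

lemma shuffle_prod_map:
  "shuffle_prod (\<lambda>vs. f (map L vs)) (\<lambda>vs. g (map L vs)) vs = shuffle_prod f g (map L vs)"
  by (induction vs arbitrary: f g) auto

definition empty_list_indicator :: "'v list \<Rightarrow> 'r::comm_ring_1"
  where "empty_list_indicator vs = (if vs = [] then 1 else 0)"

lemma contract_empty_list_indicator [simp]: "contract v empty_list_indicator = 0"
  and grade_empty_list_indicator [simp]: "grade empty_list_indicator = empty_list_indicator"
  by (auto simp: empty_list_indicator_def fun_eq_iff grade_def contract_apply)

lemma shuffle_prod_unit_left: "shuffle_prod empty_list_indicator g = g"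
proof
  show "shuffle_prod empty_list_indicator g vs = g vs" for vs
    by (induction vs arbitrary: g) (auto simp: empty_list_indicator_def contract_apply)
qed

lemma shuffle_prod_unit_right: "shuffle_prod f empty_list_indicator = f"
proof
  show "shuffle_prod f empty_list_indicator vs = f vs" for vs
    by (induction vs arbitrary: f) (auto simp: empty_list_indicator_def contract_apply)
qed

text \<open>Integer degrees spare a case split under contraction: from degree \<open>0\<close> it
  leads to degree \<open>-1\<close>, where only the zero function is homogeneous.\<close>

definition homogeneous :: "int \<Rightarrow> ('v list \<Rightarrow> 'r::zero) \<Rightarrow> bool"
  where "homogeneous k f \<longleftrightarrow> (\<forall>vs. int (length vs) \<noteq> k \<longrightarrow> f vs = 0)"

lemma homogeneous_contract: "homogeneous k f \<Longrightarrow> homogeneous (k - 1) (contract v f)"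
  and homogeneous_grade: "homogeneous k g \<Longrightarrow> homogeneous k (grade g)"
  by (auto simp: homogeneous_def grade_def contract_apply)

lemma homogeneous_shuffle_prod:
  assumes "homogeneous k f" "homogeneous l g"
  shows "homogeneous (k + l) (shuffle_prod f g)"
proof -
  have "shuffle_prod f g vs = 0" if "int (length vs) \<noteq> k + l" for vs
    using assms that
  proof (induction vs arbitrary: f g k l)
    case Nil
    then show ?case by (cases "k = 0") (auto simp: homogeneous_def)
  next
    case (Cons v vs)
    have "shuffle_prod (contract v f) g vs = 0"
      using Cons.prems homogeneous_contract[of k f v]
      by (intro Cons.IH[of "k - 1" _ l]) auto
    moreover have "shuffle_prod (grade f) (contract v g) vs = 0"
      using Cons.prems homogeneous_contract[of l g v]
      by (intro Cons.IH[of k _ "l - 1"] homogeneous_grade) auto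
    ultimately show ?case by simp
  qed
  then show ?thesis by (simp add: homogeneous_def)
qed

text \<open>Removing position \<open>0\<close> from the shuffle \<open>S\<close> gives the recursion of \<open>shuffle_prod\<close>: if \<open>0\<close> is
  not in \<open>S\<close>, it is inverted with every element of \<open>S\<close>.\<close>

lemma shuffle_prod_eq_sum:
  "shuffle_prod f g vs = (\<Sum>S\<in>Pow {..<length vs}.
    (-1) ^ card {(i, j). i \<in> {..<length vs} - S \<and> j \<in> S \<and> i < j} * f (nths vs S) * g (nths vs (- S)))"
proof (induction vs arbitrary: f g)
  case (Cons v vs)
  define n where "n = length vs"
  define invs where "invs = (\<lambda>n S. {(i, j). i \<in> {..<n::nat} - S \<and> j \<in> S \<and> i < (j::nat)})"
  define T where "T = (\<lambda>S. (-1) ^ card (invs (Suc n) S) * f (nths (v # vs) S) * g (nths (v # vs) (- S)))"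
  have Pow: "Pow {..<Suc n} = image Suc ` Pow {..<n} \<union> (\<lambda>S. insert 0 (Suc ` S)) ` Pow {..<n}"
    by (simp only: lessThan_Suc_eq_insert_0 Pow_insert image_image image_Pow_surj[OF refl, symmetric])
  have inj: "inj_on (image Suc) (Pow {..<n})" "inj_on (\<lambda>S. insert 0 (Suc ` S)) (Pow {..<n})"
    by (auto simp: inj_on_def)
  have fin: "finite (invs n S)" if "S \<subseteq> {..<n}" for S
    by (rule finite_subset[of _ "{..<n} \<times> {..<n}"]) (use that in \<open>auto simp: invs_def\<close>)
  have finS: "finite S" if "S \<subseteq> {..<n}" for S
    using that finite_subset by blast
  have inv1: "invs (Suc n) (insert 0 (Suc ` S)) = (\<lambda>(i, j). (Suc i, Suc j)) ` invs n S" for S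
  proof (rule Set.set_eqI)
    fix p :: "nat \<times> nat"
    obtain i j where p: "p = (i, j)" by fastforce
    show "(p \<in> invs (Suc n) (insert 0 (Suc ` S))) = (p \<in> (\<lambda>(i, j). (Suc i, Suc j)) ` invs n S)"
      unfolding p by (cases i; cases j) (auto simp: invs_def image_iff)
  qed
  have inv0: "invs (Suc n) (Suc ` S) = (\<lambda>(i, j). (Suc i, Suc j)) ` invs n S \<union> (\<lambda>j. (0, Suc j)) ` S" for S
  proof (rule Set.set_eqI)
    fix p :: "nat \<times> nat"
    obtain i j where p: "p = (i, j)" by fastforce
    show "(p \<in> invs (Suc n) (Suc ` S)) =
        (p \<in> (\<lambda>(i, j). (Suc i, Suc j)) ` invs n S \<union> (\<lambda>j. (0, Suc j)) ` S)"
      unfolding p by (cases i; cases j) (auto simp: invs_def image_iff)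
  qed
  have card_Suc_pairs: "card ((\<lambda>(i, j). (Suc i, Suc j)) ` P) = card P" for P
    by (rule card_image) (auto simp: inj_on_def)
  have card1: "card (invs (Suc n) (insert 0 (Suc ` S))) = card (invs n S)" for S
    by (simp add: inv1 card_Suc_pairs)
  have card0: "card (invs (Suc n) (Suc ` S)) = card (invs n S) + card S" if "S \<subseteq> {..<n}" for S
    unfolding inv0
    by (subst card_Un_disjoint)
      (auto simp: card_Suc_pairs card_image inj_on_def fin[OF that] finS[OF that])
  have nths1: "nths (v # vs) (insert 0 (Suc ` S)) = v # nths vs S"
      "nths (v # vs) (- insert 0 (Suc ` S)) = nths vs (- S)"
      "nths (v # vs) (Suc ` S) = nths vs S"
      "nths (v # vs) (- Suc ` S) = v # nths vs (- S)" for S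
    by (auto simp: nths_Cons image_iff intro!: arg_cong2[where f = nths])
  \<comment> \<open>Turns the \<open>card S\<close> additional inversions into the sign of
    \<open>grade f\<close>, which is given by the length of the list passed to
    \<open>f\<close>.\<close>
  have len: "length (nths vs S) = card S" if "S \<subseteq> {..<n}" for S
    unfolding length_nths by (rule arg_cong[where f = card]) (use that n_def in auto)
  have "(\<Sum>S\<in>Pow {..<Suc n}. T S) = (\<Sum>S\<in>Pow {..<n}. T (Suc ` S)) + (\<Sum>S\<in>Pow {..<n}. T (insert 0 (Suc ` S)))"
    unfolding Pow
  proof (subst sum.union_disjoint)
    show "image Suc ` Pow {..<n} \<inter> (\<lambda>S. insert 0 (Suc ` S)) ` Pow {..<n} = {}"
      by auto
  qed (simp_all add: sum.reindex[OF inj(1)] sum.reindex[OF inj(2)])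
  also have "(\<Sum>S\<in>Pow {..<n}. T (insert 0 (Suc ` S))) = shuffle_prod (contract v f) g vs"
    unfolding Cons by (rule sum.cong) (auto simp: T_def card1 nths1 contract_apply n_def[symmetric] invs_def[symmetric], simp add: invs_def)
  also have "(\<Sum>S\<in>Pow {..<n}. T (Suc ` S)) = shuffle_prod (grade f) (contract v g) vs"
    unfolding Cons
    by (rule sum.cong) (auto simp: T_def card0 nths1 len grade_def contract_apply power_add n_def[symmetric] invs_def[symmetric], simp add: invs_def)
  finally show ?case
    by (simp add: T_def invs_def n_def add.commute)
qed auto

lemma wedge_eq_shuffle_prod: "wedge \<alpha> \<beta> = (\<lambda>c x. shuffle_prod (\<alpha> c x) (\<beta> c x))"
  by (simp add: wedge_def shuffle_prod_eq_sum fun_eq_iff)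

section \<open>Multilinear and alternating functions of lists\<close>

definition mlin :: "('v::real_vector list \<Rightarrow> 'r::real_vector) \<Rightarrow> bool"
  where "mlin f \<longleftrightarrow> (\<forall>us vs. linear (\<lambda>v. f (us @ v # vs)))"

text \<open>Only neighbouring equal arguments are considered, which suits induction on lists;
  \<open>alt_iff_repeated\<close> relates this to arbitrary positions.\<close>

definition alt :: "('v list \<Rightarrow> 'r::zero) \<Rightarrow> bool"
  where "alt f \<longleftrightarrow> (\<forall>us v vs. f (us @ v # v # vs) = 0)"

text \<open>\<open>forms\<close> addresses a slot by its index. Splitting the list instead lets
  linearity pass to contractions by extending the prefix \<open>us\<close>.\<close>

lemma mlin_iff_update: "mlin f \<longleftrightarrow> (\<forall>vs. \<forall>i<length vs. linear (\<lambda>v. f (vs[i := v])))"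
proof (intro iffI allI impI)
  fix vs :: "'a list" and i assume "mlin f" "i < length vs"
  then show "linear (\<lambda>v. f (vs[i := v]))"
    by (simp add: mlin_def upd_conv_take_nth_drop)
next
  assume *: "\<forall>vs. \<forall>i<length vs. linear (\<lambda>v. f (vs[i := v]))"
  show "mlin f"
    unfolding mlin_def
  proof (intro allI)
    fix us vs
    show "linear (\<lambda>v. f (us @ v # vs))"
      using *[rule_format, of "length us" "us @ 0 # vs"] by (simp add: list_update_append)
  qed
qed

lemma mlin_contract: "mlin f \<Longrightarrow> mlin (contract v f)"
  by (auto simp: mlin_def contract_apply simp flip: append_Cons)

lemma mlin_head: "mlin f \<Longrightarrow> linear (\<lambda>v. f (v # vs))"
  by (drule mlin_def[THEN iffD1, rule_format, of _ "[]"]) simp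

lemma mlin_grade: "mlin f \<Longrightarrow> mlin (grade f)"
  for f :: "'v::real_vector list \<Rightarrow> complex"
  by (auto simp: mlin_def grade_def linear_iff algebra_simps)

lemma alt_contract: "alt f \<Longrightarrow> alt (contract v f)"
  by (auto simp: alt_def contract_apply simp flip: append_Cons)

lemma alt_grade: "alt f \<Longrightarrow> alt (grade f)"
  by (auto simp: alt_def grade_def)

lemma alt_head: "alt f \<Longrightarrow> f (v # v # vs) = 0"
  unfolding alt_def by (metis append_Nil)

text \<open>In the head slot, \<open>contract v f\<close> and \<open>contract v g\<close> are linear
  in \<open>v\<close> and the product is bilinear. The recursion moves any other slot towards the
  head, replacing the factors by contracted or graded ones.\<close>

lemma mlin_shuffle_prod:
  fixes f g :: "'v::real_vector list \<Rightarrow> complex"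
  assumes "mlin f" "mlin g"
  shows "mlin (shuffle_prod f g)"
proof -
  have "linear (\<lambda>v. shuffle_prod f g (us @ v # vs))" for us vs
    using assms
  proof (induction us arbitrary: f g)
    case Nil
    have f: "contract (a + b) f = contract a f + contract b f"
        "contract (r *\<^sub>R a) f = (\<lambda>vs. of_real r * contract a f vs)" for a b r
      using mlin_head[OF Nil(1)] by (auto simp: linear_iff fun_eq_iff scaleR_conv_of_real contract_apply)
    have g: "contract (a + b) g = contract a g + contract b g"
        "contract (r *\<^sub>R a) g = (\<lambda>vs. of_real r * contract a g vs)" for a b r
      using mlin_head[OF Nil(2)] by (auto simp: linear_iff fun_eq_iff scaleR_conv_of_real contract_apply)
    show ?case
      by (auto simp: linear_iff f g shuffle_prod_add_left shuffle_prod_add_right shuffle_prod_cmult_left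
          shuffle_prod_cmult_right scaleR_conv_of_real algebra_simps)
  next
    case (Cons u us)
    then show ?case
      by (auto intro!: linear_compose_add Cons.IH mlin_contract mlin_grade)
  qed
  then show ?thesis by (simp add: mlin_def)
qed

lemma contract_contract_same: "alt f \<Longrightarrow> contract v (contract v f) = 0"
  by (auto simp: fun_eq_iff contract_apply alt_head)

text \<open>Contracting twice with \<open>v\<close> leaves the cross terms with left factors
  \<open>grade (contract v f)\<close> and \<open>contract v (grade f)\<close>, both with right
  factor \<open>contract v g\<close>. They cancel because contraction anticommutes with
  \<open>grade\<close>.\<close>

lemma alt_shuffle_prod:
  fixes f g :: "'v list \<Rightarrow> 'r::comm_ring_1"
  assumes "alt f" "alt g"
  shows "alt (shuffle_prod f g)"
proof -
  have "shuffle_prod f g (us @ v # v # vs) = 0" for us v vs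
    using assms
  proof (induction us arbitrary: f g)
    case Nil
    then show ?case
      by (simp add: contract_contract_same shuffle_prod_uminus_left)
  next
    case (Cons u us)
    then show ?case by (simp add: alt_contract alt_grade)
  qed
  then show ?thesis by (simp add: alt_def)
qed

text \<open>Polarization: the value with \<open>v + w\<close> in both slots vanishes and is
  expanded.\<close>

lemma alt_swap:
  fixes f :: "'v::real_vector list \<Rightarrow> complex"
  assumes "mlin f" "alt f"
  shows "f (us @ v # w # vs) = - f (us @ w # v # vs)"
proof -
  have add: "f (us @ (a + b) # vs) = f (us @ a # vs) + f (us @ b # vs)" for us a b vs
    using assms(1) by (simp add: mlin_def linear_iff)
  have "0 = f (us @ (v + w) # (v + w) # vs)"
    using assms(2) by (simp add: alt_def)
  also have "\<dots> = f (us @ v # (v + w) # vs) + f (us @ w # (v + w) # vs)"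
    by (rule add)
  also have "\<dots> = f (us @ v # w # vs) + f (us @ w # v # vs)"
    using add[of "us @ [v]" v w vs] add[of "us @ [w]" v w vs] assms(2) by (simp add: alt_def)
  finally show ?thesis by (simp add: eq_neg_iff_add_eq_0)
qed

lemma alt_move_front:
  fixes f :: "'v::real_vector list \<Rightarrow> complex"
  assumes "mlin f" "alt f"
  shows "f (us @ w # ws) = (-1) ^ length us * f (w # us @ ws)"
  using assms
proof (induction us arbitrary: f)
  case (Cons u us)
  have "contract u f (us @ w # ws) = (-1) ^ length us * contract u f (w # us @ ws)"
    using Cons.prems by (intro Cons.IH mlin_contract alt_contract)
  then have "f ((u # us) @ w # ws) = (-1) ^ length us * f (u # w # us @ ws)"
    by (simp add: contract_apply)
  also have "f (u # w # us @ ws) = - f (w # u # us @ ws)"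
    using alt_swap[OF Cons.prems, of "[]" u w "us @ ws"] by simp
  finally show ?case by simp
qed simp

lemma alt_iff_repeated:
  fixes f :: "'v::real_vector list \<Rightarrow> complex"
  assumes "mlin f"
  shows "alt f \<longleftrightarrow> (\<forall>vs i j. i < j \<and> j < length vs \<and> vs ! i = vs ! j \<longrightarrow> f vs = 0)"
proof (intro iffI allI impI)
  assume *: "\<forall>vs i j. i < j \<and> j < length vs \<and> vs ! i = vs ! j \<longrightarrow> f vs = 0"
  show "alt f"
    unfolding alt_def
  proof (intro allI)
    fix us v vs
    show "f (us @ v # v # vs) = 0"
      using *[rule_format, of "length us" "Suc (length us)" "us @ v # v # vs"] by (simp add: nth_append)
  qed
next
  fix vs :: "'v list" and i j
  assume "alt f" and ij: "i < j \<and> j < length vs \<and> vs ! i = vs ! j"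
  define us where "us = take i vs"
  define ms where "ms = take (j - Suc i) (drop (Suc i) vs)"
  have "drop (Suc i) vs = ms @ vs ! j # drop (Suc j) vs"
    using ij id_take_nth_drop[of "j - Suc i" "drop (Suc i) vs"]
    by (auto simp: ms_def less_diff_iff)
  then have vs: "vs = us @ vs ! j # ms @ vs ! j # drop (Suc j) vs"
    using ij id_take_nth_drop[of i vs] by (simp add: us_def)
  have g: "mlin (\<lambda>ws. f (us @ ws))" "alt (\<lambda>ws. f (us @ ws))"
    using assms \<open>alt f\<close> unfolding mlin_def alt_def
    by (simp_all flip: append_assoc)
  \<comment> \<open>The second \<open>v\<close> is moved left across \<open>v # ms\<close> until it
    stands next to the first. The prefix \<open>us\<close> stays in place because the move is made
    in the function \<open>\<lambda>ws. f (us @ ws)\<close>.\<close>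
  have "f (us @ (v # ms) @ v # ws) = 0" for v ws
    using alt_move_front[OF g, of "v # ms" v ws] alt_head[OF g(2), of v "ms @ ws"] by simp
  then show "f vs = 0"
    by (subst vs) simp
qed

section \<open>Smooth functions\<close>

lemma smooth_on_differentiable: "smooth_on S f \<Longrightarrow> x \<in> S \<Longrightarrow> f differentiable (at x)"
  by (erule smooth_on.cases) simp

lemma smooth_on_has_derivative:
  "smooth_on S f \<Longrightarrow> x \<in> S \<Longrightarrow> (f has_derivative frechet_derivative f (at x)) (at x)"
  by (simp add: smooth_on_differentiable flip: frechet_derivative_works)

lemma smooth_on_frechet_derivative: "smooth_on S f \<Longrightarrow> smooth_on S (\<lambda>x. frechet_derivative f (at x) v)"
  by (erule smooth_on.cases) simp

lemma frechet_derivative_eqI: "(f has_derivative f') (at x) \<Longrightarrow> frechet_derivative f (at x) = f'"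
  by (rule frechet_derivative_at[symmetric])

lemma has_derivative_cong_open:
  assumes "(f has_derivative f') (at x)" "open S" "x \<in> S" "\<And>y. y \<in> S \<Longrightarrow> g y = f y"
  shows "(g has_derivative f') (at x)"
  using has_derivative_transform_within_open[OF assms(1-3), of g] assms(4) by simp

lemma frechet_derivative_cong_open:
  assumes "open S" "x \<in> S" "\<And>y. y \<in> S \<Longrightarrow> g y = f y"
  shows "frechet_derivative g (at x) = frechet_derivative f (at x)"
proof -
  have "(g has_derivative f') (at x) \<longleftrightarrow> (f has_derivative f') (at x)" for f'
    using has_derivative_cong_open[OF _ assms(1,2)] assms(3) by metis
  then show ?thesis by (simp add: frechet_derivative_def)
qed

section \<open>Closure properties of smooth functions\<close>

lemma smooth_on_const: "smooth_on S (\<lambda>x. a)"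
proof -
  have "\<exists>a. f = (\<lambda>x. a) \<Longrightarrow> smooth_on S f" for f :: "'a \<Rightarrow> 'b"
  proof (coinduction arbitrary: f rule: smooth_on.coinduct)
    case smooth_on
    then show ?case
      by (auto simp: frechet_derivative_eqI[OF has_derivative_const])
  qed
  then show ?thesis by blast
qed

text \<open>The coinductive invariant asks for agreement on \<open>S\<close> only: openness of
  \<open>S\<close> lets the derivative be computed there, while off \<open>S\<close> nothing is
  known about \<open>g\<close>. The identity as \<open>L\<close> then gives
  \<open>smooth_on_cong\<close>.\<close>

lemma smooth_on_bounded_linear:
  assumes "bounded_linear L" "open S" "smooth_on S f" "\<And>x. x \<in> S \<Longrightarrow> g x = L (f x)"
  shows "smooth_on S g"
proof -
  have "\<exists>f. smooth_on S f \<and> (\<forall>x\<in>S. g x = L (f x)) \<Longrightarrow> smooth_on S g" for g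
  proof (coinduction arbitrary: g rule: smooth_on.coinduct)
    case (smooth_on g)
    then obtain f where f: "smooth_on S f" "\<And>x. x \<in> S \<Longrightarrow> g x = L (f x)" by blast
    have g: "(g has_derivative (\<lambda>v. L (frechet_derivative f (at x) v))) (at x)" if "x \<in> S" for x
      by (rule has_derivative_cong_open[OF bounded_linear.has_derivative[OF assms(1)
              smooth_on_has_derivative[OF f(1) that]] assms(2) that]) (rule f(2))
    then have "\<forall>x\<in>S. g differentiable (at x)"
      by (auto simp: differentiable_def)
    moreover have "\<exists>f'. smooth_on S f' \<and> (\<forall>x\<in>S. frechet_derivative g (at x) v = L (f' x))" for v
      by (intro exI[of _ "\<lambda>x. frechet_derivative f (at x) v"] conjI ballI)
        (simp_all add: frechet_derivative_eqI[OF g] smooth_on_frechet_derivative[OF f(1)])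
    ultimately show ?case by simp
  qed
  then show ?thesis using assms by blast
qed

lemma smooth_on_cong: "open S \<Longrightarrow> smooth_on S f \<Longrightarrow> (\<And>x. x \<in> S \<Longrightarrow> g x = f x) \<Longrightarrow> smooth_on S g"
  using smooth_on_bounded_linear[OF bounded_linear_ident] by blast

text \<open>The derivative of a product is a sum of products, so the coinductive invariant has to be
  closed under both operations.\<close>

inductive smooth_generated :: "'a::real_normed_vector set \<Rightarrow> ('a \<Rightarrow> complex) \<Rightarrow> bool"
  for S where
    base: "smooth_on S f \<Longrightarrow> smooth_generated S f"
  | cong: "smooth_generated S f \<Longrightarrow> (\<And>x. x \<in> S \<Longrightarrow> g x = f x) \<Longrightarrow> smooth_generated S g"
  | add: "smooth_generated S f \<Longrightarrow> smooth_generated S g \<Longrightarrow> smooth_generated S (\<lambda>x. f x + g x)"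
  | mult: "smooth_generated S f \<Longrightarrow> smooth_generated S g \<Longrightarrow> smooth_generated S (\<lambda>x. f x * g x)"

text \<open>The formula for each derivative is available on \<open>S\<close> only, so a sum or
  product of generated functions is followed by an application of the rule
  \<open>cong\<close>.\<close>

lemma smooth_generated_derivative:
  assumes "open S" "smooth_generated S f"
  shows "(\<forall>x\<in>S. f differentiable (at x)) \<and> (\<forall>v. smooth_generated S (\<lambda>x. frechet_derivative f (at x) v))"
  using assms(2)
proof induction
  case (base f)
  then show ?case
    by (simp add: smooth_generated.base smooth_on_differentiable smooth_on_frechet_derivative)
next
  case (cong f g)
  have *: "(g has_derivative frechet_derivative f (at x)) (at x)" if "x \<in> S" for x
    by (rule has_derivative_cong_open[OF _ assms(1) that])
      (simp_all add: cong that flip: frechet_derivative_works)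
  have "smooth_generated S (\<lambda>x. frechet_derivative g (at x) v)" for v
    by (rule smooth_generated.cong[of _ "\<lambda>x. frechet_derivative f (at x) v"])
      (simp_all add: cong frechet_derivative_eqI[OF *])
  with * show ?case by (blast intro: differentiableI)
next
  case (add f g)
  have *: "((\<lambda>x. f x + g x) has_derivative
      (\<lambda>v. frechet_derivative f (at x) v + frechet_derivative g (at x) v)) (at x)" if "x \<in> S" for x
    by (intro has_derivative_add) (simp_all add: add that flip: frechet_derivative_works)
  have "smooth_generated S (\<lambda>x. frechet_derivative (\<lambda>x. f x + g x) (at x) v)" for v
    by (rule smooth_generated.cong[OF smooth_generated.add[of _ "\<lambda>x. frechet_derivative f (at x) v"
            "\<lambda>x. frechet_derivative g (at x) v"]])
      (simp_all add: add frechet_derivative_eqI[OF *])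
  with * show ?case by (blast intro: differentiableI)
next
  case (mult f g)
  have *: "((\<lambda>x. f x * g x) has_derivative
      (\<lambda>v. f x * frechet_derivative g (at x) v + frechet_derivative f (at x) v * g x)) (at x)" if "x \<in> S" for x
    by (intro has_derivative_mult) (simp_all add: mult that flip: frechet_derivative_works)
  have "smooth_generated S (\<lambda>x. frechet_derivative (\<lambda>x. f x * g x) (at x) v)" for v
    by (rule smooth_generated.cong[OF smooth_generated.add[OF
            smooth_generated.mult[of _ f "\<lambda>x. frechet_derivative g (at x) v"]
            smooth_generated.mult[of _ "\<lambda>x. frechet_derivative f (at x) v" g]]])
      (simp_all add: mult frechet_derivative_eqI[OF *])
  with * show ?case by (blast intro: differentiableI)
qed

lemma smooth_generated_imp_smooth_on:
  assumes "open S" "smooth_generated S f"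
  shows "smooth_on S f"
  using assms(2)
proof (coinduction arbitrary: f rule: smooth_on.coinduct)
  case smooth_on
  then show ?case using smooth_generated_derivative[OF assms(1), of f] by simp
qed

lemma smooth_on_add:
  fixes f g :: "'a::real_normed_vector \<Rightarrow> complex"
  shows "open S \<Longrightarrow> smooth_on S f \<Longrightarrow> smooth_on S g \<Longrightarrow> smooth_on S (\<lambda>x. f x + g x)"
  by (intro smooth_generated_imp_smooth_on smooth_generated.intros(3)) (simp_all add: smooth_generated.base)

lemma smooth_on_mult:
  fixes f g :: "'a::real_normed_vector \<Rightarrow> complex"
  shows "open S \<Longrightarrow> smooth_on S f \<Longrightarrow> smooth_on S g \<Longrightarrow> smooth_on S (\<lambda>x. f x * g x)"
  by (intro smooth_generated_imp_smooth_on smooth_generated.intros(4)) (simp_all add: smooth_generated.base)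

lemma smooth_on_sum:
  fixes f :: "'i \<Rightarrow> 'a::real_normed_vector \<Rightarrow> complex"
  assumes "open S" "\<And>i. i \<in> I \<Longrightarrow> smooth_on S (f i)"
  shows "smooth_on S (\<lambda>x. \<Sum>i\<in>I. f i x)"
  using assms(2)
  by (induction I rule: infinite_finite_induct) (auto simp: smooth_on_const intro: smooth_on_add[OF assms(1)])

section \<open>Symmetry of second derivatives\<close>

lemma has_real_derivative_along_line:
  fixes f :: "'a::real_normed_vector \<Rightarrow> real"
  assumes "f differentiable (at (p + s *\<^sub>R v))"
  shows "((\<lambda>s. f (p + s *\<^sub>R v)) has_real_derivative frechet_derivative f (at (p + s *\<^sub>R v)) v) (at s)"
proof -
  let ?f' = "frechet_derivative f (at (p + s *\<^sub>R v))"
  have f': "(f has_derivative ?f') (at (p + s *\<^sub>R v))"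
    using assms by (simp flip: frechet_derivative_works)
  have "((\<lambda>s. p + s *\<^sub>R v) has_derivative (\<lambda>h. h *\<^sub>R v)) (at s)"
    by (auto intro!: derivative_eq_intros)
  from diff_chain_at[OF this f'] have "((\<lambda>s. f (p + s *\<^sub>R v)) has_derivative (\<lambda>h. ?f' (h *\<^sub>R v))) (at s)"
    by (simp add: o_def)
  moreover have "?f' (h *\<^sub>R v) = ?f' v * h" for h
    using linear_cmul[OF has_derivative_linear[OF f'], of h v] by simp
  ultimately show ?thesis by (simp add: has_field_derivative_def)
qed

text \<open>The second difference of \<open>f\<close> along \<open>v\<close> and \<open>w\<close> is symmetric, and by the mean value theorem
  it is \<open>h\<^sup>2\<close> times the iterated derivative at a nearby point.\<close>

lemma second_difference_mean_value:
  fixes f :: "'a::real_normed_vector \<Rightarrow> real"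
  assumes U: "smooth_on U f" and h: "0 < h"
    and in_U: "\<And>s t. 0 \<le> s \<Longrightarrow> s \<le> h \<Longrightarrow> 0 \<le> t \<Longrightarrow> t \<le> h \<Longrightarrow> x + s *\<^sub>R v + t *\<^sub>R w \<in> U"
  shows "\<exists>s t. 0 < s \<and> s < h \<and> 0 < t \<and> t < h \<and>
    f (x + h *\<^sub>R v + h *\<^sub>R w) - f (x + h *\<^sub>R v) - f (x + h *\<^sub>R w) + f x =
    h * h * frechet_derivative (\<lambda>y. frechet_derivative f (at y) v) (at (x + s *\<^sub>R v + t *\<^sub>R w)) w"
proof -
  let ?D = "\<lambda>y. frechet_derivative f (at y) v"
  \<comment> \<open>The difference along \<open>w\<close>, as a function of the displacement
    \<open>s\<close> along \<open>v\<close>. The mean value theorem for \<open>g\<close> fixes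
    \<open>s\<close>; its derivative there is again a difference along \<open>w\<close>, to which
    the theorem is applied through \<open>k\<close>.\<close>
  define g where "g = (\<lambda>s. f (x + h *\<^sub>R w + s *\<^sub>R v) - f (x + s *\<^sub>R v))"
  have in_U': "x + h *\<^sub>R w + s *\<^sub>R v \<in> U" "x + s *\<^sub>R v \<in> U" if "0 \<le> s" "s \<le> h" for s
    using in_U[of s h] in_U[of s 0] that h by (auto simp: algebra_simps)
  define g' where "g' = (\<lambda>s. ?D (x + h *\<^sub>R w + s *\<^sub>R v) - ?D (x + s *\<^sub>R v))"
  have "(g has_real_derivative g' s) (at s)" if "0 \<le> s" "s \<le> h" for s
    unfolding g_def g'_def
    by (rule DERIV_diff[OF has_real_derivative_along_line has_real_derivative_along_line])
      (rule smooth_on_differentiable[OF U in_U'(1)[OF that]] smooth_on_differentiable[OF U in_U'(2)[OF that]])+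
  from MVT2[OF h this] obtain s where s: "0 < s" "s < h" "g h - g 0 = h * g' s"
    by auto
  define k where "k = (\<lambda>t. ?D (x + s *\<^sub>R v + t *\<^sub>R w))"
  define k' where "k' = (\<lambda>t. frechet_derivative ?D (at (x + s *\<^sub>R v + t *\<^sub>R w)) w)"
  have "(k has_real_derivative k' t) (at t)" if "0 \<le> t" "t \<le> h" for t
    unfolding k_def k'_def
    by (rule has_real_derivative_along_line, rule smooth_on_differentiable[OF smooth_on_frechet_derivative[OF U]])
      (use s that in \<open>simp add: in_U\<close>)
  from MVT2[OF h this] obtain t where "0 < t" "t < h" "k h - k 0 = h * k' t"
    by auto
  moreover have "g' s = k h - k 0"
    by (simp add: g'_def k_def algebra_simps)
  moreover have "g h - g 0 = f (x + h *\<^sub>R v + h *\<^sub>R w) - f (x + h *\<^sub>R v) - f (x + h *\<^sub>R w) + f x"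
    by (simp add: g_def algebra_simps)
  ultimately show ?thesis
    using s by (intro exI[of _ s] exI[of _ t]) (simp add: k'_def)
qed

text \<open>The intermediate point tends to \<open>x\<close> with \<open>h\<close>, and the second
  derivative is continuous because it is differentiable in turn. The limit is one-sided since the
  mean value step takes \<open>0 < h\<close>.\<close>

lemma second_difference_limit:
  fixes f :: "'a::real_normed_vector \<Rightarrow> real"
  assumes "open U" "smooth_on U f" "x \<in> U"
  shows "((\<lambda>h. (f (x + h *\<^sub>R v + h *\<^sub>R w) - f (x + h *\<^sub>R v) - f (x + h *\<^sub>R w) + f x) / (h * h)) \<longlongrightarrow>
    frechet_derivative (\<lambda>y. frechet_derivative f (at y) v) (at x) w) (at_right 0)"
proof (rule tendstoI)
  let ?D2 = "\<lambda>y. frechet_derivative (\<lambda>y. frechet_derivative f (at y) v) (at y) w"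
  fix e :: real assume "0 < e"
  have "continuous (at x) ?D2"
    by (intro differentiable_imp_continuous_within smooth_on_differentiable[OF
          smooth_on_frechet_derivative[OF smooth_on_frechet_derivative[OF assms(2)]] assms(3)])
  then obtain d where d: "0 < d" "\<And>y. dist y x < d \<Longrightarrow> dist (?D2 y) (?D2 x) < e"
    using \<open>0 < e\<close> by (auto simp: continuous_at_eps_delta)
  obtain r where r: "0 < r" "ball x r \<subseteq> U"
    using assms openE by blast
  \<comment> \<open>Chosen so that displacements below \<open>m\<close> along \<open>v\<close> and
    \<open>w\<close> move the point by less than \<open>min d r\<close>. The summand
    \<open>1\<close> keeps the denominator positive for \<open>v = w = 0\<close> and makes the
    estimate strict.\<close>
  define m where "m = min d r / (norm v + norm w + 1)"
  have m: "0 < m" using d r by (simp add: m_def add_nonneg_pos)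
  have near: "dist (x + s *\<^sub>R v + t *\<^sub>R w) x < min d r" if "0 \<le> s" "s < m" "0 \<le> t" "t < m" for s t
  proof -
    have "dist (x + s *\<^sub>R v + t *\<^sub>R w) x \<le> s * norm v + t * norm w"
      using norm_triangle_ineq[of "s *\<^sub>R v" "t *\<^sub>R w"] that by (simp add: dist_norm add.assoc)
    also have "\<dots> \<le> m * norm v + m * norm w"
      using that by (intro add_mono mult_right_mono) auto
    also have "\<dots> < m * (norm v + norm w + 1)"
      using m by (simp add: algebra_simps)
    also have "\<dots> = min d r"
      using add_nonneg_pos[of "norm v + norm w" 1] by (simp add: m_def)
    finally show ?thesis .
  qed
  have "dist ((f (x + h *\<^sub>R v + h *\<^sub>R w) - f (x + h *\<^sub>R v) - f (x + h *\<^sub>R w) + f x) / (h * h)) (?D2 x) < e"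
    if h: "0 < h" "h < m" for h
  proof -
    have "x + s *\<^sub>R v + t *\<^sub>R w \<in> U" if "0 \<le> s" "s \<le> h" "0 \<le> t" "t \<le> h" for s t
      using near[of s t] that h r by (auto simp: subset_iff dist_commute)
    from second_difference_mean_value[OF assms(2) h(1) this]
    obtain s t where "0 < s" "s < h" "0 < t" "t < h"
      and eq: "f (x + h *\<^sub>R v + h *\<^sub>R w) - f (x + h *\<^sub>R v) - f (x + h *\<^sub>R w) + f x =
        h * h * ?D2 (x + s *\<^sub>R v + t *\<^sub>R w)"
      by auto
    then have "dist (?D2 (x + s *\<^sub>R v + t *\<^sub>R w)) (?D2 x) < e"
      using h near[of s t] by (intro d) auto
    with eq h show ?thesis by simp
  qed
  then show "\<forall>\<^sub>F h in at_right 0. dist ((f (x + h *\<^sub>R v + h *\<^sub>R w) - f (x + h *\<^sub>R v) - f (x + h *\<^sub>R w) + f x) / (h * h)) (?D2 x) < e"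
    using m by (auto simp: eventually_at_right_field)
qed

text \<open>Exchanging \<open>v\<close> and \<open>w\<close> does not change the second difference,
  so its two limits agree. The mean value argument is for real functions, hence the pairing with an
  arbitrary \<open>e\<close>. Targets in \<open>real_inner\<close> cover both complex coefficients
  and transition maps.\<close>

lemma second_derivative_symmetric:
  fixes f :: "'a::real_normed_vector \<Rightarrow> 'b::real_inner"
  assumes U: "open U" and f: "smooth_on U f" and x: "x \<in> U"
  shows "frechet_derivative (\<lambda>y. frechet_derivative f (at y) v) (at x) w =
    frechet_derivative (\<lambda>y. frechet_derivative f (at y) w) (at x) v"
proof -
  have "frechet_derivative (\<lambda>y. frechet_derivative f (at y) v) (at x) w \<bullet> e =
      frechet_derivative (\<lambda>y. frechet_derivative f (at y) w) (at x) v \<bullet> e" for e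
  proof -
    define g where "g = (\<lambda>y. f y \<bullet> e)"
    have g: "smooth_on U g"
      by (rule smooth_on_bounded_linear[OF bounded_linear_inner_left[of e] U f]) (simp add: g_def)
    have inner_left: "frechet_derivative (\<lambda>y. k y \<bullet> e) (at y) u = frechet_derivative k (at y) u \<bullet> e"
      if "smooth_on U k" "y \<in> U" for k :: "'a \<Rightarrow> 'b" and y u
      by (simp add: frechet_derivative_eqI[OF bounded_linear.has_derivative[OF bounded_linear_inner_left
            smooth_on_has_derivative[OF that]]])
    have g2: "frechet_derivative (\<lambda>y. frechet_derivative g (at y) a) (at x) b =
        frechet_derivative (\<lambda>y. frechet_derivative f (at y) a) (at x) b \<bullet> e" for a b
    proof -
      have "frechet_derivative (\<lambda>y. frechet_derivative g (at y) a) (at x) =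
          frechet_derivative (\<lambda>y. frechet_derivative f (at y) a \<bullet> e) (at x)"
        by (rule frechet_derivative_cong_open[OF U x]) (simp add: g_def inner_left f)
      then show ?thesis
        by (simp add: inner_left smooth_on_frechet_derivative f x)
    qed
    have "frechet_derivative (\<lambda>y. frechet_derivative g (at y) v) (at x) w =
        frechet_derivative (\<lambda>y. frechet_derivative g (at y) w) (at x) v"
    proof (rule tendsto_unique)
      show "((\<lambda>h. (g (x + h *\<^sub>R v + h *\<^sub>R w) - g (x + h *\<^sub>R v) - g (x + h *\<^sub>R w) + g x) / (h * h)) \<longlongrightarrow>
          frechet_derivative (\<lambda>y. frechet_derivative g (at y) v) (at x) w) (at_right 0)"
        by (rule second_difference_limit[OF U g x])
      show "((\<lambda>h. (g (x + h *\<^sub>R v + h *\<^sub>R w) - g (x + h *\<^sub>R v) - g (x + h *\<^sub>R w) + g x) / (h * h)) \<longlongrightarrow>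
          frechet_derivative (\<lambda>y. frechet_derivative g (at y) w) (at x) v) (at_right 0)"
        using second_difference_limit[OF U g x, of w v] by (simp add: algebra_simps)
    qed simp
    then show ?thesis by (simp add: g2)
  qed
  then show ?thesis
    by (rule vector_eq_rdot[THEN iffD1, OF allI])
qed

section \<open>Exterior derivative in a chart\<close>

text \<open>In a chart, a form is a function of a point and a list of tangent vectors. Most identities
  for such fields hold without multilinearity and in mixed degree.\<close>

definition dir_deriv :: "'e \<Rightarrow> ('e::real_normed_vector \<Rightarrow> 'e list \<Rightarrow> complex) \<Rightarrow> 'e \<Rightarrow> 'e list \<Rightarrow> complex"
  where "dir_deriv v F x vs = frechet_derivative (\<lambda>y. F y vs) (at x) v"

definition smooth_field :: "'e::real_normed_vector set \<Rightarrow> ('e \<Rightarrow> 'e list \<Rightarrow> complex) \<Rightarrow> bool"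
  where "smooth_field U F \<longleftrightarrow> (\<forall>vs. smooth_on U (\<lambda>x. F x vs))"

text \<open>Separates the signs of the exterior derivative from the differentiation, so that the
  same recursion applies to the second-derivative terms of a pullback.\<close>

definition alternating_sum :: "('v \<Rightarrow> 'v list \<Rightarrow> complex) \<Rightarrow> 'v list \<Rightarrow> complex"
  where "alternating_sum g vs = (\<Sum>i<length vs. (-1) ^ i * g (vs ! i) (take i vs @ drop (Suc i) vs))"

definition field_d :: "('e::real_normed_vector \<Rightarrow> 'e list \<Rightarrow> complex) \<Rightarrow> 'e \<Rightarrow> 'e list \<Rightarrow> complex"
  where "field_d F x = alternating_sum (\<lambda>v. dir_deriv v F x)"

lemma ext_d_eq_field_d: "x \<in> chart_range c \<Longrightarrow> ext_d \<alpha> c x = field_d (\<alpha> c) x"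
  by (simp add: ext_d_def field_d_def alternating_sum_def dir_deriv_def fun_eq_iff)

lemma alternating_sum_Nil [simp]: "alternating_sum g [] = 0"
  by (simp add: alternating_sum_def)

text \<open>Omitting \<open>v\<close> is the term of index \<open>0\<close>. In all others
  \<open>v\<close> stays as the first argument and the index is shifted by one, whence the minus
  sign.\<close>

lemma alternating_sum_Cons:
  "alternating_sum g (v # vs) = g v vs - alternating_sum (\<lambda>u. contract v (g u)) vs"
  by (simp add: alternating_sum_def sum.lessThan_Suc_shift contract_apply sum_negf del: sum.lessThan_Suc)

lemma alternating_sum_add:
  "alternating_sum (\<lambda>u us. g u us + h u us) vs = alternating_sum g vs + alternating_sum h vs"
  by (simp add: alternating_sum_def sum.distrib algebra_simps)

lemma alternating_sum_uminus: "alternating_sum (\<lambda>u us. - g u us) vs = - alternating_sum g vs"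
  by (simp add: alternating_sum_def sum_negf)

lemma alternating_sum_map:
  "alternating_sum (\<lambda>u us. g (L u) (map L us)) vs = alternating_sum g (map L vs)"
  by (simp add: alternating_sum_def take_map drop_map)

lemma contract_dir_deriv [simp]: "contract w (dir_deriv v F x) = dir_deriv v (\<lambda>y. contract w (F y)) x"
  by (simp add: fun_eq_iff contract_apply dir_deriv_def)

lemma field_d_Nil [simp]: "field_d F x [] = 0"
  by (simp add: field_d_def)

text \<open>Cartan's formula for the constant vector field \<open>v\<close>.\<close>

lemma contract_field_d:
  "contract v (field_d F x) = dir_deriv v F x - field_d (\<lambda>y. contract v (F y)) x"
  by (simp add: fun_eq_iff contract_apply[of v] field_d_def alternating_sum_Cons)

lemma field_d_Cons: "field_d F x (v # vs) = dir_deriv v F x vs - field_d (\<lambda>y. contract v (F y)) x vs"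
  using fun_cong[OF contract_field_d, of v F x vs] by (simp add: contract_apply)

section \<open>Calculus of fields on an open set\<close>

context
  fixes U :: "'e::real_normed_vector set"
  assumes open_U: "open U"
begin

lemma dir_deriv_cong: "x \<in> U \<Longrightarrow> (\<And>y. y \<in> U \<Longrightarrow> F y vs = G y vs) \<Longrightarrow> dir_deriv v F x vs = dir_deriv v G x vs"
  using frechet_derivative_cong_open[OF open_U] unfolding dir_deriv_def by metis

lemma field_d_cong: "x \<in> U \<Longrightarrow> (\<And>y. y \<in> U \<Longrightarrow> F y = G y) \<Longrightarrow> field_d F x = field_d G x"
  using dir_deriv_cong[of x F _ G] by (simp add: field_d_def alternating_sum_def fun_eq_iff)

lemma smooth_field_has_derivative:
  "smooth_field U F \<Longrightarrow> x \<in> U \<Longrightarrow> ((\<lambda>y. F y vs) has_derivative (\<lambda>v. dir_deriv v F x vs)) (at x)"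
  unfolding smooth_field_def dir_deriv_def using smooth_on_has_derivative by blast

lemma dir_deriv_eqI: "((\<lambda>y. F y vs) has_derivative f') (at x) \<Longrightarrow> dir_deriv v F x vs = f' v"
  by (simp add: dir_deriv_def frechet_derivative_eqI)

lemma dir_deriv_add:
  assumes "smooth_field U F" "smooth_field U G" "x \<in> U"
  shows "dir_deriv v (\<lambda>y. F y + G y) x = dir_deriv v F x + dir_deriv v G x"
  using assms by (auto simp: fun_eq_iff intro!: dir_deriv_eqI has_derivative_add smooth_field_has_derivative)

text \<open>The factor may depend on the argument list but not on the point; this includes the sign
  of \<open>grade\<close>.\<close>

lemma dir_deriv_cmult:
  assumes "smooth_field U F" "x \<in> U"
  shows "dir_deriv v (\<lambda>y vs. z vs * F y vs) x vs = z vs * dir_deriv v F x vs"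
  using assms by (intro dir_deriv_eqI has_derivative_mult_right smooth_field_has_derivative)

lemma dir_deriv_uminus:
  assumes "smooth_field U F" "x \<in> U"
  shows "dir_deriv v (\<lambda>y. - F y) x = - dir_deriv v F x"
  using assms by (auto simp: fun_eq_iff intro!: dir_deriv_eqI has_derivative_minus smooth_field_has_derivative)

lemma dir_deriv_grade:
  assumes "smooth_field U F" "x \<in> U"
  shows "dir_deriv v (\<lambda>y. grade (F y)) x = grade (dir_deriv v F x)"
  using dir_deriv_cmult[OF assms, of v "\<lambda>vs. (-1) ^ length vs"] by (simp add: grade_def fun_eq_iff)

lemma smooth_field_add: "smooth_field U F \<Longrightarrow> smooth_field U G \<Longrightarrow> smooth_field U (\<lambda>x. F x + G x)"
  by (simp add: smooth_field_def smooth_on_add open_U)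

lemma smooth_field_cmult: "smooth_field U F \<Longrightarrow> smooth_field U (\<lambda>x vs. z vs * F x vs)"
  by (simp add: smooth_field_def smooth_on_mult smooth_on_const open_U)

lemma smooth_field_uminus: "smooth_field U F \<Longrightarrow> smooth_field U (\<lambda>x. - F x)"
  using smooth_field_cmult[of F "\<lambda>_. -1"] by (simp add: fun_Compl_def)

lemma smooth_field_grade: "smooth_field U F \<Longrightarrow> smooth_field U (\<lambda>x. grade (F x))"
  unfolding grade_def by (rule smooth_field_cmult)

lemma smooth_field_contract: "smooth_field U F \<Longrightarrow> smooth_field U (\<lambda>x. contract v (F x))"
  by (simp add: smooth_field_def contract_apply)

lemma smooth_field_dir_deriv: "smooth_field U F \<Longrightarrow> smooth_field U (dir_deriv v F)"
  by (simp add: smooth_field_def dir_deriv_def smooth_on_frechet_derivative)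

lemma smooth_field_d: "smooth_field U F \<Longrightarrow> smooth_field U (field_d F)"
  unfolding smooth_field_def field_d_def alternating_sum_def
  using smooth_field_dir_deriv[of F]
  by (intro allI smooth_on_sum smooth_on_mult smooth_on_const open_U) (simp add: smooth_field_def)

lemma smooth_field_shuffle_prod:
  assumes "smooth_field U F" "smooth_field U G"
  shows "smooth_field U (\<lambda>x. shuffle_prod (F x) (G x))"
proof -
  have "smooth_on U (\<lambda>x. shuffle_prod (F x) (G x) vs)" for vs
    using assms
  proof (induction vs arbitrary: F G)
    case Nil
    then show ?case by (simp add: smooth_field_def smooth_on_mult open_U)
  next
    case (Cons v vs)
    then show ?case
      by (simp add: smooth_on_add open_U smooth_field_contract smooth_field_grade)
  qed
  then show ?thesis by (simp add: smooth_field_def)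
qed

lemma field_d_add:
  assumes "smooth_field U F" "smooth_field U G" "x \<in> U"
  shows "field_d (\<lambda>y. F y + G y) x = field_d F x + field_d G x"
  by (simp add: field_d_def alternating_sum_def dir_deriv_add[OF assms] fun_eq_iff sum.distrib algebra_simps)

lemma field_d_cmult:
  assumes "smooth_field U F" "x \<in> U"
  shows "field_d (\<lambda>y vs. z * F y vs) x vs = z * field_d F x vs"
  by (simp add: field_d_def dir_deriv_cmult[OF assms] alternating_sum_def sum_distrib_left algebra_simps)

lemma field_d_uminus:
  assumes "smooth_field U F" "x \<in> U"
  shows "field_d (\<lambda>y. - F y) x = - field_d F x"
  using field_d_cmult[OF assms, of "-1"] by (simp add: fun_eq_iff fun_Compl_def)

lemma field_d_diff:
  assumes "smooth_field U F" "smooth_field U G" "x \<in> U"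
  shows "field_d (\<lambda>y. F y - G y) x = field_d F x - field_d G x"
  using field_d_add[OF assms(1) smooth_field_uminus[OF assms(2)] assms(3)] field_d_uminus[OF assms(2,3)]
  by simp

text \<open>\<open>d\<close> is odd: its value on a list is made from values of \<open>F\<close> on
  lists shorter by one.\<close>

lemma field_d_grade:
  assumes "smooth_field U F" "x \<in> U"
  shows "field_d (\<lambda>y. grade (F y)) x = - grade (field_d F x)"
proof
  show "field_d (\<lambda>y. grade (F y)) x vs = (- grade (field_d F x)) vs" for vs
    using assms(1)
  proof (induction vs arbitrary: F)
    case (Cons v vs)
    have "(- grade (field_d F x)) (v # vs) = grade (contract v (field_d F x)) vs"
      by (simp add: grade_def contract_apply)
    also have "\<dots> = grade (dir_deriv v F x) vs - grade (field_d (\<lambda>y. contract v (F y)) x) vs"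
      by (simp add: contract_field_d grade_def algebra_simps)
    finally show ?case
      using Cons.IH[OF smooth_field_contract, OF Cons.prems, of v] Cons.prems assms(2)
      by (simp add: field_d_Cons dir_deriv_grade field_d_uminus smooth_field_grade smooth_field_contract)
  qed simp
qed

section \<open>Leibniz rules\<close>

lemma dir_deriv_shuffle_prod:
  assumes "smooth_field U F" "smooth_field U G" "x \<in> U"
  shows "dir_deriv v (\<lambda>y. shuffle_prod (F y) (G y)) x =
    shuffle_prod (dir_deriv v F x) (G x) + shuffle_prod (F x) (dir_deriv v G x)"
proof
  show "dir_deriv v (\<lambda>y. shuffle_prod (F y) (G y)) x vs =
    (shuffle_prod (dir_deriv v F x) (G x) + shuffle_prod (F x) (dir_deriv v G x)) vs" for vs
    using assms(1,2)
  proof (induction vs arbitrary: F G)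
    case Nil
    have "dir_deriv v (\<lambda>y. shuffle_prod (F y) (G y)) x [] = F x [] * dir_deriv v G x [] + dir_deriv v F x [] * G x []"
      using has_derivative_mult[OF smooth_field_has_derivative[OF Nil(1) assms(3)]
          smooth_field_has_derivative[OF Nil(2) assms(3)], of "[]" "[]"]
      by (intro dir_deriv_eqI) simp
    then show ?case by simp
  next
    case (Cons u us)
    have "dir_deriv v (\<lambda>y. shuffle_prod (F y) (G y)) x (u # us) =
        dir_deriv v (\<lambda>y. shuffle_prod (contract u (F y)) (G y) + shuffle_prod (grade (F y)) (contract u (G y))) x us"
      by (simp add: dir_deriv_def)
    also have "\<dots> = dir_deriv v (\<lambda>y. shuffle_prod (contract u (F y)) (G y)) x us +
        dir_deriv v (\<lambda>y. shuffle_prod (grade (F y)) (contract u (G y))) x us"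
      using Cons.prems assms(3)
      by (subst dir_deriv_add) (simp_all add: smooth_field_shuffle_prod smooth_field_contract smooth_field_grade)
    also have "\<dots> = (shuffle_prod (dir_deriv v F x) (G x) + shuffle_prod (F x) (dir_deriv v G x)) (u # us)"
      using Cons.prems assms(3)
      by (simp add: Cons.IH smooth_field_contract smooth_field_grade dir_deriv_grade algebra_simps)
    finally show ?case .
  qed
qed

text \<open>Contracted with \<open>v\<close>, Cartan's formula leaves the directional derivative,
  for which the rule is known, and \<open>d\<close> of two products with factors
  \<open>contract v F\<close>, \<open>G\<close> and \<open>grade F\<close>,
  \<open>contract v G\<close>, evaluated on a shorter list.\<close>

lemma field_d_shuffle_prod:
  assumes "smooth_field U F" "smooth_field U G" "x \<in> U"
  shows "field_d (\<lambda>y. shuffle_prod (F y) (G y)) x =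
    shuffle_prod (field_d F x) (G x) + shuffle_prod (grade (F x)) (field_d G x)"
proof
  show "field_d (\<lambda>y. shuffle_prod (F y) (G y)) x vs =
    (shuffle_prod (field_d F x) (G x) + shuffle_prod (grade (F x)) (field_d G x)) vs" for vs
    using assms(1,2)
  proof (induction vs arbitrary: F G)
    case Nil
    then show ?case by simp
  next
    case (Cons v vs)
    note smooth = Cons.prems smooth_field_contract smooth_field_grade
    have diff_left: "shuffle_prod (f - f') g = shuffle_prod f g - shuffle_prod f' g"
      and diff_right: "shuffle_prod g (f - f') = shuffle_prod g f - shuffle_prod g f'"
      for f f' g :: "'e list \<Rightarrow> complex"
      using shuffle_prod_add_left[of f "- f'" g] shuffle_prod_add_right[of g f "- f'"]
      by (simp_all add: shuffle_prod_uminus_left shuffle_prod_uminus_right)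
    have "field_d (\<lambda>y. shuffle_prod (F y) (G y)) x (v # vs) =
        (shuffle_prod (dir_deriv v F x) (G x) + shuffle_prod (F x) (dir_deriv v G x)) vs
        - (field_d (\<lambda>y. shuffle_prod (contract v (F y)) (G y)) x vs +
           field_d (\<lambda>y. shuffle_prod (grade (F y)) (contract v (G y))) x vs)"
      using assms(3)
      by (simp add: field_d_Cons shuffle_prod_Cons dir_deriv_shuffle_prod field_d_add
          smooth smooth_field_shuffle_prod)
    also have "\<dots> = (shuffle_prod (field_d F x) (G x) + shuffle_prod (grade (F x)) (field_d G x)) (v # vs)"
      using assms(3)
      by (simp add: Cons.IH smooth contract_field_d field_d_grade diff_left diff_right
          shuffle_prod_uminus_left shuffle_prod_uminus_left[unfolded fun_Compl_def])
    finally show ?case .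
  qed
qed

section \<open>The exterior derivative squares to zero\<close>

lemma dir_deriv_commute:
  assumes "smooth_field U F" "x \<in> U"
  shows "dir_deriv v (dir_deriv w F) x = dir_deriv w (dir_deriv v F) x"
  unfolding dir_deriv_def
  by (rule ext, rule second_derivative_symmetric[OF open_U _ assms(2)]) (use assms(1) in \<open>simp add: smooth_field_def\<close>)

text \<open>For a constant field \<open>v\<close> this is the commutation of the Lie derivative with
  \<open>d\<close>; the head argument \<open>w\<close> contributes a mixed second
  derivative.\<close>

lemma dir_deriv_field_d:
  assumes "smooth_field U F" "x \<in> U"
  shows "dir_deriv v (field_d F) x vs = field_d (dir_deriv v F) x vs"
  using assms(1)
proof (induction vs arbitrary: F)
  case Nil
  show ?case using dir_deriv_eqI[of "field_d F" "[]" "\<lambda>_. 0" x v] by simp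
next
  case (Cons w ws)
  have "dir_deriv v (field_d F) x (w # ws) =
      dir_deriv v (\<lambda>y. dir_deriv w F y - field_d (\<lambda>y. contract w (F y)) y) x ws"
    by (simp add: dir_deriv_def field_d_Cons)
  also have "\<dots> = dir_deriv v (dir_deriv w F) x ws - dir_deriv v (field_d (\<lambda>y. contract w (F y))) x ws"
    using dir_deriv_add[OF smooth_field_dir_deriv[of F w]
        smooth_field_uminus[OF smooth_field_d[OF smooth_field_contract[of F w]]] assms(2), of v]
      dir_deriv_uminus[OF smooth_field_d[OF smooth_field_contract[of F w]] assms(2), of v] Cons.prems
    by (simp add: fun_eq_iff)
  also have "\<dots> = field_d (dir_deriv v F) x (w # ws)"
    using Cons.IH[OF smooth_field_contract, OF Cons.prems, of w] Cons.prems assms(2)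
    by (simp add: field_d_Cons dir_deriv_commute[of F x v w])
  finally show ?case .
qed

lemma field_d_field_d:
  assumes "smooth_field U F" "x \<in> U"
  shows "field_d (field_d F) x = 0"
proof
  show "field_d (field_d F) x vs = 0 vs" for vs
    using assms(1)
  proof (induction vs arbitrary: F)
    case (Cons v vs)
    \<comment> \<open>Cartan's formula is used twice: the outer \<open>d\<close> gives a directional
      derivative of \<open>dF\<close> and \<open>d\<close> of a contraction of \<open>dF\<close>,
      and the latter is expanded again. The directional derivatives cancel by
      \<open>dir_deriv_field_d\<close>.\<close>
    have "field_d (field_d F) x (v # vs) = 
        dir_deriv v (field_d F) x vs - (field_d (dir_deriv v F) x - field_d (field_d (\<lambda>y. contract v (F y))) x) vs"
      using Cons.prems assms(2)
      by (simp add: field_d_Cons contract_field_d smooth_field_dir_deriv smooth_field_d smooth_field_contract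
          flip: field_d_diff)
    then show ?case
      using Cons.IH[OF smooth_field_contract, OF Cons.prems, of v] Cons.prems assms(2)
      by (simp add: dir_deriv_field_d)
  qed simp
qed

section \<open>Multilinearity, alternation and degree of the exterior derivative\<close>

lemma linear_dir_deriv: "smooth_field U F \<Longrightarrow> x \<in> U \<Longrightarrow> linear (\<lambda>v. dir_deriv v F x vs)"
  by (rule has_derivative_linear[OF smooth_field_has_derivative])

text \<open>Differentiability is assumed at \<open>x\<close> alone because the lemma is also applied
  to a composite of a field with a map, for which only the chain rule at \<open>x\<close> is at
  hand.\<close>

lemma mlin_dir_deriv:
  assumes "x \<in> U" "\<And>vs. (\<lambda>y. F y vs) differentiable (at x)" "\<And>y. y \<in> U \<Longrightarrow> mlin (F y)"
  shows "mlin (dir_deriv v F x)"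
proof -
  have der: "((\<lambda>y. F y vs) has_derivative (\<lambda>v. dir_deriv v F x vs)) (at x)" for vs
    using assms(2)[of vs] by (simp add: dir_deriv_def flip: frechet_derivative_works)
  have "dir_deriv v F x (us @ (a + b) # vs) = dir_deriv v F x (us @ a # vs) + dir_deriv v F x (us @ b # vs)" for us a b vs
    using assms(1,3)
    by (intro dir_deriv_eqI has_derivative_cong_open[OF has_derivative_add[OF der der] open_U])
      (auto simp: mlin_def linear_iff)
  moreover have "dir_deriv v F x (us @ (r *\<^sub>R a) # vs) = r *\<^sub>R dir_deriv v F x (us @ a # vs)" for us a vs r
    using assms(1,3)
    by (intro dir_deriv_eqI has_derivative_cong_open[OF has_derivative_scaleR_right[OF der] open_U])
      (auto simp: mlin_def linear_iff)
  ultimately show ?thesis by (simp add: mlin_def linear_iff)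
qed

lemma alt_dir_deriv:
  assumes "x \<in> U" "\<And>y. y \<in> U \<Longrightarrow> alt (F y)"
  shows "alt (dir_deriv v F x)"
  using assms
  by (auto simp: alt_def intro!: dir_deriv_eqI[of F _ "\<lambda>_. 0", THEN trans] has_derivative_cong_open[OF has_derivative_const open_U])

text \<open>In the head slot, Cartan's formula leaves a directional derivative, linear in its
  direction, and \<open>d\<close> of \<open>contract v (F y)\<close>, which is linear in
  \<open>v\<close> for each \<open>y\<close> in \<open>U\<close>.\<close>

lemma mlin_field_d:
  assumes "smooth_field U F" "x \<in> U" "\<And>y. y \<in> U \<Longrightarrow> mlin (F y)"
  shows "mlin (field_d F x)"
proof -
  have "linear (\<lambda>v. field_d F x (us @ v # vs))" for us vs
    using assms(1,3)
  proof (induction us arbitrary: F)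
    case Nil
    have contract: "contract (a + b) (F y) = contract a (F y) + contract b (F y)"
        "contract (r *\<^sub>R a) (F y) = (\<lambda>vs. of_real r * contract a (F y) vs)" if "y \<in> U" for a b r y
      using mlin_head[OF Nil(2), OF that] by (auto simp: linear_iff fun_eq_iff scaleR_conv_of_real contract_apply)
    have "linear (\<lambda>v. field_d (\<lambda>y. contract v (F y)) x vs)"
    proof (rule linearI)
      fix a b
      show "field_d (\<lambda>y. contract (a + b) (F y)) x vs =
          field_d (\<lambda>y. contract a (F y)) x vs + field_d (\<lambda>y. contract b (F y)) x vs"
        using Nil assms(2) field_d_cong[OF assms(2) contract(1)]
        by (simp add: field_d_add smooth_field_contract)
    next
      fix r a
      show "field_d (\<lambda>y. contract (r *\<^sub>R a) (F y)) x vs = r *\<^sub>R field_d (\<lambda>y. contract a (F y)) x vs"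
        using Nil assms(2) field_d_cong[OF assms(2) contract(2)]
        by (simp add: field_d_cmult smooth_field_contract scaleR_conv_of_real)
    qed
    then show ?case
      using linear_dir_deriv[OF Nil(1) assms(2)] by (simp add: field_d_Cons linear_compose_sub)
  next
    case (Cons u us)
    have "mlin (dir_deriv u F x)"
      by (rule mlin_dir_deriv[OF assms(2)])
        (use Cons.prems assms(2) in \<open>simp_all add: smooth_field_def smooth_on_differentiable[of U]\<close>)
    then have "linear (\<lambda>v. dir_deriv u F x (us @ v # vs))"
      by (simp add: mlin_def)
    moreover have "linear (\<lambda>v. field_d (\<lambda>y. contract u (F y)) x (us @ v # vs))"
      using Cons.prems by (intro Cons.IH smooth_field_contract mlin_contract)
    ultimately show ?case by (simp add: field_d_Cons linear_compose_sub)
  qed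
  then show ?thesis by (simp add: mlin_def)
qed

text \<open>Contracting twice with \<open>v\<close> produces two equal directional derivatives of
  \<open>contract v F\<close> with opposite signs, and \<open>d\<close> of the double contraction,
  which is \<open>0\<close>.\<close>

lemma alt_field_d:
  assumes "smooth_field U F" "x \<in> U" "\<And>y. y \<in> U \<Longrightarrow> alt (F y)"
  shows "alt (field_d F x)"
proof -
  have "field_d F x (us @ v # v # vs) = 0" for us v vs
    using assms(1,3)
  proof (induction us arbitrary: F)
    case Nil
    have zero: "field_d (\<lambda>y. 0) x = 0"
      by (simp add: field_d_def alternating_sum_def dir_deriv_def fun_eq_iff frechet_derivative_eqI[OF has_derivative_const])
    have "field_d (\<lambda>y. contract v (contract v (F y))) x = field_d (\<lambda>y. 0) x"
      by (rule field_d_cong[OF assms(2)]) (simp add: contract_contract_same Nil)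
    then show ?case by (simp add: field_d_Cons zero) (simp add: dir_deriv_def contract_apply)
  next
    case (Cons u us)
    then show ?case
      using alt_dir_deriv[OF assms(2), of F u]
      by (simp add: field_d_Cons smooth_field_contract alt_contract) (simp add: alt_def)
  qed
  then show ?thesis by (simp add: alt_def)
qed

lemma homogeneous_field_d:
  assumes "x \<in> U" "\<And>y. y \<in> U \<Longrightarrow> homogeneous k (F y)"
  shows "homogeneous (k + 1) (field_d F x)"
  unfolding homogeneous_def
proof (intro allI impI)
  fix vs :: "'e list" assume len: "int (length vs) \<noteq> k + 1"
  have "dir_deriv v F x (take i vs @ drop (Suc i) vs) = 0" if "i < length vs" for v i
    using that len assms
    by (intro dir_deriv_eqI[of F _ "\<lambda>_. 0", THEN trans] has_derivative_cong_open[OF has_derivative_const open_U])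
      (auto simp: homogeneous_def)
  then show "field_d F x vs = 0"
    by (simp add: field_d_def alternating_sum_def)
qed

end

text \<open>The terms of the product rule for \<open>f (map A vs)\<close> in which the linear map \<open>A = L\<close> is
  differentiated, \<open>M\<close> being its derivative.\<close>

fun subst_sum :: "('v list \<Rightarrow> complex) \<Rightarrow> ('u \<Rightarrow> 'v) \<Rightarrow> ('u \<Rightarrow> 'v) \<Rightarrow> 'u list \<Rightarrow> complex"
  where
    "subst_sum f L M [] = 0"
  | "subst_sum f L M (v # vs) = f (M v # map L vs) + subst_sum (contract (L v) f) L M vs"

lemma subst_sum_add: "subst_sum (f + g) L M vs = subst_sum f L M vs + subst_sum g L M vs"
  by (induction vs arbitrary: f g) auto

lemma subst_sum_cmult: "subst_sum (\<lambda>vs. z * f vs) L M vs = z * subst_sum f L M vs"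
  by (induction vs arbitrary: f) (auto simp: algebra_simps)

lemma linear_subst_sum_contract:
  assumes "mlin f"
  shows "linear (\<lambda>u. subst_sum (contract u f) L M vs)"
proof -
  have "contract (a + b) f = contract a f + contract b f"
      "contract (r *\<^sub>R a) f = (\<lambda>vs. of_real r * contract a f vs)" for a b r
    using mlin_head[OF assms] by (auto simp: linear_iff fun_eq_iff scaleR_conv_of_real contract_apply)
  then show ?thesis
    by (simp add: linear_iff subst_sum_add subst_sum_cmult scaleR_conv_of_real)
qed

text \<open>The argument carrying \<open>M\<close> is moved to the front, and the transpositions
  this takes produce the alternating sign.\<close>

lemma subst_sum_eq_alternating_sum:
  assumes "mlin f" "alt f"
  shows "subst_sum f L M vs = alternating_sum (\<lambda>u us. f (M u # map L us)) vs"
  using assms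
proof (induction vs arbitrary: f)
  case (Cons v vs)
  have "subst_sum (contract (L v) f) L M vs = alternating_sum (\<lambda>u us. f (L v # M u # map L us)) vs"
    by (subst Cons.IH) (simp_all add: Cons.prems mlin_contract alt_contract contract_apply)
  also have "\<dots> = alternating_sum (\<lambda>u us. - f (M u # L v # map L us)) vs"
  proof -
    have "f (L v # M u # map L us) = - f (M u # L v # map L us)" for u us
      using alt_swap[OF Cons.prems, of "[]" "L v" "M u" "map L us"] by simp
    then show ?thesis by (simp only:)
  qed
  finally show ?case
    by (simp add: alternating_sum_Cons alternating_sum_uminus contract_def)
qed simp

text \<open>A double sum over pairs of positions: the symmetric \<open>H\<close> meets an
  antisymmetric sign. In the induction, the pairs involving the head \<open>v\<close> appear once
  with \<open>v\<close> as direction and once with \<open>v\<close> as differentiated argument, and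
  these two sums cancel.\<close>

lemma alternating_sum_subst_sum_symmetric:
  assumes "mlin f" "alt f" "\<And>u v. H u v = H v u"
  shows "alternating_sum (\<lambda>u us. subst_sum f L (H u) us) vs = 0"
  using assms(1,2)
proof (induction vs arbitrary: f)
  case (Cons v vs)
  have "alternating_sum (\<lambda>u us. subst_sum f L (H u) us) (v # vs) =
      subst_sum f L (H v) vs - alternating_sum (\<lambda>u us. f (H u v # map L us) + subst_sum (contract (L v) f) L (H u) us) vs"
    by (simp add: alternating_sum_Cons contract_def)
  also have "\<dots> = subst_sum f L (H v) vs - alternating_sum (\<lambda>u us. f (H v u # map L us)) vs"
    using Cons.IH[OF mlin_contract alt_contract, OF Cons.prems] by (simp add: alternating_sum_add assms(3)[of v])
  finally show ?case
    using subst_sum_eq_alternating_sum[OF Cons.prems] by simp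
qed simp

text \<open>A substitute for the basis of a Euclidean space that also covers dimension \<open>0\<close>; the frame may
  contain \<open>0\<close>, for which the coefficient is \<open>x / 0 = 0\<close>.\<close>

locale orthogonal_frame =
  fixes C :: "'e::real_inner set"
  assumes finite_frame: "finite C"
    and frame_expand: "v = (\<Sum>b\<in>C. ((v \<bullet> b) / (b \<bullet> b)) *\<^sub>R b)"

text \<open>Gram-Schmidt without normalization, for which the division by
  \<open>b \<bullet> b\<close> makes up.\<close>

lemma orthogonal_frame_exists:
  fixes B :: "'e::real_inner set"
  assumes "finite B" "span B = UNIV"
  shows "\<exists>C :: 'e set. orthogonal_frame C"
proof -
  obtain C where "finite C" "span C = span B" "pairwise orthogonal C"
    using basis_orthogonal[OF assms(1)] by blast
  with assms(2) have C: "finite C" "span C = UNIV" "pairwise orthogonal C"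
    by simp_all
  have "v = (\<Sum>b\<in>C. ((v \<bullet> b) / (b \<bullet> b)) *\<^sub>R b)" for v
  proof -
    obtain r where r: "v = (\<Sum>b\<in>C. r b *\<^sub>R b)"
      using C(2) by (auto simp: span_finite[OF C(1)] set_eq_iff)
    have "v \<bullet> b = r b * (b \<bullet> b)" if "b \<in> C" for b
    proof -
      have "v \<bullet> b = (\<Sum>a\<in>C. if a = b then r b * (b \<bullet> b) else 0)"
        unfolding r inner_sum_left
        by (rule sum.cong) (use C(3) that in \<open>auto simp: pairwise_def orthogonal_def\<close>)
      then show ?thesis using that C(1) by simp
    qed
    then have "((v \<bullet> b) / (b \<bullet> b)) *\<^sub>R b = r b *\<^sub>R b" if "b \<in> C" for b
      using that by (cases "b = 0") auto
    then have "(\<Sum>b\<in>C. ((v \<bullet> b) / (b \<bullet> b)) *\<^sub>R b) = (\<Sum>b\<in>C. r b *\<^sub>R b)"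
      by (rule sum.cong[OF refl])
    then show ?thesis
      using r by (rule trans[rotated, OF sym])
  qed
  with C(1) show ?thesis
    by (auto simp: orthogonal_frame_def)
qed

context orthogonal_frame
begin

definition frame_coord :: "'e \<Rightarrow> 'e \<Rightarrow> complex"
  where "frame_coord b v = of_real ((v \<bullet> b) / (b \<bullet> b))"

lemma bounded_linear_frame_coord: "bounded_linear (frame_coord b)"
proof -
  have "bounded_linear (\<lambda>v. of_real ((v \<bullet> b) * inverse (b \<bullet> b)) :: complex)"
    by (intro bounded_linear_compose[OF bounded_linear_of_real] bounded_linear_mult_const bounded_linear_inner_left)
  then show ?thesis by (simp add: frame_coord_def[abs_def] divide_inverse)
qed

lemma linear_frame_expand:
  fixes g :: "'e \<Rightarrow> complex"
  assumes "linear g"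
  shows "g v = (\<Sum>b\<in>C. frame_coord b v * g b)"
proof -
  have "g v = g (\<Sum>b\<in>C. ((v \<bullet> b) / (b \<bullet> b)) *\<^sub>R b)"
    using frame_expand[of v] by simp
  also have "\<dots> = (\<Sum>b\<in>C. frame_coord b v * g b)"
    by (simp add: linear_sum[OF assms] linear_cmul[OF assms] frame_coord_def scaleR_conv_of_real)
  finally show ?thesis .
qed

lemma mlin_head_expand: "mlin f \<Longrightarrow> f (v # vs) = (\<Sum>b\<in>C. frame_coord b v * contract b f vs)"
  using linear_frame_expand[OF mlin_head] by (simp add: contract_apply)

text \<open>The arguments move with the point. Expanding the head in the frame turns the value into
  a finite sum of scalar functions times contractions with fixed vectors, to which the product rule
  applies.\<close>

lemma smooth_on_map_args:
  fixes A :: "'e \<Rightarrow> 'e \<Rightarrow> 'e"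
  assumes "open U" "smooth_field U F" "\<And>y. y \<in> U \<Longrightarrow> mlin (F y)" "\<And>v. smooth_on U (\<lambda>y. A y v)"
  shows "smooth_on U (\<lambda>y. F y (map (A y) vs))"
  using assms(2,3)
proof (induction vs arbitrary: F)
  case Nil
  then show ?case by (simp add: smooth_field_def)
next
  case (Cons v vs)
  have "smooth_on U (\<lambda>y. frame_coord b (A y v))" for b
    by (rule smooth_on_bounded_linear[OF bounded_linear_frame_coord assms(1) assms(4)[of v]]) (rule refl)
  moreover have "smooth_on U (\<lambda>y. contract b (F y) (map (A y) vs))" for b
    by (rule Cons.IH[OF smooth_field_contract[OF assms(1) Cons.prems(1)] mlin_contract[OF Cons.prems(2)]])
  ultimately have "smooth_on U (\<lambda>y. \<Sum>b\<in>C. frame_coord b (A y v) * contract b (F y) (map (A y) vs))"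
    by (intro smooth_on_sum smooth_on_mult assms(1))
  then show ?case
    by (rule smooth_on_cong[OF assms(1)]) (simp add: mlin_head_expand Cons.prems(2))
qed

lemma has_derivative_map_args:
  fixes A :: "'e \<Rightarrow> 'e \<Rightarrow> 'e"
  assumes "open U" "x \<in> U" "\<And>us. (\<lambda>y. F y us) differentiable (at x)" "\<And>y. y \<in> U \<Longrightarrow> mlin (F y)"
    and "\<And>v. (\<lambda>y. A y v) differentiable (at x)"
  shows "((\<lambda>y. F y (map (A y) vs)) has_derivative
    (\<lambda>w. dir_deriv w F x (map (A x) vs) +
      subst_sum (F x) (A x) (\<lambda>v. frechet_derivative (\<lambda>y. A y v) (at x) w) vs)) (at x)"
  using assms(3,4)
proof (induction vs arbitrary: F)
  case Nil
  from Nil(1)[of "[]"] show ?case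
    by (simp add: dir_deriv_def flip: frechet_derivative_works)
next
  case (Cons v vs)
  let ?A' = "\<lambda>w v. frechet_derivative (\<lambda>y. A y v) (at x) w"
  \<comment> \<open>\<open>?g w u\<close> is the derivative in direction \<open>w\<close> with the
    head argument frozen at \<open>u\<close>. Its linearity in \<open>u\<close> allows the frame
    expansion to be undone after differentiation; differentiating the coordinates themselves gives
    the first term of \<open>subst_sum\<close>.\<close>
  let ?g = "\<lambda>w u. dir_deriv w F x (u # map (A x) vs) + subst_sum (contract u (F x)) (A x) (?A' w) vs"
  have lin_g: "linear (?g w)" for w
    by (intro linear_compose_add mlin_head mlin_dir_deriv[OF assms(1,2)] Cons.prems
        linear_subst_sum_contract assms(2))
  have coord: "((\<lambda>y. frame_coord b (A y v)) has_derivative (\<lambda>w. frame_coord b (?A' w v))) (at x)" for b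
    using bounded_linear.has_derivative[OF bounded_linear_frame_coord] assms(5)[of v]
    by (simp add: frechet_derivative_works)
  have "((\<lambda>y. contract b (F y) (map (A y) vs)) has_derivative (\<lambda>w. ?g w b)) (at x)" for b
  proof -
    have "(\<lambda>y. contract b (F y) us) differentiable (at x)" for us
      using Cons.prems(1) by (simp add: contract_apply)
    moreover have "dir_deriv w F x (b # us) = dir_deriv w (\<lambda>y. contract b (F y)) x us" for w us
      by (simp add: dir_deriv_def contract_apply)
    ultimately show ?thesis
      using Cons.IH[of "\<lambda>y. contract b (F y)"] mlin_contract[OF Cons.prems(2)] by presburger
  qed
  then have "((\<lambda>y. \<Sum>b\<in>C. frame_coord b (A y v) * contract b (F y) (map (A y) vs)) has_derivative
      (\<lambda>w. \<Sum>b\<in>C. frame_coord b (A x v) * ?g w b + frame_coord b (?A' w v) * contract b (F x) (map (A x) vs))) (at x)"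
    by (intro has_derivative_sum has_derivative_mult coord)
  moreover have "(\<Sum>b\<in>C. frame_coord b (A x v) * ?g w b + frame_coord b (?A' w v) * contract b (F x) (map (A x) vs)) =
      dir_deriv w F x (map (A x) (v # vs)) + subst_sum (F x) (A x) (?A' w) (v # vs)" for w
    using linear_frame_expand[OF lin_g[of w], of "A x v"]
      mlin_head_expand[OF Cons.prems(2)[OF assms(2)], of "?A' w v" "map (A x) vs"]
    by (simp add: sum.distrib)
  ultimately have "((\<lambda>y. \<Sum>b\<in>C. frame_coord b (A y v) * contract b (F y) (map (A y) vs)) has_derivative
      (\<lambda>w. dir_deriv w F x (map (A x) (v # vs)) + subst_sum (F x) (A x) (?A' w) (v # vs))) (at x)"
    by simp
  then show ?case
    by (rule has_derivative_cong_open[OF _ assms(1,2)]) (simp add: mlin_head_expand Cons.prems(2))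
qed

text \<open>The terms with second derivatives of \<open>\<phi>\<close> cancel because these are symmetric, whereas the
  field is alternating.\<close>

lemma field_d_pullback:
  fixes \<phi> :: "'e \<Rightarrow> 'e"
  assumes U: "open U" "x \<in> U" and \<phi>: "smooth_on U \<phi>" "\<phi> ` U \<subseteq> V"
    and G: "smooth_field V G" "\<And>y. y \<in> V \<Longrightarrow> mlin (G y)" "\<And>y. y \<in> V \<Longrightarrow> alt (G y)"
    and F: "\<And>y vs. y \<in> U \<Longrightarrow> F y vs = G (\<phi> y) (map (frechet_derivative \<phi> (at y)) vs)"
  shows "field_d F x vs = field_d G (\<phi> x) (map (frechet_derivative \<phi> (at x)) vs)"
proof -
  let ?L = "frechet_derivative \<phi> (at x)"
  let ?H = "\<lambda>u v. frechet_derivative (\<lambda>y. frechet_derivative \<phi> (at y) v) (at x) u"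
  have \<phi>x: "\<phi> x \<in> V" using U \<phi> by auto
  have comp: "((\<lambda>y. G (\<phi> y) us) has_derivative (\<lambda>w. dir_deriv (?L w) G (\<phi> x) us)) (at x)" for us
  proof -
    have "((\<lambda>y. G y us) has_derivative (\<lambda>w. dir_deriv w G (\<phi> x) us)) (at (\<phi> x))"
      using smooth_on_has_derivative[of V "\<lambda>y. G y us"] G(1) \<phi>x
      by (simp add: smooth_field_def dir_deriv_def)
    from diff_chain_at[OF smooth_on_has_derivative[OF \<phi>(1) U(2)] this]
    show ?thesis by (simp add: o_def)
  qed
  have "dir_deriv u F x us = dir_deriv (?L u) G (\<phi> x) (map ?L us) + subst_sum (G (\<phi> x)) ?L (?H u) us" for u us
  proof -
    have "((\<lambda>y. G (\<phi> y) (map (frechet_derivative \<phi> (at y)) us)) has_derivative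
        (\<lambda>w. dir_deriv w (\<lambda>y. G (\<phi> y)) x (map ?L us) + subst_sum (G (\<phi> x)) ?L (?H w) us)) (at x)"
    proof (rule has_derivative_map_args[OF U])
      show "(\<lambda>y. G (\<phi> y) us) differentiable at x" for us
        using comp by (rule differentiableI)
      show "mlin (G (\<phi> y))" if "y \<in> U" for y
        using G(2) \<phi>(2) that by auto
      show "(\<lambda>y. frechet_derivative \<phi> (at y) v) differentiable at x" for v
        by (rule smooth_on_differentiable[OF smooth_on_frechet_derivative[OF \<phi>(1)] U(2)])
    qed
    from has_derivative_cong_open[OF this U F]
    have "((\<lambda>y. F y us) has_derivative
        (\<lambda>w. dir_deriv w (\<lambda>y. G (\<phi> y)) x (map ?L us) + subst_sum (G (\<phi> x)) ?L (?H w) us)) (at x)" .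
    then show ?thesis
      using frechet_derivative_eqI[OF comp] by (simp add: dir_deriv_def frechet_derivative_eqI)
  qed
  then have "field_d F x vs = alternating_sum (\<lambda>u us. dir_deriv (?L u) G (\<phi> x) (map ?L us)) vs +
      alternating_sum (\<lambda>u us. subst_sum (G (\<phi> x)) ?L (?H u) us) vs"
    by (simp add: field_d_def alternating_sum_def sum.distrib algebra_simps)
  also have "alternating_sum (\<lambda>u us. subst_sum (G (\<phi> x)) ?L (?H u) us) vs = 0"
    by (rule alternating_sum_subst_sum_symmetric[OF G(2,3)[OF \<phi>x]])
      (rule second_derivative_symmetric[OF U(1) \<phi>(1) U(2)])
  finally show ?thesis
    using alternating_sum_map[of "\<lambda>u. dir_deriv u G (\<phi> x)" ?L vs] by (simp add: field_d_def)
qed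

end

section \<open>Forms on an almost complex manifold\<close>

lemma transition_apply:
  assumes "is_chart X c" "p \<in> fst c"
  shows "transition c c' (snd c p) = snd c' p"
proof -
  have "inj_on (snd c) (fst c)"
    using assms(1) openin_subset[of X "fst c"]
    by (auto simp: is_chart_def homeomorphic_map_def quotient_map_def Int_absorb1
        dest!: homeomorphic_imp_injective_map)
  then show ?thesis
    using assms(2) by (simp add: transition_def)
qed

text \<open>Derivatives of transition maps and the pullback formula are taken on an open set. A
  chart is open onto its range, and the range is open in the model space.\<close>

lemma open_overlap:
  assumes "is_chart X c" "is_chart X c'"
  shows "open (overlap c c')"
proof -
  have "openin (subtopology X (fst c)) (fst c \<inter> fst c')"
    using assms by (auto simp: is_chart_def openin_subtopology)
  then have "openin (top_of_set (chart_range c)) (snd c ` (fst c \<inter> fst c'))"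
    using assms(1) homeomorphic_imp_open_map[of "subtopology X (fst c)" "top_of_set (chart_range c)" "snd c"]
    by (simp add: is_chart_def open_map_def)
  then show ?thesis
    using assms(1) by (simp add: overlap_def is_chart_def openin_open_eq)
qed

text \<open>The sign \<open>(-1)\<^sup>k\<close> in the Leibniz rule for a \<open>k\<close>-form is carried by \<open>sign_form\<close>, so that
  no identity depends on the parity of a degree.\<close>

definition sign_form :: "('m, 'e) form \<Rightarrow> ('m, 'e) form"
  where "sign_form \<alpha> = (\<lambda>c x. grade (\<alpha> c x))"

lemma sign_form_sign_form [simp]: "sign_form (sign_form \<alpha>) = \<alpha>"
  by (simp add: sign_form_def)

lemma sign_form_zero: "sign_form 0 = 0"
  by (simp add: sign_form_def fun_eq_iff)

section \<open>Algebraic rules for forms and for the dual action\<close>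

lemma wedge_add_left: "wedge (\<alpha> + \<alpha>') \<beta> = wedge \<alpha> \<beta> + wedge \<alpha>' \<beta>"
  and wedge_add_right: "wedge \<alpha> (\<beta> + \<beta>') = wedge \<alpha> \<beta> + wedge \<alpha> \<beta>'"
  and wedge_uminus_left: "wedge (- \<alpha>) \<beta> = - wedge \<alpha> \<beta>"
  and wedge_zero_left: "wedge 0 \<beta> = 0"
  and wedge_zero_right: "wedge \<alpha> 0 = 0"
  by (simp_all add: fun_eq_iff wedge_eq_shuffle_prod shuffle_prod_add_left shuffle_prod_add_right
      shuffle_prod_uminus_left shuffle_prod_uminus_right)

lemma wedge_scale_left: "wedge (scale z \<alpha>) \<beta> = scale z (wedge \<alpha> \<beta>)"
  and wedge_scale_right: "wedge \<alpha> (scale z \<beta>) = scale z (wedge \<alpha> \<beta>)"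
  by (simp_all add: fun_eq_iff wedge_eq_shuffle_prod scale_def shuffle_prod_cmult_left shuffle_prod_cmult_right)

lemma wedge_assoc: "wedge (wedge \<alpha> \<beta>) \<gamma> = wedge \<alpha> (wedge \<beta> \<gamma>)"
  by (simp add: wedge_eq_shuffle_prod shuffle_prod_assoc)

lemma scale_add: "scale z (\<alpha> + \<beta>) = scale z \<alpha> + scale z \<beta>"
  and scale_add_left: "scale (z + w) \<alpha> = scale z \<alpha> + scale w \<alpha>"
  and scale_scale: "scale z (scale w \<alpha>) = scale (z * w) \<alpha>"
  and scale_one: "scale 1 \<alpha> = \<alpha>"
  and scale_zero_left: "scale 0 \<alpha> = 0"
  and scale_zero_right: "scale z 0 = 0"
  and scale_minus_one: "scale (-1) \<alpha> = - \<alpha>"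
  by (simp_all add: scale_def fun_eq_iff algebra_simps)

lemma dual_act_apply: "dual_act L \<alpha> c x vs = \<alpha> c x (map (L c x) vs)"
  by (simp add: dual_act_def)

lemma dual_act_add: "dual_act L (\<alpha> + \<beta>) = dual_act L \<alpha> + dual_act L \<beta>"
  and dual_act_scale: "dual_act L (scale z \<alpha>) = scale z (dual_act L \<alpha>)"
  and dual_act_zero: "dual_act L 0 = 0"
  and dual_act_uminus: "dual_act L (- \<alpha>) = - dual_act L \<alpha>"
  and dual_act_sign_form: "dual_act L (sign_form \<alpha>) = sign_form (dual_act L \<alpha>)"
  by (simp_all add: dual_act_def scale_def sign_form_def grade_def fun_eq_iff)

lemma dual_act_wedge: "dual_act L (wedge \<alpha> \<beta>) = wedge (dual_act L \<alpha>) (dual_act L \<beta>)"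
  by (simp add: dual_act_def wedge_eq_shuffle_prod fun_eq_iff shuffle_prod_map)

section \<open>Spaces of forms and the wedge product on the manifold\<close>

locale almost_complex =
  fixes m :: nat and X :: "'m topology" and \<A> :: "('m, 'e::real_inner) chart set"
    and J :: "('m, 'e) endo_field"
  assumes almost_complex: "almost_complex_manifold m X \<A> J"
begin

lemma manifold: "smooth_manifold (2 * m) X \<A>"
  and smooth_J: "smooth_endo_field \<A> J"
  and J_J: "c \<in> \<A> \<Longrightarrow> x \<in> chart_range c \<Longrightarrow> J c x (J c x v) = - v"
  using almost_complex by (auto simp: almost_complex_manifold_def)

lemma chart: "c \<in> \<A> \<Longrightarrow> is_chart X c"
  and smooth_transition: "c \<in> \<A> \<Longrightarrow> c' \<in> \<A> \<Longrightarrow> smooth_on (overlap c c') (transition c c')"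
  using manifold by (auto simp: smooth_manifold_def)

lemma open_chart_range: "c \<in> \<A> \<Longrightarrow> open (chart_range c)"
  using chart by (auto simp: is_chart_def)

lemma overlap_subset: "overlap c c' \<subseteq> chart_range c"
  by (auto simp: overlap_def chart_range_def)

lemma transition_in_chart_range:
  assumes "c \<in> \<A>" "x \<in> overlap c c'"
  shows "transition c c' x \<in> chart_range c'"
proof -
  obtain p where "p \<in> fst c" "p \<in> fst c'" "x = snd c p"
    using assms(2) by (auto simp: overlap_def)
  then show ?thesis
    using transition_apply[OF chart[OF assms(1)], of p c'] by (simp add: chart_range_def)
qed

lemma linear_transition_deriv:
  "c \<in> \<A> \<Longrightarrow> c' \<in> \<A> \<Longrightarrow> x \<in> overlap c c' \<Longrightarrow> linear (transition_deriv c c' x)"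
  using smooth_on_has_derivative[OF smooth_transition] has_derivative_linear by blast

lemma frame_exists: "\<exists>C :: 'e set. orthogonal_frame C"
  using manifold orthogonal_frame_exists by (auto simp: smooth_manifold_def)

lemma forms_iff:
  "\<alpha> \<in> forms \<A> k \<longleftrightarrow>
    (\<forall>c x. c \<notin> \<A> \<or> x \<notin> chart_range c \<longrightarrow> \<alpha> c x = 0) \<and>
    (\<forall>c\<in>\<A>. \<forall>x\<in>chart_range c. homogeneous k (\<alpha> c x) \<and> mlin (\<alpha> c x) \<and> alt (\<alpha> c x)) \<and>
    (\<forall>c\<in>\<A>. smooth_field (chart_range c) (\<alpha> c)) \<and>
    (\<forall>c\<in>\<A>. \<forall>c'\<in>\<A>. \<forall>x\<in>overlap c c'. \<forall>vs.
       \<alpha> c x vs = \<alpha> c' (transition c c' x) (map (transition_deriv c c' x) vs))"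
proof -
  have zero: "(\<forall>c x vs. c \<notin> \<A> \<or> x \<notin> chart_range c \<or> int (length vs) \<noteq> k \<longrightarrow> \<alpha> c x vs = 0) \<longleftrightarrow>
      (\<forall>c x. c \<notin> \<A> \<or> x \<notin> chart_range c \<longrightarrow> \<alpha> c x = 0) \<and>
      (\<forall>c\<in>\<A>. \<forall>x\<in>chart_range c. homogeneous k (\<alpha> c x))"
    unfolding homogeneous_def fun_eq_iff zero_fun_apply by blast
  have lin: "(\<forall>c\<in>\<A>. \<forall>x\<in>chart_range c. \<forall>vs.
       (\<forall>i<length vs. linear (\<lambda>v. \<alpha> c x (vs[i := v]))) \<and>
       (\<forall>i j. i < j \<and> j < length vs \<and> vs ! i = vs ! j \<longrightarrow> \<alpha> c x vs = 0)) \<longleftrightarrow>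
      (\<forall>c\<in>\<A>. \<forall>x\<in>chart_range c. mlin (\<alpha> c x) \<and> alt (\<alpha> c x))"
  proof -
    have "(\<forall>vs. (\<forall>i<length vs. linear (\<lambda>v. f (vs[i := v]))) \<and>
        (\<forall>i j. i < j \<and> j < length vs \<and> vs ! i = vs ! j \<longrightarrow> f vs = 0)) \<longleftrightarrow> mlin f \<and> alt f"
      for f :: "'e list \<Rightarrow> complex"
      using alt_iff_repeated[of f] mlin_iff_update[of f] by meson
    then show ?thesis by simp
  qed
  show ?thesis
    unfolding forms_def mem_Collect_eq zero lin smooth_field_def by blast
qed

lemma
  assumes "\<alpha> \<in> forms \<A> k"
  shows form_zero: "c \<notin> \<A> \<or> x \<notin> chart_range c \<Longrightarrow> \<alpha> c x = 0"
    and form_homogeneous: "c \<in> \<A> \<Longrightarrow> x \<in> chart_range c \<Longrightarrow> homogeneous k (\<alpha> c x)"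
    and form_mlin: "c \<in> \<A> \<Longrightarrow> x \<in> chart_range c \<Longrightarrow> mlin (\<alpha> c x)"
    and form_alt: "c \<in> \<A> \<Longrightarrow> x \<in> chart_range c \<Longrightarrow> alt (\<alpha> c x)"
    and form_smooth: "c \<in> \<A> \<Longrightarrow> smooth_field (chart_range c) (\<alpha> c)"
    and form_compatible: "c \<in> \<A> \<Longrightarrow> c' \<in> \<A> \<Longrightarrow> x \<in> overlap c c' \<Longrightarrow>
      \<alpha> c x vs = \<alpha> c' (transition c c' x) (map (transition_deriv c c' x) vs)"
  using assms unfolding forms_iff by blast+

lemma form_eqI:
  assumes "\<alpha> \<in> forms \<A> k" "\<beta> \<in> forms \<A> l"
    and "\<And>c x. c \<in> \<A> \<Longrightarrow> x \<in> chart_range c \<Longrightarrow> \<alpha> c x = \<beta> c x"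
  shows "\<alpha> = \<beta>"
proof (intro ext)
  fix c x vs
  show "\<alpha> c x vs = \<beta> c x vs"
    using assms(3)[of c x] form_zero[OF assms(1), of c x] form_zero[OF assms(2), of c x] by metis
qed

lemma formI:
  assumes "\<And>c x. c \<notin> \<A> \<or> x \<notin> chart_range c \<Longrightarrow> \<alpha> c x = 0"
    and "\<And>c x. c \<in> \<A> \<Longrightarrow> x \<in> chart_range c \<Longrightarrow> homogeneous k (\<alpha> c x)"
    and "\<And>c x. c \<in> \<A> \<Longrightarrow> x \<in> chart_range c \<Longrightarrow> mlin (\<alpha> c x)"
    and "\<And>c x. c \<in> \<A> \<Longrightarrow> x \<in> chart_range c \<Longrightarrow> alt (\<alpha> c x)"
    and "\<And>c. c \<in> \<A> \<Longrightarrow> smooth_field (chart_range c) (\<alpha> c)"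
    and "\<And>c c' x vs. c \<in> \<A> \<Longrightarrow> c' \<in> \<A> \<Longrightarrow> x \<in> overlap c c' \<Longrightarrow>
      \<alpha> c x vs = \<alpha> c' (transition c c' x) (map (transition_deriv c c' x) vs)"
  shows "\<alpha> \<in> forms \<A> k"
  unfolding forms_iff using assms by blast

lemma zero_form: "0 \<in> forms \<A> k"
  by (rule formI) (auto simp: homogeneous_def mlin_def alt_def smooth_field_def smooth_on_const linear_iff)

lemma add_form:
  assumes "\<alpha> \<in> forms \<A> k" "\<beta> \<in> forms \<A> k"
  shows "\<alpha> + \<beta> \<in> forms \<A> k"
proof (rule formI)
  fix c x assume c: "c \<in> \<A>" "x \<in> chart_range c"
  show "homogeneous k ((\<alpha> + \<beta>) c x)"
    using form_homogeneous[OF assms(1) c] form_homogeneous[OF assms(2) c] by (simp add: homogeneous_def)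
  show "mlin ((\<alpha> + \<beta>) c x)"
    using form_mlin[OF assms(1) c] form_mlin[OF assms(2) c] by (simp add: mlin_def linear_compose_add)
  show "alt ((\<alpha> + \<beta>) c x)"
    using form_alt[OF assms(1) c] form_alt[OF assms(2) c] by (simp add: alt_def)
next
  fix c assume c: "c \<in> \<A>"
  show "smooth_field (chart_range c) ((\<alpha> + \<beta>) c)"
    using smooth_field_add[OF open_chart_range[OF c] form_smooth[OF assms(1) c] form_smooth[OF assms(2) c]]
    by (simp add: smooth_field_def)
next
  fix c c' x vs assume c: "c \<in> \<A>" "c' \<in> \<A>" "x \<in> overlap c c'"
  show "(\<alpha> + \<beta>) c x vs = (\<alpha> + \<beta>) c' (transition c c' x) (map (transition_deriv c c' x) vs)"
    using form_compatible[OF assms(1) c] form_compatible[OF assms(2) c] by simp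
qed (use form_zero[OF assms(1)] form_zero[OF assms(2)] in \<open>simp add: fun_eq_iff\<close>)

text \<open>A coefficient depending on the length alone survives a change of charts, which preserves
  lengths. Constants give \<open>scale\<close>, signs give \<open>sign_form\<close>.\<close>

lemma cmult_form:
  fixes z :: "nat \<Rightarrow> complex"
  assumes "\<alpha> \<in> forms \<A> k"
  shows "(\<lambda>c x vs. z (length vs) * \<alpha> c x vs) \<in> forms \<A> k"
proof (rule formI)
  fix c x assume c: "c \<in> \<A>" "x \<in> chart_range c"
  show "homogeneous k (\<lambda>vs. z (length vs) * \<alpha> c x vs)"
    using form_homogeneous[OF assms(1) c] by (simp add: homogeneous_def)
  show "mlin (\<lambda>vs. z (length vs) * \<alpha> c x vs)"
    using form_mlin[OF assms(1) c] by (simp add: mlin_def linear_iff algebra_simps)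
  show "alt (\<lambda>vs. z (length vs) * \<alpha> c x vs)"
    using form_alt[OF assms(1) c] by (simp add: alt_def)
next
  fix c assume c: "c \<in> \<A>"
  show "smooth_field (chart_range c) (\<lambda>x vs. z (length vs) * \<alpha> c x vs)"
    by (rule smooth_field_cmult[OF open_chart_range[OF c] form_smooth[OF assms c]])
next
  fix c c' x vs assume c: "c \<in> \<A>" "c' \<in> \<A>" "x \<in> overlap c c'"
  show "z (length vs) * \<alpha> c x vs = z (length (map (transition_deriv c c' x) vs)) *
      \<alpha> c' (transition c c' x) (map (transition_deriv c c' x) vs)"
    using form_compatible[OF assms(1) c] by simp
qed (use form_zero[OF assms(1)] in \<open>simp add: fun_eq_iff\<close>)

lemma scale_form: "\<alpha> \<in> forms \<A> k \<Longrightarrow> scale z \<alpha> \<in> forms \<A> k"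
  using cmult_form[of \<alpha> k "\<lambda>_. z"] by (simp add: scale_def)

lemma sign_form_form: "\<alpha> \<in> forms \<A> k \<Longrightarrow> sign_form \<alpha> \<in> forms \<A> k"
  using cmult_form[of \<alpha> k "\<lambda>n. (-1) ^ n"] by (simp add: sign_form_def grade_def)

lemma uminus_form: "\<alpha> \<in> forms \<A> k \<Longrightarrow> - \<alpha> \<in> forms \<A> k"
  using scale_form[of \<alpha> k "-1"] by (simp add: scale_minus_one)

lemma diff_form: "\<alpha> \<in> forms \<A> k \<Longrightarrow> \<beta> \<in> forms \<A> k \<Longrightarrow> \<alpha> - \<beta> \<in> forms \<A> k"
  using add_form[OF _ uminus_form, of \<alpha> k \<beta>] by simp

lemma one_form0_eq: "one_form0 \<A> c x = (if c \<in> \<A> \<and> x \<in> chart_range c then empty_list_indicator else 0)"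
  by (auto simp: one_form0_def empty_list_indicator_def fun_eq_iff)

lemma one_form0_form: "one_form0 \<A> \<in> forms \<A> 0"
proof (rule formI)
  fix c assume c: "c \<in> \<A>"
  show "smooth_field (chart_range c) (one_form0 \<A> c)"
    unfolding smooth_field_def
    by (rule allI, rule smooth_on_cong[OF open_chart_range[OF c] smooth_on_const])
      (use c in \<open>simp add: one_form0_eq\<close>)
next
  fix c c' x vs assume c: "c \<in> \<A>" "c' \<in> \<A>" "x \<in> overlap c c'"
  then show "one_form0 \<A> c x vs = one_form0 \<A> c' (transition c c' x) (map (transition_deriv c c' x) vs)"
    using transition_in_chart_range[OF c(1,3)] overlap_subset[of c c'] by (auto simp: one_form0_def)
qed (auto simp: one_form0_def homogeneous_def mlin_def alt_def linear_iff)

lemma wedge_form: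
  assumes "\<alpha> \<in> forms \<A> k" "\<beta> \<in> forms \<A> l"
  shows "wedge \<alpha> \<beta> \<in> forms \<A> (k + l)"
  unfolding wedge_eq_shuffle_prod
proof (rule formI)
  fix c x assume c: "c \<in> \<A>" "x \<in> chart_range c"
  note * = form_homogeneous form_mlin form_alt
  note ** = *[OF assms(1) c] *[OF assms(2) c]
  show "homogeneous (k + l) (shuffle_prod (\<alpha> c x) (\<beta> c x))"
      "mlin (shuffle_prod (\<alpha> c x) (\<beta> c x))" "alt (shuffle_prod (\<alpha> c x) (\<beta> c x))"
    by (rule homogeneous_shuffle_prod mlin_shuffle_prod alt_shuffle_prod; rule **)+
next
  fix c assume c: "c \<in> \<A>"
  show "smooth_field (chart_range c) (\<lambda>x. shuffle_prod (\<alpha> c x) (\<beta> c x))"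
    by (rule smooth_field_shuffle_prod[OF open_chart_range[OF c] form_smooth[OF assms(1) c] form_smooth[OF assms(2) c]])
next
  fix c c' x vs assume c: "c \<in> \<A>" "c' \<in> \<A>" "x \<in> overlap c c'"
  let ?L = "transition_deriv c c' x"
  have "\<alpha> c x = (\<lambda>vs. \<alpha> c' (transition c c' x) (map ?L vs))"
      "\<beta> c x = (\<lambda>vs. \<beta> c' (transition c c' x) (map ?L vs))"
    using form_compatible[OF assms(1) c] form_compatible[OF assms(2) c] by blast+
  then show "shuffle_prod (\<alpha> c x) (\<beta> c x) vs =
      shuffle_prod (\<alpha> c' (transition c c' x)) (\<beta> c' (transition c c' x)) (map ?L vs)"
    by (simp add: shuffle_prod_map)
qed (use form_zero[OF assms(1)] in simp)

lemma wedge_one_left: "\<alpha> \<in> forms \<A> k \<Longrightarrow> wedge (one_form0 \<A>) \<alpha> = \<alpha>"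
  using form_zero by (fastforce simp: wedge_eq_shuffle_prod fun_eq_iff one_form0_eq shuffle_prod_unit_left)

lemma wedge_one_right: "\<alpha> \<in> forms \<A> k \<Longrightarrow> wedge \<alpha> (one_form0 \<A>) = \<alpha>"
  using form_zero by (fastforce simp: wedge_eq_shuffle_prod fun_eq_iff one_form0_eq shuffle_prod_unit_right)

section \<open>The exterior derivative of forms\<close>

lemma field_d_zero: "field_d (\<lambda>y. 0) x = 0"
  by (simp add: field_d_def alternating_sum_def dir_deriv_def fun_eq_iff frechet_derivative_eqI[OF has_derivative_const])

text \<open>For a chart outside the atlas \<open>ext_d\<close> still differentiates; the result is
  \<open>0\<close> because the form is identically \<open>0\<close> in that chart.\<close>

lemma ext_d_eq:
  "\<alpha> \<in> forms \<A> k \<Longrightarrow> ext_d \<alpha> c x = (if c \<in> \<A> \<and> x \<in> chart_range c then field_d (\<alpha> c) x else 0)"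
proof -
  assume \<alpha>: "\<alpha> \<in> forms \<A> k"
  consider "c \<in> \<A>" "x \<in> chart_range c" | "x \<notin> chart_range c" | "c \<notin> \<A>" "x \<in> chart_range c" by blast
  then show ?thesis
  proof cases
    case 3
    then have "\<alpha> c = (\<lambda>y. 0)" using form_zero[OF \<alpha>] by blast
    with 3 show ?thesis by (simp add: ext_d_eq_field_d field_d_zero)
  qed (auto simp: ext_d_eq_field_d, simp add: ext_d_def fun_eq_iff)
qed

lemma ext_d_form:
  assumes "\<alpha> \<in> forms \<A> k"
  shows "ext_d \<alpha> \<in> forms \<A> (k + 1)"
proof (rule formI)
  fix c x assume c: "c \<in> \<A>" "x \<in> chart_range c"
  note U = open_chart_range[OF c(1)]
  note * = form_smooth[OF assms c(1)] form_homogeneous[OF assms c(1)] form_mlin[OF assms c(1)] form_alt[OF assms c(1)]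
  show "homogeneous (k + 1) (ext_d \<alpha> c x)"
    using homogeneous_field_d[OF U c(2) *(2)] c by (simp add: ext_d_eq[OF assms])
  show "mlin (ext_d \<alpha> c x)"
    using mlin_field_d[OF U *(1) c(2) *(3)] c by (simp add: ext_d_eq[OF assms])
  show "alt (ext_d \<alpha> c x)"
    using alt_field_d[OF U *(1) c(2) *(4)] c by (simp add: ext_d_eq[OF assms])
next
  fix c assume c: "c \<in> \<A>"
  have "smooth_on (chart_range c) (\<lambda>x. ext_d \<alpha> c x vs)" for vs
    by (rule smooth_on_cong[OF open_chart_range[OF c]
          smooth_field_d[OF open_chart_range[OF c] form_smooth[OF assms c], unfolded smooth_field_def, rule_format]])
      (use c in \<open>simp add: ext_d_eq[OF assms]\<close>)
  then show "smooth_field (chart_range c) (ext_d \<alpha> c)"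
    by (simp add: smooth_field_def)
next
  fix c c' x vs assume c: "c \<in> \<A>" "c' \<in> \<A>" "x \<in> overlap c c'"
  obtain C :: "'e set" where "orthogonal_frame C" using frame_exists by blast
  then interpret orthogonal_frame C .
  \<comment> \<open>Compatibility of \<open>\<alpha>\<close> says that its representative in
    \<open>c\<close> is, on the overlap, the pullback of that in \<open>c'\<close> by the transition
    map.\<close>
  have "field_d (\<alpha> c) x vs = field_d (\<alpha> c') (transition c c' x) (map (transition_deriv c c' x) vs)"
  proof (rule field_d_pullback[where V = "chart_range c'"])
    show "transition c c' ` overlap c c' \<subseteq> chart_range c'"
      using transition_in_chart_range[OF c(1)] by blast
  qed (fact open_overlap[OF chart[OF c(1)] chart[OF c(2)]] c(3) smooth_transition[OF c(1,2)]
      form_smooth[OF assms c(2)] form_mlin[OF assms c(2)] form_alt[OF assms c(2)] form_compatible[OF assms c(1,2)])+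
  moreover have "x \<in> chart_range c" "transition c c' x \<in> chart_range c'"
    using c(3) overlap_subset[of c c'] transition_in_chart_range[OF c(1,3)] by blast+
  ultimately show "ext_d \<alpha> c x vs = ext_d \<alpha> c' (transition c c' x) (map (transition_deriv c c' x) vs)"
    using c by (simp add: ext_d_eq[OF assms])
qed (use ext_d_eq[OF assms] in auto)

lemma ext_d_wedge:
  assumes "\<alpha> \<in> forms \<A> k" "\<beta> \<in> forms \<A> l"
  shows "ext_d (wedge \<alpha> \<beta>) = wedge (ext_d \<alpha>) \<beta> + wedge (sign_form \<alpha>) (ext_d \<beta>)"
proof (rule form_eqI)
  show "ext_d (wedge \<alpha> \<beta>) \<in> forms \<A> (k + l + 1)"
    by (intro ext_d_form wedge_form assms)
  have "wedge (ext_d \<alpha>) \<beta> \<in> forms \<A> (k + 1 + l)" "wedge (sign_form \<alpha>) (ext_d \<beta>) \<in> forms \<A> (k + (l + 1))"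
    by (intro ext_d_form wedge_form sign_form_form assms)+
  then show "wedge (ext_d \<alpha>) \<beta> + wedge (sign_form \<alpha>) (ext_d \<beta>) \<in> forms \<A> (k + l + 1)"
    by (intro add_form) (simp_all add: algebra_simps)
next
  fix c x assume c: "c \<in> \<A>" "x \<in> chart_range c"
  show "ext_d (wedge \<alpha> \<beta>) c x = (wedge (ext_d \<alpha>) \<beta> + wedge (sign_form \<alpha>) (ext_d \<beta>)) c x"
    using field_d_shuffle_prod[OF open_chart_range[OF c(1)] form_smooth[OF assms(1) c(1)] form_smooth[OF assms(2) c(1)] c(2)] c
    by (simp add: ext_d_eq[OF wedge_form[OF assms]] ext_d_eq[OF assms(1)] ext_d_eq[OF assms(2)])
      (simp add: wedge_eq_shuffle_prod sign_form_def ext_d_eq[OF assms(1)] ext_d_eq[OF assms(2)])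
qed

lemma ext_d_ext_d:
  assumes "\<alpha> \<in> forms \<A> k"
  shows "ext_d (ext_d \<alpha>) = 0"
proof (rule form_eqI[OF ext_d_form[OF ext_d_form[OF assms]] zero_form])
  fix c x assume c: "c \<in> \<A>" "x \<in> chart_range c"
  have "field_d (ext_d \<alpha> c) x = field_d (field_d (\<alpha> c)) x"
    by (rule field_d_cong[OF open_chart_range[OF c(1)] c(2)]) (simp add: ext_d_eq[OF assms] c)
  then show "ext_d (ext_d \<alpha>) c x = 0 c x"
    using field_d_field_d[OF open_chart_range[OF c(1)] form_smooth[OF assms c(1)] c(2)] c
    by (simp add: ext_d_eq[OF ext_d_form[OF assms]])
qed

lemma ext_d_add:
  assumes "\<alpha> \<in> forms \<A> k" "\<beta> \<in> forms \<A> k"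
  shows "ext_d (\<alpha> + \<beta>) = ext_d \<alpha> + ext_d \<beta>"
proof (rule form_eqI[OF ext_d_form[OF add_form[OF assms]] add_form[OF ext_d_form[OF assms(1)] ext_d_form[OF assms(2)]]])
  fix c x assume c: "c \<in> \<A>" "x \<in> chart_range c"
  show "ext_d (\<alpha> + \<beta>) c x = (ext_d \<alpha> + ext_d \<beta>) c x"
  proof -
    have "(\<alpha> + \<beta>) c = (\<lambda>y. \<alpha> c y + \<beta> c y)"
      by (simp add: fun_eq_iff)
    then show ?thesis
      using field_d_add[OF open_chart_range[OF c(1)] form_smooth[OF assms(1) c(1)] form_smooth[OF assms(2) c(1)] c(2)] c
      by (simp add: ext_d_eq[OF add_form[OF assms]] ext_d_eq[OF assms(1)] ext_d_eq[OF assms(2)])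
  qed
qed

lemma ext_d_scale:
  assumes "\<alpha> \<in> forms \<A> k"
  shows "ext_d (scale z \<alpha>) = scale z (ext_d \<alpha>)"
proof (rule form_eqI[OF ext_d_form[OF scale_form[OF assms]] scale_form[OF ext_d_form[OF assms]]])
  fix c x assume c: "c \<in> \<A>" "x \<in> chart_range c"
  show "ext_d (scale z \<alpha>) c x = scale z (ext_d \<alpha>) c x"
    using field_d_cmult[OF open_chart_range[OF c(1)] form_smooth[OF assms c(1)] c(2)] c
    by (simp add: ext_d_eq[OF scale_form[OF assms]] fun_eq_iff) (simp add: scale_def ext_d_eq[OF assms])
qed

lemma ext_d_sign_form:
  assumes "\<alpha> \<in> forms \<A> k"
  shows "ext_d (sign_form \<alpha>) = - sign_form (ext_d \<alpha>)"
proof (rule form_eqI[OF ext_d_form[OF sign_form_form[OF assms]] uminus_form[OF sign_form_form[OF ext_d_form[OF assms]]]])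
  fix c x assume c: "c \<in> \<A>" "x \<in> chart_range c"
  show "ext_d (sign_form \<alpha>) c x = (- sign_form (ext_d \<alpha>)) c x"
    using field_d_grade[OF open_chart_range[OF c(1)] form_smooth[OF assms c(1)] c(2)] c
    by (simp add: ext_d_eq[OF sign_form_form[OF assms]]) (simp add: sign_form_def ext_d_eq[OF assms])
qed

section \<open>The action of \<open>J\<close> and the operator \<open>d\<^sup>c\<close>\<close>

lemma dual_act_form:
  assumes "\<alpha> \<in> forms \<A> k" "smooth_endo_field \<A> L"
  shows "dual_act L \<alpha> \<in> forms \<A> k"
  unfolding dual_act_def
proof (rule formI)
  fix c x assume c: "c \<in> \<A>" "x \<in> chart_range c"
  have lin: "linear (L c x)"
    using assms(2) c by (auto simp: smooth_endo_field_def)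
  show "homogeneous k (\<lambda>vs. \<alpha> c x (map (L c x) vs))"
    using form_homogeneous[OF assms(1) c] by (simp add: homogeneous_def)
  show "mlin (\<lambda>vs. \<alpha> c x (map (L c x) vs))"
    unfolding mlin_def
  proof (intro allI)
    fix us vs
    have "linear (\<lambda>v. \<alpha> c x (map (L c x) us @ v # map (L c x) vs))"
      using form_mlin[OF assms(1) c] by (simp add: mlin_def)
    from linear_compose[OF lin this]
    show "linear (\<lambda>v. \<alpha> c x (map (L c x) (us @ v # vs)))"
      by (simp add: o_def)
  qed
  show "alt (\<lambda>vs. \<alpha> c x (map (L c x) vs))"
    using form_alt[OF assms(1) c] by (simp add: alt_def)
next
  fix c assume c: "c \<in> \<A>"
  obtain C :: "'e set" where "orthogonal_frame C" using frame_exists by blast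
  then interpret orthogonal_frame C .
  show "smooth_field (chart_range c) (\<lambda>x vs. \<alpha> c x (map (L c x) vs))"
    unfolding smooth_field_def
    by (rule allI, rule smooth_on_map_args[OF open_chart_range[OF c] form_smooth[OF assms(1) c] form_mlin[OF assms(1) c]])
      (use assms(2) c in \<open>auto simp: smooth_endo_field_def\<close>)
next
  fix c c' x vs assume c: "c \<in> \<A>" "c' \<in> \<A>" "x \<in> overlap c c'"
  have "transition_deriv c c' x (L c x v) = L c' (transition c c' x) (transition_deriv c c' x v)" for v
    using assms(2) c by (auto simp: smooth_endo_field_def)
  then show "\<alpha> c x (map (L c x) vs) =
      \<alpha> c' (transition c c' x) (map (L c' (transition c c' x)) (map (transition_deriv c c' x) vs))"
    using form_compatible[OF assms(1) c, of "map (L c x) vs"] by (simp add: o_def)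
qed (use form_zero[OF assms(1)] in \<open>simp add: fun_eq_iff\<close>)

text \<open>The inverse of \<open>J\<close> on the atlas, as \<open>J\<close> squares to
  \<open>-1\<close>. Written this way, it inherits linearity and smoothness from
  \<open>J\<close>.\<close>

definition J_inv :: "('m, 'e) endo_field"
  where "J_inv c x v = - J c x v"

lemma smooth_J_inv: "smooth_endo_field \<A> J_inv"
proof -
  have "linear (J_inv c x)" if "c \<in> \<A>" "x \<in> chart_range c" for c x
    using linear_compose_neg[of "J c x"] smooth_J that by (simp add: smooth_endo_field_def J_inv_def[abs_def])
  moreover have "smooth_on (chart_range c) (\<lambda>x. J_inv c x v)" if "c \<in> \<A>" for c v
    by (rule smooth_on_bounded_linear[OF bounded_linear_minus[OF bounded_linear_ident] open_chart_range[OF that], of "\<lambda>x. J c x v"])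
      (use smooth_J that in \<open>auto simp: smooth_endo_field_def J_inv_def\<close>)
  moreover have "transition_deriv c c' x (J_inv c x v) = J_inv c' (transition c c' x) (transition_deriv c c' x v)"
    if "c \<in> \<A>" "c' \<in> \<A>" "x \<in> overlap c c'" for c c' x v
    using linear_neg[OF linear_transition_deriv[OF that]] smooth_J that
    by (simp add: smooth_endo_field_def J_inv_def)
  ultimately show ?thesis by (simp add: smooth_endo_field_def)
qed

lemma inv_J:
  assumes "c \<in> \<A>" "x \<in> chart_range c"
  shows "inv_into UNIV (J c x) = J_inv c x"
proof -
  have lin: "linear (J c x)" using smooth_J assms by (auto simp: smooth_endo_field_def)
  have 1: "J c x (J_inv c x v) = v" "J_inv c x (J c x v) = v" for v
    using J_J[OF assms] linear_neg[OF lin] by (simp_all add: J_inv_def)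
  then show ?thesis
    by (intro inv_unique_comp) (simp_all add: fun_eq_iff)
qed

lemma dual_act_J_J_inv: "\<alpha> \<in> forms \<A> k \<Longrightarrow> dual_act J (dual_act J_inv \<alpha>) = \<alpha>"
proof (rule form_eqI[OF dual_act_form[OF dual_act_form[OF _ smooth_J_inv] smooth_J]])
  fix c x assume c: "c \<in> \<A>" "x \<in> chart_range c"
  have "J_inv c x (J c x v) = v" for v
    using J_J[OF c] by (simp add: J_inv_def)
  then show "dual_act J (dual_act J_inv \<alpha>) c x = \<alpha> c x"
    by (simp add: dual_act_def o_def)
qed

lemma ext_dc_eq:
  assumes "\<alpha> \<in> forms \<A> k"
  shows "ext_dc J \<alpha> = dual_act J_inv (ext_d (dual_act J \<alpha>))"
proof (intro ext)
  fix c x vs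
  show "ext_dc J \<alpha> c x vs = dual_act J_inv (ext_d (dual_act J \<alpha>)) c x vs"
  proof (cases "c \<in> \<A> \<and> x \<in> chart_range c")
    \<comment> \<open>Here \<open>J_inv\<close> and the chosen inverse of \<open>J\<close> may
      differ, but the form they act on is \<open>0\<close> at such points.\<close>
    case False
    then have "ext_d (dual_act J \<alpha>) c x = 0"
      using ext_d_eq[OF dual_act_form[OF assms smooth_J], of c x] by auto
    then show ?thesis
      by (simp add: ext_dc_def dual_act_apply)
  qed (simp add: ext_dc_def dual_act_apply inv_J)
qed

lemma ext_dc_form: "\<alpha> \<in> forms \<A> k \<Longrightarrow> ext_dc J \<alpha> \<in> forms \<A> (k + 1)"
  by (simp add: ext_dc_eq dual_act_form ext_d_form smooth_J smooth_J_inv)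

lemma dual_act_J_ext_dc: "\<alpha> \<in> forms \<A> k \<Longrightarrow> dual_act J (ext_dc J \<alpha>) = ext_d (dual_act J \<alpha>)"
  by (simp add: ext_dc_eq dual_act_J_J_inv[OF ext_d_form[OF dual_act_form[OF _ smooth_J]]])

lemma ext_dc_ext_dc: "\<alpha> \<in> forms \<A> k \<Longrightarrow> ext_dc J (ext_dc J \<alpha>) = 0"
  by (simp add: ext_dc_eq[OF ext_dc_form] dual_act_J_ext_dc ext_d_ext_d[OF dual_act_form[OF _ smooth_J]] dual_act_zero)

lemma dual_act_J_inv_J:
  assumes "\<alpha> \<in> forms \<A> k"
  shows "dual_act J_inv (dual_act J \<alpha>) = \<alpha>"
proof (rule form_eqI[OF dual_act_form[OF dual_act_form[OF assms smooth_J] smooth_J_inv] assms])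
  fix c x assume c: "c \<in> \<A>" "x \<in> chart_range c"
  have lin: "linear (J c x)" using smooth_J c by (auto simp: smooth_endo_field_def)
  have "J c x (J_inv c x v) = v" for v
    using J_J[OF c] linear_neg[OF lin] by (simp add: J_inv_def)
  then show "dual_act J_inv (dual_act J \<alpha>) c x = \<alpha> c x"
    by (simp add: dual_act_def o_def)
qed

text \<open>The dual action is multiplicative and preserves the length of lists, so conjugating with
  it turns the Leibniz rule for \<open>d\<close> into that for \<open>d\<^sup>c\<close>, with the
  same sign.\<close>

lemma ext_dc_wedge:
  assumes "\<alpha> \<in> forms \<A> k" "\<beta> \<in> forms \<A> l"
  shows "ext_dc J (wedge \<alpha> \<beta>) = wedge (ext_dc J \<alpha>) \<beta> + wedge (sign_form \<alpha>) (ext_dc J \<beta>)"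
  by (simp add: ext_dc_eq[OF wedge_form[OF assms]] ext_dc_eq[OF assms(1)] ext_dc_eq[OF assms(2)] dual_act_wedge
      ext_d_wedge[OF dual_act_form[OF assms(1) smooth_J] dual_act_form[OF assms(2) smooth_J]]
      dual_act_add dual_act_sign_form dual_act_J_inv_J[OF assms(1)] dual_act_J_inv_J[OF assms(2)])

lemma ext_dc_add:
  assumes "\<alpha> \<in> forms \<A> k" "\<beta> \<in> forms \<A> k"
  shows "ext_dc J (\<alpha> + \<beta>) = ext_dc J \<alpha> + ext_dc J \<beta>"
  by (simp add: ext_dc_eq[OF add_form[OF assms]] ext_dc_eq[OF assms(1)] ext_dc_eq[OF assms(2)] dual_act_add
      ext_d_add[OF dual_act_form[OF assms(1) smooth_J] dual_act_form[OF assms(2) smooth_J]])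

lemma ext_dc_scale:
  assumes "\<alpha> \<in> forms \<A> k"
  shows "ext_dc J (scale z \<alpha>) = scale z (ext_dc J \<alpha>)"
  by (simp add: ext_dc_eq[OF scale_form[OF assms]] ext_dc_eq[OF assms] dual_act_scale
      ext_d_scale[OF dual_act_form[OF assms smooth_J]])

lemma ext_dc_sign_form:
  assumes "\<alpha> \<in> forms \<A> k"
  shows "ext_dc J (sign_form \<alpha>) = - sign_form (ext_dc J \<alpha>)"
  by (simp add: ext_dc_eq[OF sign_form_form[OF assms]] ext_dc_eq[OF assms] dual_act_sign_form
      ext_d_sign_form[OF dual_act_form[OF assms smooth_J]] dual_act_uminus)

end

section \<open>Cohomology classes as quotients\<close>

definition form_subspace :: "('m, 'e) form set \<Rightarrow> bool"
  where "form_subspace N \<longleftrightarrow>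
    0 \<in> N \<and> (\<forall>\<alpha>\<in>N. \<forall>\<beta>\<in>N. \<alpha> + \<beta> \<in> N) \<and> (\<forall>z. \<forall>\<alpha>\<in>N. scale z \<alpha> \<in> N)"

lemma
  assumes "form_subspace N"
  shows subspace_zero: "0 \<in> N"
    and subspace_add: "\<alpha> \<in> N \<Longrightarrow> \<beta> \<in> N \<Longrightarrow> \<alpha> + \<beta> \<in> N"
    and subspace_scale: "\<alpha> \<in> N \<Longrightarrow> scale z \<alpha> \<in> N"
    and subspace_uminus: "\<alpha> \<in> N \<Longrightarrow> - \<alpha> \<in> N"
    and subspace_diff: "\<alpha> \<in> N \<Longrightarrow> \<beta> \<in> N \<Longrightarrow> \<alpha> - \<beta> \<in> N"
proof -
  show 1: "0 \<in> N" and 2: "\<alpha> \<in> N \<Longrightarrow> \<beta> \<in> N \<Longrightarrow> \<alpha> + \<beta> \<in> N"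
    and 3: "\<alpha> \<in> N \<Longrightarrow> scale z \<alpha> \<in> N" for \<alpha> \<beta> z
    using assms by (simp_all add: form_subspace_def)
  show 4: "- \<alpha> \<in> N" if "\<alpha> \<in> N" for \<alpha>
    using 3[OF that, of "-1"] by (simp only: scale_minus_one)
  show "\<alpha> \<in> N \<Longrightarrow> \<beta> \<in> N \<Longrightarrow> \<alpha> - \<beta> \<in> N"
    using 2[OF _ 4, of \<alpha> \<beta>] by simp
qed

lemma image_subspace:
  assumes "form_subspace N"
    and "\<And>\<alpha> \<beta>. \<alpha> \<in> N \<Longrightarrow> \<beta> \<in> N \<Longrightarrow> f (\<alpha> + \<beta>) = f \<alpha> + f \<beta>"
    and "\<And>z \<alpha>. \<alpha> \<in> N \<Longrightarrow> f (scale z \<alpha>) = scale z (f \<alpha>)"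
  shows "form_subspace (f ` N)"
  unfolding form_subspace_def
proof (intro conjI ballI allI)
  show "0 \<in> f ` N"
    using assms(3)[OF subspace_zero[OF assms(1)], of 0] subspace_zero[OF assms(1)]
    by (intro image_eqI[of _ _ 0]) (simp_all add: scale_zero_left)
next
  fix \<alpha> \<beta> assume "\<alpha> \<in> f ` N" "\<beta> \<in> f ` N"
  then obtain \<alpha>' \<beta>' where "\<alpha>' \<in> N" "\<beta>' \<in> N" "\<alpha> = f \<alpha>'" "\<beta> = f \<beta>'" by blast
  then show "\<alpha> + \<beta> \<in> f ` N"
    by (intro image_eqI[of _ _ "\<alpha>' + \<beta>'"]) (simp_all add: assms(2) subspace_add[OF assms(1)])
next
  fix z \<alpha> assume "\<alpha> \<in> f ` N"
  then obtain \<alpha>' where "\<alpha>' \<in> N" "\<alpha> = f \<alpha>'" by blast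
  then show "scale z \<alpha> \<in> f ` N"
    by (intro image_eqI[of _ _ "scale z \<alpha>'"]) (simp_all add: assms(3) subspace_scale[OF assms(1)])
qed

lemma coset_eq_iff:
  assumes "form_subspace N"
  shows "\<alpha> +o N = \<beta> +o N \<longleftrightarrow> \<alpha> - \<beta> \<in> N"
proof
  assume eq: "\<alpha> +o N = \<beta> +o N"
  have "\<alpha> \<in> \<alpha> +o N"
    using set_plus_intro2[OF subspace_zero[OF assms], of \<alpha>] by simp
  then show "\<alpha> - \<beta> \<in> N"
    unfolding eq by (auto simp: elt_set_plus_def)
next
  assume diff: "\<alpha> - \<beta> \<in> N"
  have "\<alpha> +o N \<subseteq> \<beta> +o N" if "\<alpha> - \<beta> \<in> N" for \<alpha> \<beta>
  proof
    fix \<gamma> assume "\<gamma> \<in> \<alpha> +o N"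
    then obtain n where n: "n \<in> N" "\<gamma> = \<alpha> + n" by (auto simp: elt_set_plus_def)
    have "\<beta> + ((\<alpha> - \<beta>) + n) \<in> \<beta> +o N"
      by (rule set_plus_intro2[OF subspace_add[OF assms that n(1)]])
    then show "\<gamma> \<in> \<beta> +o N"
      by (simp add: n(2))
  qed
  from this[OF diff] this[of \<beta> \<alpha>] show "\<alpha> +o N = \<beta> +o N"
    using subspace_uminus[OF assms diff] by simp
qed

lemma subspace_plus_self:
  assumes "form_subspace N"
  shows "N + N = N"
proof
  show "N + N \<subseteq> N"
    using subspace_add[OF assms] by (auto simp: set_plus_def)
  show "N \<subseteq> N + N"
    using set_plus_intro[OF subspace_zero[OF assms]] by fastforce
qed

lemma coset_plus: "form_subspace N \<Longrightarrow> (\<alpha> +o N) + (\<beta> +o N) = (\<alpha> + \<beta>) +o N"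
  by (simp add: set_plus_rearrange subspace_plus_self)

text \<open>Additivity is asked only for \<open>\<alpha>\<close> plus elements of \<open>N\<close>,
  because \<open>ext_d\<close> and \<open>ext_dc\<close> are shown to be additive on forms, not on
  arbitrary functions.\<close>

lemma induced_coset:
  assumes "form_subspace N" "form_subspace N'"
    and "\<And>\<nu>. \<nu> \<in> N \<Longrightarrow> f (\<alpha> + \<nu>) = f \<alpha> + f \<nu>" "\<And>\<nu>. \<nu> \<in> N \<Longrightarrow> f \<nu> \<in> N'"
  shows "induced N' f (\<alpha> +o N) = f \<alpha> +o N'"
proof
  show "induced N' f (\<alpha> +o N) \<subseteq> f \<alpha> +o N'"
  proof
    fix \<gamma> assume "\<gamma> \<in> induced N' f (\<alpha> +o N)"
    then obtain \<nu> \<nu>' where "\<nu> \<in> N" "\<nu>' \<in> N'" "\<gamma> = f (\<alpha> + \<nu>) + \<nu>'"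
      by (auto simp: induced_def set_plus_def elt_set_plus_def)
    then show "\<gamma> \<in> f \<alpha> +o N'"
      using assms(3,4) subspace_add[OF assms(2), of "f \<nu>" \<nu>'] by (auto simp: add.assoc)
  qed
  show "f \<alpha> +o N' \<subseteq> induced N' f (\<alpha> +o N)"
  proof
    fix \<gamma> assume "\<gamma> \<in> f \<alpha> +o N'"
    then obtain \<nu>' where "\<nu>' \<in> N'" "\<gamma> = f \<alpha> + \<nu>'" by (auto simp: elt_set_plus_def)
    moreover have "\<alpha> \<in> \<alpha> +o N"
      using set_plus_intro2[OF subspace_zero[OF assms(1)], of \<alpha>] by simp
    ultimately show "\<gamma> \<in> induced N' f (\<alpha> +o N)"
      by (auto simp: induced_def)
  qed
qed

text \<open>\<open>q\<close> is a surjective linear map from a space of forms onto \<open>U\<close>,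
  so module axioms and bilinearity can be checked on forms. This presents cosets and cosets of
  cosets in the same way.\<close>

definition quotient_space ::
    "(complex, 'q, 'x) module_scheme \<Rightarrow> (('m, 'e) form \<Rightarrow> 'q) \<Rightarrow> ('m, 'e) form set \<Rightarrow> bool"
  where "quotient_space U q Z \<longleftrightarrow> form_subspace Z \<and> carrier U = q ` Z \<and> \<zero>\<^bsub>U\<^esub> = q 0 \<and>
    (\<forall>\<alpha>\<in>Z. \<forall>\<beta>\<in>Z. q \<alpha> \<oplus>\<^bsub>U\<^esub> q \<beta> = q (\<alpha> + \<beta>)) \<and>
    (\<forall>z. \<forall>\<alpha>\<in>Z. z \<odot>\<^bsub>U\<^esub> q \<alpha> = q (scale z \<alpha>))"

lemma cring_complex_ring: "cring complex_ring"
proof (rule cringI)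
  show "abelian_group complex_ring"
    by (rule abelian_groupI) (auto simp: complex_ring_def intro: exI[of _ "- _"])
  show "comm_monoid complex_ring"
    by (rule comm_monoidI) (auto simp: complex_ring_def)
qed (auto simp: complex_ring_def algebra_simps)

lemma quotient_space_module:
  assumes "quotient_space U q Z"
  shows "Module.module complex_ring U"
proof -
  have Z: "form_subspace Z" and U: "carrier U = q ` Z" "\<zero>\<^bsub>U\<^esub> = q 0"
    "\<And>\<alpha> \<beta>. \<alpha> \<in> Z \<Longrightarrow> \<beta> \<in> Z \<Longrightarrow> q \<alpha> \<oplus>\<^bsub>U\<^esub> q \<beta> = q (\<alpha> + \<beta>)"
    "\<And>z \<alpha>. \<alpha> \<in> Z \<Longrightarrow> z \<odot>\<^bsub>U\<^esub> q \<alpha> = q (scale z \<alpha>)"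
    using assms by (auto simp: quotient_space_def)
  note closed = subspace_zero[OF Z] subspace_add[OF Z] subspace_scale[OF Z] subspace_uminus[OF Z]
  have "abelian_group U"
  proof (rule abelian_groupI)
    fix x assume "x \<in> carrier U"
    then obtain \<alpha> where "\<alpha> \<in> Z" "x = q \<alpha>" by (auto simp: U)
    then show "\<exists>y\<in>carrier U. y \<oplus>\<^bsub>U\<^esub> x = \<zero>\<^bsub>U\<^esub>"
      by (intro bexI[of _ "q (- \<alpha>)"]) (simp_all add: U closed)
  qed (auto simp: U closed algebra_simps)
  then show ?thesis
    by (rule moduleI[OF cring_complex_ring])
      (auto simp: U closed complex_ring_def scale_add scale_add_left scale_scale scale_one)
qed

lemma quotient_space_bilinear:
  assumes "quotient_space U q\<^sub>1 Z\<^sub>1" "quotient_space V q\<^sub>2 Z\<^sub>2" "quotient_space W q\<^sub>3 Z\<^sub>3"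
    and "\<And>\<alpha> \<beta>. \<alpha> \<in> Z\<^sub>1 \<Longrightarrow> \<beta> \<in> Z\<^sub>2 \<Longrightarrow> wedge \<alpha> \<beta> \<in> Z\<^sub>3"
    and "\<And>\<alpha> \<beta>. \<alpha> \<in> Z\<^sub>1 \<Longrightarrow> \<beta> \<in> Z\<^sub>2 \<Longrightarrow> f (q\<^sub>1 \<alpha>) (q\<^sub>2 \<beta>) = q\<^sub>3 (wedge \<alpha> \<beta>)"
  shows "bilinear_pairing complex_ring U V W f"
  using assms
  by (auto simp: bilinear_pairing_def quotient_space_def form_subspace_def wedge_add_left wedge_add_right
      wedge_scale_left wedge_scale_right)

section \<open>The second-order operators and wedge products\<close>

context almost_complex
begin

lemma ddc_plus_dcd_form: "\<alpha> \<in> forms \<A> k \<Longrightarrow> ddc_plus_dcd J \<alpha> \<in> forms \<A> (k + 2)"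
  using add_form[OF ext_d_form[OF ext_dc_form] ext_dc_form[OF ext_d_form], of \<alpha> k \<alpha>]
  by (simp add: ddc_plus_dcd_def add.assoc)

lemma ddc_add: "\<alpha> \<in> forms \<A> k \<Longrightarrow> \<beta> \<in> forms \<A> k \<Longrightarrow> ddc J (\<alpha> + \<beta>) = ddc J \<alpha> + ddc J \<beta>"
  by (simp add: ddc_def ext_dc_add ext_d_add[OF ext_dc_form ext_dc_form])

lemma ddc_scale: "\<alpha> \<in> forms \<A> k \<Longrightarrow> ddc J (scale z \<alpha>) = scale z (ddc J \<alpha>)"
  by (simp add: ddc_def ext_dc_scale ext_d_scale[OF ext_dc_form])

lemma ddc_plus_dcd_add:
  "\<alpha> \<in> forms \<A> k \<Longrightarrow> \<beta> \<in> forms \<A> k \<Longrightarrow>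
    ddc_plus_dcd J (\<alpha> + \<beta>) = ddc_plus_dcd J \<alpha> + ddc_plus_dcd J \<beta>"
  by (simp add: ddc_plus_dcd_def ext_dc_add ext_d_add[OF ext_dc_form ext_dc_form] ext_d_add
      ext_dc_add[OF ext_d_form ext_d_form])

lemma ddc_plus_dcd_scale:
  "\<alpha> \<in> forms \<A> k \<Longrightarrow> ddc_plus_dcd J (scale z \<alpha>) = scale z (ddc_plus_dcd J \<alpha>)"
  by (simp add: ddc_plus_dcd_def ext_dc_scale ext_d_scale[OF ext_dc_form] ext_d_scale
      ext_dc_scale[OF ext_d_form] scale_add)

lemma ext_d_zero: "ext_d 0 = (0 :: ('m, 'e) form)"
  using ext_d_scale[OF zero_form, of 0] by (simp add: scale_zero_left)

lemma ext_dc_zero: "ext_dc J 0 = 0"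
  using ext_dc_scale[OF zero_form, of 0] by (simp add: scale_zero_left)

text \<open>\<open>dd\<^sup>c + d\<^sup>cd\<close> is the graded commutator of two odd derivations, hence an even derivation.\<close>

lemma ddc_plus_dcd_wedge:
  assumes \<alpha>: "\<alpha> \<in> forms \<A> k" and \<beta>: "\<beta> \<in> forms \<A> l"
  shows "ddc_plus_dcd J (wedge \<alpha> \<beta>) = wedge (ddc_plus_dcd J \<alpha>) \<beta> + wedge \<alpha> (ddc_plus_dcd J \<beta>)"
proof -
  note f = ext_d_form[OF \<alpha>] ext_dc_form[OF \<alpha>] ext_d_form[OF \<beta>] ext_dc_form[OF \<beta>] sign_form_form[OF \<alpha>]
  have "wedge (ext_d \<alpha>) \<beta> \<in> forms \<A> (k + l + 1)" "wedge (ext_dc J \<alpha>) \<beta> \<in> forms \<A> (k + l + 1)"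
      "wedge (sign_form \<alpha>) (ext_d \<beta>) \<in> forms \<A> (k + l + 1)"
      "wedge (sign_form \<alpha>) (ext_dc J \<beta>) \<in> forms \<A> (k + l + 1)"
    using wedge_form[OF f(1) \<beta>] wedge_form[OF f(2) \<beta>] wedge_form[OF f(5,3)] wedge_form[OF f(5,4)]
    by (simp_all add: algebra_simps)
  note g = this
  have "ext_d (ext_dc J (wedge \<alpha> \<beta>)) =
      wedge (ext_d (ext_dc J \<alpha>)) \<beta> + wedge (sign_form (ext_dc J \<alpha>)) (ext_d \<beta>)
      - wedge (sign_form (ext_d \<alpha>)) (ext_dc J \<beta>) + wedge \<alpha> (ext_d (ext_dc J \<beta>))"
    by (simp add: ext_dc_wedge[OF \<alpha> \<beta>] ext_d_add[OF g(2,4)] ext_d_wedge[OF f(2) \<beta>] ext_d_wedge[OF f(5,4)]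
        ext_d_sign_form[OF \<alpha>] wedge_uminus_left)
  moreover have "ext_dc J (ext_d (wedge \<alpha> \<beta>)) =
      wedge (ext_dc J (ext_d \<alpha>)) \<beta> + wedge (sign_form (ext_d \<alpha>)) (ext_dc J \<beta>)
      - wedge (sign_form (ext_dc J \<alpha>)) (ext_d \<beta>) + wedge \<alpha> (ext_dc J (ext_d \<beta>))"
    by (simp add: ext_d_wedge[OF \<alpha> \<beta>] ext_dc_add[OF g(1,3)] ext_dc_wedge[OF f(1) \<beta>] ext_dc_wedge[OF f(5,3)]
        ext_dc_sign_form[OF \<alpha>] wedge_uminus_left)
  ultimately show ?thesis
    by (simp add: ddc_plus_dcd_def wedge_add_left wedge_add_right)
qed

text \<open>Putting \<open>sign_form\<close> on the left factor cancels the sign of the Leibniz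
  rule, so this exhibits a primitive of \<open>wedge \<alpha> (ext_d \<beta>)\<close> valid in all
  degrees.\<close>

lemma ext_d_sign_wedge_closed:
  assumes "\<alpha> \<in> forms \<A> k" "\<beta> \<in> forms \<A> l" "ext_d \<alpha> = 0"
  shows "ext_d (wedge (sign_form \<alpha>) \<beta>) = wedge \<alpha> (ext_d \<beta>)"
  using assms ext_d_wedge[OF sign_form_form[OF assms(1)] assms(2)]
    ext_d_sign_form[OF assms(1)]
  by (simp_all add: wedge_zero_left sign_form_zero)

lemma
  assumes "\<alpha> \<in> forms \<A> k" "\<beta> \<in> forms \<A> l" "ext_dc J \<alpha> = 0"
  shows ext_dc_wedge_closed: "ext_dc J (wedge \<alpha> \<beta>) = wedge (sign_form \<alpha>) (ext_dc J \<beta>)"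
    and ext_dc_sign_wedge_closed: "ext_dc J (wedge (sign_form \<alpha>) \<beta>) = wedge \<alpha> (ext_dc J \<beta>)"
  using assms ext_dc_wedge[OF assms(1,2)] ext_dc_wedge[OF sign_form_form[OF assms(1)] assms(2)]
    ext_dc_sign_form[OF assms(1)]
  by (simp_all add: wedge_zero_left sign_form_zero)

text \<open>The sign from moving \<open>d\<^sup>c\<close> past \<open>\<alpha>\<close> is cancelled
  by that from moving \<open>d\<close>.\<close>

lemma ddc_wedge_closed:
  assumes "\<alpha> \<in> forms \<A> k" "\<beta> \<in> forms \<A> l" "ext_d \<alpha> = 0" "ext_dc J \<alpha> = 0"
  shows "ddc J (wedge \<alpha> \<beta>) = wedge \<alpha> (ddc J \<beta>)"
  using assms by (simp add: ddc_def ext_dc_wedge_closed ext_d_sign_wedge_closed[OF _ ext_dc_form])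

lemma ddc_wedge_closed_right:
  assumes "\<alpha> \<in> forms \<A> k" "\<beta> \<in> forms \<A> l" "ext_d \<beta> = 0" "ext_dc J \<beta> = 0"
  shows "ddc J (wedge \<alpha> \<beta>) = wedge (ddc J \<alpha>) \<beta>"
  using assms
  by (simp add: ddc_def ext_dc_wedge ext_d_wedge[OF ext_dc_form] wedge_zero_right)

section \<open>Bott-Chern groups and the quotient by the image of \<open>D\<close>\<close>

lemma forms_subspace: "form_subspace (forms \<A> k)"
  by (simp add: form_subspace_def zero_form add_form scale_form)

text \<open>If \<open>d\<alpha>\<close> and \<open>d\<^sup>c\<alpha>\<close> vanish, so do both
  terms of \<open>D\<alpha>\<close>, which places \<open>\<alpha>\<close> in
  \<open>B_space\<close>.\<close>

lemma BC_cocycles_iff: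
  "\<alpha> \<in> BC_cocycles \<A> J k \<longleftrightarrow> \<alpha> \<in> forms \<A> k \<and> ext_d \<alpha> = 0 \<and> ext_dc J \<alpha> = 0"
  by (auto simp: BC_cocycles_def B_space_def ddc_plus_dcd_def ext_d_zero ext_dc_zero)

lemma BC_cocycles_subspace: "form_subspace (BC_cocycles \<A> J k)"
  unfolding form_subspace_def
proof (intro conjI ballI allI)
  show "0 \<in> BC_cocycles \<A> J k"
    by (simp add: BC_cocycles_iff zero_form ext_d_zero ext_dc_zero)
  show "\<alpha> + \<beta> \<in> BC_cocycles \<A> J k" if "\<alpha> \<in> BC_cocycles \<A> J k" "\<beta> \<in> BC_cocycles \<A> J k" for \<alpha> \<beta>
    using that ext_d_add[of \<alpha> k \<beta>] ext_dc_add[of \<alpha> k \<beta>] by (simp add: BC_cocycles_iff add_form)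
  show "scale z \<alpha> \<in> BC_cocycles \<A> J k" if "\<alpha> \<in> BC_cocycles \<A> J k" for z \<alpha>
    using that ext_d_scale[of \<alpha> k z] ext_dc_scale[of \<alpha> k z] by (simp add: BC_cocycles_iff scale_form scale_zero_right)
qed

lemma B_space_subspace: "form_subspace (B_space \<A> J k)"
  by (auto simp: form_subspace_def B_space_def zero_form add_form scale_form ddc_plus_dcd_add
      ddc_plus_dcd_scale scale_zero_right ddc_plus_dcd_def[of J 0] ext_d_zero ext_dc_zero)

lemma BC_boundaries_subspace: "form_subspace (BC_boundaries \<A> J k)"
  unfolding BC_boundaries_def
  by (rule image_subspace[OF B_space_subspace]) (auto simp: B_space_def ddc_add ddc_scale)

lemma C_zero_subspace: "form_subspace (C_zero \<A> J k)"
  unfolding C_zero_def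
  by (rule image_subspace[OF forms_subspace]) (auto simp: ddc_plus_dcd_add ddc_plus_dcd_scale)

lemma C_zero_subset: "C_zero \<A> J k \<subseteq> forms \<A> k"
  using ddc_plus_dcd_form[of _ "k - 2"] by (auto simp: C_zero_def)

lemma BC_class_eq_iff: "BC_class \<A> J k \<alpha> = BC_class \<A> J k \<beta> \<longleftrightarrow> \<alpha> - \<beta> \<in> BC_boundaries \<A> J k"
  unfolding BC_class_def by (rule coset_eq_iff[OF BC_boundaries_subspace])

lemma C_class_eq_iff: "C_class \<A> J k \<alpha> = C_class \<A> J k \<beta> \<longleftrightarrow> \<alpha> - \<beta> \<in> C_zero \<A> J k"
  unfolding C_class_def by (rule coset_eq_iff[OF C_zero_subspace])

lemma C_class_add: "C_class \<A> J k \<alpha> + C_class \<A> J k \<beta> = C_class \<A> J k (\<alpha> + \<beta>)"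
  unfolding C_class_def by (rule coset_plus[OF C_zero_subspace])

lemma C_class_zero: "C_class \<A> J k 0 = C_zero \<A> J k"
  unfolding C_class_def by (auto simp: elt_set_plus_def)

lemma induced_scale: "form_subspace N \<Longrightarrow> induced N (scale z) (\<alpha> +o N) = scale z \<alpha> +o N"
  by (rule induced_coset) (auto simp: scale_add subspace_scale)

lemma BC_quotient: "quotient_space (BC_cohomology \<A> J k) (BC_class \<A> J k) (BC_cocycles \<A> J k)"
  by (auto simp: quotient_space_def BC_cohomology_def BC_cocycles_subspace BC_class_def
      coset_plus[OF BC_boundaries_subspace] induced_scale[OF BC_boundaries_subspace] elt_set_plus_def[of 0])

section \<open>Aeppli groups as quotients of spaces of forms\<close>

definition A_closed :: "int \<Rightarrow> ('m, 'e) form set"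
  where "A_closed k = {\<gamma> \<in> forms \<A> k. ddc J \<gamma> \<in> C_zero \<A> J (k + 2)}"

text \<open>The denominator at the level of forms. It contains \<open>C_zero\<close>, so dividing by
  it performs both quotients at once.\<close>

definition A_exact :: "int \<Rightarrow> ('m, 'e) form set"
  where "A_exact k = ext_d ` forms \<A> (k - 1) + ext_dc J ` forms \<A> (k - 1)"

lemma A_exactI: "\<mu> \<in> forms \<A> (k - 1) \<Longrightarrow> \<nu> \<in> forms \<A> (k - 1) \<Longrightarrow> ext_d \<mu> + ext_dc J \<nu> \<in> A_exact k"
  unfolding A_exact_def by (intro set_plus_intro imageI)

lemma A_exactE:
  assumes "\<alpha> \<in> A_exact k"
  obtains \<mu> \<nu> where "\<mu> \<in> forms \<A> (k - 1)" "\<nu> \<in> forms \<A> (k - 1)" "\<alpha> = ext_d \<mu> + ext_dc J \<nu>"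
  using assms unfolding A_exact_def by (auto elim!: set_plus_elim)

lemma A_exact_ext_d: "\<mu> \<in> forms \<A> k \<Longrightarrow> ext_d \<mu> \<in> A_exact (k + 1)"
  using A_exactI[of \<mu> "k + 1" 0] by (simp add: zero_form ext_dc_zero)

lemma A_exact_ext_dc: "\<mu> \<in> forms \<A> k \<Longrightarrow> ext_dc J \<mu> \<in> A_exact (k + 1)"
  using A_exactI[of 0 "k + 1" \<mu>] by (simp add: zero_form ext_d_zero)

lemma A_exact_subspace: "form_subspace (A_exact k)"
  unfolding form_subspace_def
proof (intro conjI ballI allI)
  show "0 \<in> A_exact k"
    using A_exact_ext_d[OF zero_form, of "k - 1"] by (simp add: ext_d_zero)
next
  fix \<alpha> \<beta> assume "\<alpha> \<in> A_exact k" "\<beta> \<in> A_exact k"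
  then obtain \<mu> \<nu> \<mu>' \<nu>' where *: "\<mu> \<in> forms \<A> (k - 1)" "\<nu> \<in> forms \<A> (k - 1)" "\<mu>' \<in> forms \<A> (k - 1)"
      "\<nu>' \<in> forms \<A> (k - 1)" "\<alpha> = ext_d \<mu> + ext_dc J \<nu>" "\<beta> = ext_d \<mu>' + ext_dc J \<nu>'"
    by (elim A_exactE)
  then have "\<alpha> + \<beta> = ext_d (\<mu> + \<mu>') + ext_dc J (\<nu> + \<nu>')"
    by (simp add: ext_d_add ext_dc_add)
  then show "\<alpha> + \<beta> \<in> A_exact k"
    using * by (simp add: A_exactI add_form)
next
  fix z \<alpha> assume "\<alpha> \<in> A_exact k"
  then obtain \<mu> \<nu> where *: "\<mu> \<in> forms \<A> (k - 1)" "\<nu> \<in> forms \<A> (k - 1)" "\<alpha> = ext_d \<mu> + ext_dc J \<nu>"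
    by (elim A_exactE)
  then have "scale z \<alpha> = ext_d (scale z \<mu>) + ext_dc J (scale z \<nu>)"
    by (simp add: ext_d_scale ext_dc_scale scale_add)
  then show "scale z \<alpha> \<in> A_exact k"
    using * by (simp add: A_exactI scale_form)
qed

lemma A_exact_ddc_plus_dcd: "\<rho> \<in> forms \<A> k \<Longrightarrow> ddc_plus_dcd J \<rho> \<in> A_exact (k + 2)"
  using subspace_add[OF A_exact_subspace A_exact_ext_d[OF ext_dc_form] A_exact_ext_dc[OF ext_d_form], of \<rho> k \<rho>]
  by (simp add: ddc_plus_dcd_def add.assoc)

lemma C_zero_subset_A_exact: "C_zero \<A> J k \<subseteq> A_exact k"
  using A_exact_ddc_plus_dcd[of _ "k - 2"] by (auto simp: C_zero_def)

lemma A_closed_subspace: "form_subspace (A_closed k)"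
proof -
  note N = C_zero_subspace[of "k + 2"]
  have "ddc J 0 = (0 :: ('m, 'e) form)"
    by (simp add: ddc_def ext_d_zero ext_dc_zero)
  then show ?thesis
    by (auto simp: form_subspace_def A_closed_def zero_form add_form scale_form ddc_add ddc_scale
        subspace_zero[OF N] subspace_add[OF N] subspace_scale[OF N])
qed

text \<open>Both \<open>dD\<close> and \<open>Dd\<close> reduce to \<open>dd\<^sup>cd\<close>, so
  \<open>d\<close> descends to the quotient by the image of \<open>D\<close>.\<close>

lemma ext_d_C_zero:
  assumes "\<nu> \<in> C_zero \<A> J k"
  shows "ext_d \<nu> \<in> C_zero \<A> J (k + 1)"
proof -
  obtain \<rho> where \<rho>: "\<rho> \<in> forms \<A> (k - 2)" "\<nu> = ddc_plus_dcd J \<rho>"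
    using assms by (auto simp: C_zero_def)
  have "ext_d \<nu> = ddc_plus_dcd J (ext_d \<rho>)"
    using \<rho> by (simp add: ddc_plus_dcd_def ext_d_add[OF ext_d_form[OF ext_dc_form] ext_dc_form[OF ext_d_form]]
        ext_d_ext_d ext_d_ext_d[OF ext_dc_form] ext_dc_zero)
  moreover have "ext_d \<rho> \<in> forms \<A> (k + 1 - 2)"
    using ext_d_form[OF \<rho>(1)] by (simp add: algebra_simps)
  ultimately show ?thesis by (simp add: C_zero_def)
qed

lemma ext_dc_C_zero:
  assumes "\<nu> \<in> C_zero \<A> J k"
  shows "ext_dc J \<nu> \<in> C_zero \<A> J (k + 1)"
proof -
  obtain \<rho> where \<rho>: "\<rho> \<in> forms \<A> (k - 2)" "\<nu> = ddc_plus_dcd J \<rho>"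
    using assms by (auto simp: C_zero_def)
  have "ext_dc J \<nu> = ddc_plus_dcd J (ext_dc J \<rho>)"
    using \<rho> by (simp add: ddc_plus_dcd_def ext_dc_add[OF ext_d_form[OF ext_dc_form] ext_dc_form[OF ext_d_form]]
        ext_dc_ext_dc ext_dc_ext_dc[OF ext_d_form] ext_d_zero)
  moreover have "ext_dc J \<rho> \<in> forms \<A> (k + 1 - 2)"
    using ext_dc_form[OF \<rho>(1)] by (simp add: algebra_simps)
  ultimately show ?thesis by (simp add: C_zero_def)
qed

lemma ddc_C_zero: "\<nu> \<in> C_zero \<A> J k \<Longrightarrow> ddc J \<nu> \<in> C_zero \<A> J (k + 2)"
  using ext_d_C_zero[OF ext_dc_C_zero, of \<nu> k] by (simp add: ddc_def add.assoc)

lemma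
  assumes "\<gamma> \<in> forms \<A> k"
  shows induced_ext_d: "induced (C_zero \<A> J (k + 1)) ext_d (C_class \<A> J k \<gamma>) = C_class \<A> J (k + 1) (ext_d \<gamma>)"
    and induced_ext_dc: "induced (C_zero \<A> J (k + 1)) (ext_dc J) (C_class \<A> J k \<gamma>) = C_class \<A> J (k + 1) (ext_dc J \<gamma>)"
    and induced_ddc: "induced (C_zero \<A> J (k + 2)) (ddc J) (C_class \<A> J k \<gamma>) = C_class \<A> J (k + 2) (ddc J \<gamma>)"
proof -
  have form: "\<nu> \<in> forms \<A> k" if "\<nu> \<in> C_zero \<A> J k" for \<nu>
    using C_zero_subset that by blast
  show "induced (C_zero \<A> J (k + 1)) ext_d (C_class \<A> J k \<gamma>) = C_class \<A> J (k + 1) (ext_d \<gamma>)"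
    unfolding C_class_def
    by (rule induced_coset[OF C_zero_subspace C_zero_subspace ext_d_add[OF assms form] ext_d_C_zero])
  show "induced (C_zero \<A> J (k + 1)) (ext_dc J) (C_class \<A> J k \<gamma>) = C_class \<A> J (k + 1) (ext_dc J \<gamma>)"
    unfolding C_class_def
    by (rule induced_coset[OF C_zero_subspace C_zero_subspace ext_dc_add[OF assms form] ext_dc_C_zero])
  show "induced (C_zero \<A> J (k + 2)) (ddc J) (C_class \<A> J k \<gamma>) = C_class \<A> J (k + 2) (ddc J \<gamma>)"
    unfolding C_class_def
    by (rule induced_coset[OF C_zero_subspace C_zero_subspace ddc_add[OF assms form] ddc_C_zero])
qed

lemma A_cocycles_iff: "\<gamma> \<in> forms \<A> k \<Longrightarrow> C_class \<A> J k \<gamma> \<in> A_cocycles \<A> J k \<longleftrightarrow> \<gamma> \<in> A_closed k"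
  using C_class_eq_iff[of "k + 2" "ddc J \<gamma>" 0]
  by (simp add: A_cocycles_def C_space_def induced_ddc A_closed_def C_class_zero)

lemma A_cocycles_eq: "A_cocycles \<A> J k = C_class \<A> J k ` A_closed k"
proof
  show "A_cocycles \<A> J k \<subseteq> C_class \<A> J k ` A_closed k"
  proof
    fix P assume P: "P \<in> A_cocycles \<A> J k"
    then obtain \<gamma> where "\<gamma> \<in> forms \<A> k" "P = C_class \<A> J k \<gamma>"
      by (auto simp: A_cocycles_def C_space_def)
    with P A_cocycles_iff show "P \<in> C_class \<A> J k ` A_closed k" by blast
  qed
  show "C_class \<A> J k ` A_closed k \<subseteq> A_cocycles \<A> J k"
    using A_cocycles_iff by (auto simp: A_closed_def)
qed

text \<open>Passing to classes is additive, so it commutes with sums of sets. This brings the Aeppli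
  boundaries and cosets down to sets of forms.\<close>

lemma C_class_image_plus: "C_class \<A> J k ` S + C_class \<A> J k ` T = C_class \<A> J k ` (S + T)"
proof
  show "C_class \<A> J k ` S + C_class \<A> J k ` T \<subseteq> C_class \<A> J k ` (S + T)"
  proof
    fix P assume "P \<in> C_class \<A> J k ` S + C_class \<A> J k ` T"
    then obtain \<alpha> \<beta> where "\<alpha> \<in> S" "\<beta> \<in> T" "P = C_class \<A> J k \<alpha> + C_class \<A> J k \<beta>"
      by (auto elim!: set_plus_elim)
    then show "P \<in> C_class \<A> J k ` (S + T)"
      by (simp add: C_class_add set_plus_intro)
  qed
  show "C_class \<A> J k ` (S + T) \<subseteq> C_class \<A> J k ` S + C_class \<A> J k ` T"
    by (auto elim!: set_plus_elim simp flip: C_class_add intro!: set_plus_intro)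
qed

lemma A_boundaries_eq: "A_boundaries \<A> J k = C_class \<A> J k ` A_exact k"
proof -
  have "induced (C_zero \<A> J k) ext_d ` C_space \<A> J (k - 1) = C_class \<A> J k ` ext_d ` forms \<A> (k - 1)"
      "induced (C_zero \<A> J k) (ext_dc J) ` C_space \<A> J (k - 1) = C_class \<A> J k ` ext_dc J ` forms \<A> (k - 1)"
    using induced_ext_d[of _ "k - 1"] induced_ext_dc[of _ "k - 1"] by (simp_all add: C_space_def image_image)
  then show ?thesis
    by (simp only: A_boundaries_def A_exact_def C_class_image_plus)
qed

lemma A_class_eq: "A_class \<A> J k \<gamma> = C_class \<A> J k ` (\<gamma> +o A_exact k)"
  by (auto simp: A_class_def A_boundaries_eq elt_set_plus_def C_class_add)

lemma A_class_add: "A_class \<A> J k \<alpha> + A_class \<A> J k \<beta> = A_class \<A> J k (\<alpha> + \<beta>)"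
  by (simp add: A_class_eq C_class_image_plus coset_plus[OF A_exact_subspace])

lemma A_class_scale:
  "induced (A_boundaries \<A> J k) (induced (C_zero \<A> J k) (scale z)) (A_class \<A> J k \<gamma>) = A_class \<A> J k (scale z \<gamma>)"
proof -
  have scale_class: "induced (C_zero \<A> J k) (scale z) (C_class \<A> J k \<alpha>) = C_class \<A> J k (scale z \<alpha>)" for \<alpha>
    unfolding C_class_def by (rule induced_scale[OF C_zero_subspace])
  have "induced (A_boundaries \<A> J k) (induced (C_zero \<A> J k) (scale z)) (A_class \<A> J k \<gamma>) =
      induced (C_zero \<A> J k) (scale z) ` A_class \<A> J k \<gamma> + A_boundaries \<A> J k"
    by (fact induced_def)
  also have "\<dots> = C_class \<A> J k ` scale z ` (\<gamma> +o A_exact k) + C_class \<A> J k ` A_exact k"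
    by (simp add: A_class_eq A_boundaries_eq image_image scale_class)
  also have "\<dots> = C_class \<A> J k ` induced (A_exact k) (scale z) (\<gamma> +o A_exact k)"
    by (simp only: induced_def C_class_image_plus)
  finally show ?thesis
    by (simp add: induced_scale[OF A_exact_subspace] A_class_eq)
qed

lemma A_class_eq_iff: "A_class \<A> J k \<alpha> = A_class \<A> J k \<beta> \<longleftrightarrow> \<alpha> - \<beta> \<in> A_exact k"
proof
  assume "A_class \<A> J k \<alpha> = A_class \<A> J k \<beta>"
  moreover have "C_class \<A> J k \<alpha> \<in> A_class \<A> J k \<alpha>"
    using set_plus_intro2[OF subspace_zero[OF A_exact_subspace], of \<alpha>] by (auto simp: A_class_eq)
  ultimately obtain \<eta> where "\<eta> \<in> A_exact k" "C_class \<A> J k \<alpha> = C_class \<A> J k (\<beta> + \<eta>)"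
    by (auto simp: A_class_eq elt_set_plus_def)
  \<comment> \<open>Equality of the inner classes leaves an error in \<open>C_zero\<close>, which is
    absorbed by \<open>A_exact\<close>.\<close>
  then have "\<alpha> - (\<beta> + \<eta>) + \<eta> \<in> A_exact k"
    using C_zero_subset_A_exact by (intro subspace_add[OF A_exact_subspace]) (auto simp: C_class_eq_iff)
  then show "\<alpha> - \<beta> \<in> A_exact k" by (simp add: algebra_simps)
next
  assume "\<alpha> - \<beta> \<in> A_exact k"
  then show "A_class \<A> J k \<alpha> = A_class \<A> J k \<beta>"
    unfolding A_class_eq using coset_eq_iff[OF A_exact_subspace] by metis
qed

lemma A_quotient: "quotient_space (A_cohomology \<A> J k) (A_class \<A> J k) (A_closed k)"
proof -
  have "A_class \<A> J k 0 = A_boundaries \<A> J k"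
    by (simp add: A_class_eq A_boundaries_eq elt_set_plus_def)
  then show ?thesis
    by (simp add: quotient_space_def A_cohomology_def A_closed_subspace A_cocycles_eq image_image
        A_class_add A_class_scale A_class_def[symmetric])
qed

section \<open>Products of cocycles and boundaries\<close>

lemma wedge_BC_cocycles:
  "\<alpha> \<in> BC_cocycles \<A> J k \<Longrightarrow> \<beta> \<in> BC_cocycles \<A> J l \<Longrightarrow> wedge \<alpha> \<beta> \<in> BC_cocycles \<A> J (k + l)"
  using ext_d_wedge[of \<alpha> k \<beta> l] ext_dc_wedge[of \<alpha> k \<beta> l]
  by (simp add: BC_cocycles_iff wedge_form wedge_zero_left wedge_zero_right)

lemma wedge_B_space:
  assumes "\<alpha> \<in> B_space \<A> J k" "\<beta> \<in> B_space \<A> J l"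
  shows "wedge \<alpha> \<beta> \<in> B_space \<A> J (k + l)"
  using assms ddc_plus_dcd_wedge[of \<alpha> k \<beta> l]
  by (simp add: B_space_def wedge_form wedge_zero_left wedge_zero_right)

text \<open>With \<open>\<beta>\<close> closed for both operators, \<open>dd\<^sup>c\<close> acts on
  \<open>\<eta>\<close> alone; the new primitive \<open>wedge \<eta> \<beta>\<close> lies in
  \<open>B_space\<close> because \<open>D\<close> is a derivation.\<close>

lemma wedge_BC_boundaries_left:
  assumes "\<alpha> \<in> BC_boundaries \<A> J k" "\<beta> \<in> BC_cocycles \<A> J l"
  shows "wedge \<alpha> \<beta> \<in> BC_boundaries \<A> J (k + l)"
proof -
  obtain \<eta> where \<eta>: "\<eta> \<in> B_space \<A> J (k - 2)" "\<alpha> = ddc J \<eta>"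
    using assms(1) by (auto simp: BC_boundaries_def)
  have "\<beta> \<in> B_space \<A> J l" using assms(2) by (simp add: BC_cocycles_def)
  from wedge_B_space[OF \<eta>(1) this] have "wedge \<eta> \<beta> \<in> B_space \<A> J (k + l - 2)"
    by (simp add: algebra_simps)
  moreover have "wedge \<alpha> \<beta> = ddc J (wedge \<eta> \<beta>)"
    using \<eta> assms(2) ddc_wedge_closed_right[of \<eta> "k - 2" \<beta> l] by (simp add: BC_cocycles_iff B_space_def)
  ultimately show ?thesis by (auto simp: BC_boundaries_def)
qed

lemma wedge_BC_boundaries_right:
  assumes "\<alpha> \<in> BC_cocycles \<A> J k" "\<beta> \<in> BC_boundaries \<A> J l"
  shows "wedge \<alpha> \<beta> \<in> BC_boundaries \<A> J (k + l)"
proof -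
  obtain \<eta> where \<eta>: "\<eta> \<in> B_space \<A> J (l - 2)" "\<beta> = ddc J \<eta>"
    using assms(2) by (auto simp: BC_boundaries_def)
  have "\<alpha> \<in> B_space \<A> J k" using assms(1) by (simp add: BC_cocycles_def)
  from wedge_B_space[OF this \<eta>(1)] have "wedge \<alpha> \<eta> \<in> B_space \<A> J (k + l - 2)"
    by (simp add: algebra_simps)
  moreover have "wedge \<alpha> \<beta> = ddc J (wedge \<alpha> \<eta>)"
    using \<eta> assms(1) ddc_wedge_closed[of \<alpha> k \<eta> "l - 2"] by (simp add: BC_cocycles_iff B_space_def)
  ultimately show ?thesis by (auto simp: BC_boundaries_def)
qed

lemma wedge_A_closed:
  assumes "\<alpha> \<in> BC_cocycles \<A> J k" "\<gamma> \<in> A_closed l"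
  shows "wedge \<alpha> \<gamma> \<in> A_closed (k + l)"
proof -
  have \<alpha>: "\<alpha> \<in> forms \<A> k" "ext_d \<alpha> = 0" "ext_dc J \<alpha> = 0"
    using assms(1) by (simp_all add: BC_cocycles_iff)
  obtain \<xi> where \<xi>: "\<xi> \<in> forms \<A> l" "ddc J \<gamma> = ddc_plus_dcd J \<xi>" and \<gamma>: "\<gamma> \<in> forms \<A> l"
    using assms(2) by (auto simp: A_closed_def C_zero_def)
  have "ddc_plus_dcd J \<alpha> = 0"
    using \<alpha> by (simp add: ddc_plus_dcd_def ext_d_zero ext_dc_zero)
  then have "ddc J (wedge \<alpha> \<gamma>) = ddc_plus_dcd J (wedge \<alpha> \<xi>)"
    by (simp add: ddc_wedge_closed[OF \<alpha>(1) \<gamma> \<alpha>(2,3)] \<xi>(2) ddc_plus_dcd_wedge[OF \<alpha>(1) \<xi>(1)] wedge_zero_left)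
  then show ?thesis
    using wedge_form[OF \<alpha>(1) \<gamma>] wedge_form[OF \<alpha>(1) \<xi>(1)] by (simp add: A_closed_def C_zero_def)
qed

lemma wedge_A_exact:
  assumes "\<alpha> \<in> BC_cocycles \<A> J k" "\<eta> \<in> A_exact l"
  shows "wedge \<alpha> \<eta> \<in> A_exact (k + l)"
proof -
  have \<alpha>: "\<alpha> \<in> forms \<A> k" "ext_d \<alpha> = 0" "ext_dc J \<alpha> = 0"
    using assms(1) by (simp_all add: BC_cocycles_iff)
  obtain \<mu> \<nu> where *: "\<mu> \<in> forms \<A> (l - 1)" "\<nu> \<in> forms \<A> (l - 1)" "\<eta> = ext_d \<mu> + ext_dc J \<nu>"
    using assms(2) by (elim A_exactE)
  have "wedge \<alpha> \<eta> = ext_d (wedge (sign_form \<alpha>) \<mu>) + ext_dc J (wedge (sign_form \<alpha>) \<nu>)"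
    using * \<alpha> by (simp add: wedge_add_right ext_d_sign_wedge_closed ext_dc_sign_wedge_closed)
  moreover have "wedge (sign_form \<alpha>) \<mu> \<in> forms \<A> (k + l - 1)" "wedge (sign_form \<alpha>) \<nu> \<in> forms \<A> (k + l - 1)"
    using wedge_form[OF sign_form_form[OF \<alpha>(1)] *(1)] wedge_form[OF sign_form_form[OF \<alpha>(1)] *(2)]
    by (simp_all add: algebra_simps)
  ultimately show ?thesis
    by (simp add: A_exactI)
qed

text \<open>The products \<open>d\<^sup>c\<eta> \<and> d\<gamma>\<close> in the Leibniz rules for \<open>d(d\<^sup>c\<eta> \<and> \<gamma>)\<close> and \<open>d\<^sup>c(\<eta> \<and> d\<gamma>)\<close> cancel,
  and \<open>d\<^sup>cd\<gamma>\<close> is in the image of \<open>dd\<^sup>c + d\<^sup>cd\<close> because \<open>dd\<^sup>c\<gamma>\<close> is.\<close>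

lemma wedge_BC_boundaries_A_closed:
  assumes "\<alpha> \<in> BC_boundaries \<A> J k" "\<gamma> \<in> A_closed l"
  shows "wedge \<alpha> \<gamma> \<in> A_exact (k + l)"
proof -
  obtain \<eta> where \<eta>: "\<eta> \<in> forms \<A> (k - 2)" "ddc_plus_dcd J \<eta> = 0" and \<alpha>: "\<alpha> = ddc J \<eta>"
    using assms(1) by (auto simp: BC_boundaries_def B_space_def)
  obtain \<xi> where \<xi>: "\<xi> \<in> forms \<A> l" "ddc J \<gamma> = ddc_plus_dcd J \<xi>" and \<gamma>: "\<gamma> \<in> forms \<A> l"
    using assms(2) by (auto simp: A_closed_def C_zero_def)
  have \<gamma>\<xi>: "\<gamma> - \<xi> \<in> forms \<A> l"
    using \<gamma> \<xi> by (intro diff_form)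
  have "ddc_plus_dcd J \<gamma> = ddc_plus_dcd J (\<gamma> - \<xi>) + ddc_plus_dcd J \<xi>"
    using ddc_plus_dcd_add[OF \<gamma>\<xi> \<xi>(1)] by simp
  then have dcd: "ext_dc J (ext_d \<gamma>) = ddc_plus_dcd J (\<gamma> - \<xi>)"
    using \<xi>(2) by (simp add: ddc_plus_dcd_def[of J \<gamma>] ddc_def)
  have "ext_d (wedge (ext_dc J \<eta>) \<gamma>) = wedge \<alpha> \<gamma> + wedge (sign_form (ext_dc J \<eta>)) (ext_d \<gamma>)"
    by (simp add: ext_d_wedge[OF ext_dc_form[OF \<eta>(1)] \<gamma>] \<alpha> ddc_def)
  moreover have "ext_dc J (wedge (sign_form \<eta>) (ext_d \<gamma>)) =
      - wedge (sign_form (ext_dc J \<eta>)) (ext_d \<gamma>) + wedge \<eta> (ddc_plus_dcd J (\<gamma> - \<xi>))"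
    by (simp add: ext_dc_wedge[OF sign_form_form[OF \<eta>(1)] ext_d_form[OF \<gamma>]] ext_dc_sign_form[OF \<eta>(1)]
        wedge_uminus_left dcd)
  moreover have "wedge \<eta> (ddc_plus_dcd J (\<gamma> - \<xi>)) = ddc_plus_dcd J (wedge \<eta> (\<gamma> - \<xi>))"
    by (simp add: ddc_plus_dcd_wedge[OF \<eta>(1) \<gamma>\<xi>] \<eta>(2) wedge_zero_left)
  ultimately have "wedge \<alpha> \<gamma> = ext_d (wedge (ext_dc J \<eta>) \<gamma>) + ext_dc J (wedge (sign_form \<eta>) (ext_d \<gamma>))
      - ddc_plus_dcd J (wedge \<eta> (\<gamma> - \<xi>))"
    by simp
  moreover have "ext_d (wedge (ext_dc J \<eta>) \<gamma>) \<in> A_exact (k + l)"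
    using A_exact_ext_d[OF wedge_form[OF ext_dc_form[OF \<eta>(1)] \<gamma>]] by (simp add: algebra_simps)
  moreover have "ext_dc J (wedge (sign_form \<eta>) (ext_d \<gamma>)) \<in> A_exact (k + l)"
    using A_exact_ext_dc[OF wedge_form[OF sign_form_form[OF \<eta>(1)] ext_d_form[OF \<gamma>]]] by (simp add: algebra_simps)
  moreover have "ddc_plus_dcd J (wedge \<eta> (\<gamma> - \<xi>)) \<in> A_exact (k + l)"
    using A_exact_ddc_plus_dcd[OF wedge_form[OF \<eta>(1) \<gamma>\<xi>]] by (simp add: algebra_simps)
  ultimately show ?thesis
    by (simp add: subspace_add[OF A_exact_subspace] subspace_diff[OF A_exact_subspace])
qed

text \<open>The unit \<open>e\<close> is idempotent and even, so a derivation
  \<open>\<delta>\<close> satisfies \<open>\<delta> e = \<delta> e + \<delta> e\<close>. This treats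
  \<open>d\<close> and \<open>d\<^sup>c\<close> alike.\<close>

lemma one_form0_BC_cocycle: "one_form0 \<A> \<in> BC_cocycles \<A> J 0"
proof -
  let ?e = "one_form0 \<A>"
  have ee: "wedge ?e ?e = ?e" by (rule wedge_one_left[OF one_form0_form])
  have sign: "sign_form ?e = ?e"
    by (auto simp: sign_form_def one_form0_eq fun_eq_iff)
  have "ext_d ?e = 0"
    using ext_d_wedge[OF one_form0_form one_form0_form]
    by (simp add: ee sign wedge_one_left[OF ext_d_form[OF one_form0_form]] wedge_one_right[OF ext_d_form[OF one_form0_form]])
  moreover have "ext_dc J ?e = 0"
    using ext_dc_wedge[OF one_form0_form one_form0_form]
    by (simp add: ee sign wedge_one_left[OF ext_dc_form[OF one_form0_form]] wedge_one_right[OF ext_dc_form[OF one_form0_form]])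
  ultimately show ?thesis by (simp add: BC_cocycles_iff one_form0_form)
qed

section \<open>The induced products on cohomology classes\<close>

definition BC_rep :: "int \<Rightarrow> ('m, 'e) form set \<Rightarrow> ('m, 'e) form"
  where "BC_rep k P = (SOME \<alpha>. \<alpha> \<in> BC_cocycles \<A> J k \<and> BC_class \<A> J k \<alpha> = P)"

definition A_rep :: "int \<Rightarrow> ('m, 'e) form set set \<Rightarrow> ('m, 'e) form"
  where "A_rep k P = (SOME \<gamma>. \<gamma> \<in> A_closed k \<and> A_class \<A> J k \<gamma> = P)"

lemma BC_rep:
  assumes "\<alpha> \<in> BC_cocycles \<A> J k"
  shows "BC_rep k (BC_class \<A> J k \<alpha>) \<in> BC_cocycles \<A> J k"
    and "BC_rep k (BC_class \<A> J k \<alpha>) - \<alpha> \<in> BC_boundaries \<A> J k"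
  using someI[of "\<lambda>\<beta>. \<beta> \<in> BC_cocycles \<A> J k \<and> BC_class \<A> J k \<beta> = BC_class \<A> J k \<alpha>" \<alpha>] assms
  by (simp_all add: BC_rep_def BC_class_eq_iff)

lemma A_rep:
  assumes "\<gamma> \<in> A_closed k"
  shows "A_rep k (A_class \<A> J k \<gamma>) \<in> A_closed k"
    and "A_rep k (A_class \<A> J k \<gamma>) - \<gamma> \<in> A_exact k"
  using someI[of "\<lambda>\<beta>. \<beta> \<in> A_closed k \<and> A_class \<A> J k \<beta> = A_class \<A> J k \<gamma>" \<gamma>] assms
  by (simp_all add: A_rep_def A_class_eq_iff)

text \<open>Defined by chosen representatives, which makes it a function of the classes from the
  outset; that any representatives give the same result is \<open>BC_mul_class\<close>.\<close>

definition BC_mul :: "int \<Rightarrow> int \<Rightarrow> ('m, 'e) form set \<Rightarrow> ('m, 'e) form set \<Rightarrow> ('m, 'e) form set"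
  where "BC_mul k l P Q = BC_class \<A> J (k + l) (wedge (BC_rep k P) (BC_rep l Q))"

definition BC_act :: "int \<Rightarrow> int \<Rightarrow> ('m, 'e) form set \<Rightarrow> ('m, 'e) form set set \<Rightarrow> ('m, 'e) form set set"
  where "BC_act k l P Q = A_class \<A> J (k + l) (wedge (BC_rep k P) (A_rep l Q))"

text \<open>The representatives are replaced one at a time. The first summand is a boundary times a
  cocycle, the second a cocycle times a boundary.\<close>

lemma wedge_diff_split: "wedge \<alpha>' \<beta>' - wedge \<alpha> \<beta> = wedge (\<alpha>' - \<alpha>) \<beta>' + wedge \<alpha> (\<beta>' - \<beta>)"
  using wedge_add_left[of "\<alpha>' - \<alpha>" \<alpha> \<beta>'] wedge_add_right[of \<alpha> "\<beta>' - \<beta>" \<beta>] by simp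

lemma BC_mul_class:
  assumes "\<alpha> \<in> BC_cocycles \<A> J k" "\<beta> \<in> BC_cocycles \<A> J l"
  shows "BC_mul k l (BC_class \<A> J k \<alpha>) (BC_class \<A> J l \<beta>) = BC_class \<A> J (k + l) (wedge \<alpha> \<beta>)"
  unfolding BC_mul_def BC_class_eq_iff wedge_diff_split
  by (intro subspace_add[OF BC_boundaries_subspace] wedge_BC_boundaries_left wedge_BC_boundaries_right BC_rep assms)

lemma BC_act_class:
  assumes "\<alpha> \<in> BC_cocycles \<A> J k" "\<gamma> \<in> A_closed l"
  shows "BC_act k l (BC_class \<A> J k \<alpha>) (A_class \<A> J l \<gamma>) = A_class \<A> J (k + l) (wedge \<alpha> \<gamma>)"
  unfolding BC_act_def A_class_eq_iff wedge_diff_split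
  by (intro subspace_add[OF A_exact_subspace] wedge_BC_boundaries_A_closed wedge_A_exact BC_rep A_rep assms)

text \<open>Once products of classes are classes of wedge products, each axiom is the corresponding
  identity for \<open>wedge\<close> on forms.\<close>

lemma Aeppli_graded_module:
  "graded_module complex_ring (BC_cohomology \<A> J) BC_mul (BC_class \<A> J 0 (one_form0 \<A>)) (A_cohomology \<A> J) BC_act"
proof (intro graded_module.intro graded_algebra.intro graded_module_axioms.intro)
  have BC: "carrier (BC_cohomology \<A> J k) = BC_class \<A> J k ` BC_cocycles \<A> J k"
    and A: "carrier (A_cohomology \<A> J k) = A_class \<A> J k ` A_closed k" for k
    using BC_quotient A_quotient by (auto simp: quotient_space_def)
  show "Module.module complex_ring (BC_cohomology \<A> J k)" "Module.module complex_ring (A_cohomology \<A> J k)" for k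
    by (rule quotient_space_module[OF BC_quotient] quotient_space_module[OF A_quotient])+
  show "bilinear_pairing complex_ring (BC_cohomology \<A> J k) (BC_cohomology \<A> J l) (BC_cohomology \<A> J (k + l)) (BC_mul k l)" for k l
    by (rule quotient_space_bilinear[OF BC_quotient BC_quotient BC_quotient wedge_BC_cocycles BC_mul_class])
  show "bilinear_pairing complex_ring (BC_cohomology \<A> J k) (A_cohomology \<A> J l) (A_cohomology \<A> J (k + l)) (BC_act k l)" for k l
    by (rule quotient_space_bilinear[OF BC_quotient A_quotient A_quotient wedge_A_closed BC_act_class])
  show "BC_mul (k + l) n (BC_mul k l x y) z = BC_mul k (l + n) x (BC_mul l n y z)"
    if "x \<in> carrier (BC_cohomology \<A> J k)" "y \<in> carrier (BC_cohomology \<A> J l)" "z \<in> carrier (BC_cohomology \<A> J n)"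
    for k l n x y z
    \<comment> \<open>\<open>add.assoc\<close> identifies the degrees \<open>k + l + n\<close> and
      \<open>k + (l + n)\<close>, which occur in the classes on the two sides.\<close>
    using that by (auto simp: BC BC_mul_class wedge_BC_cocycles wedge_assoc add.assoc)
  show "BC_act (k + l) n (BC_mul k l x y) u = BC_act k (l + n) x (BC_act l n y u)"
    if "x \<in> carrier (BC_cohomology \<A> J k)" "y \<in> carrier (BC_cohomology \<A> J l)" "u \<in> carrier (A_cohomology \<A> J n)"
    for k l n x y u
    using that by (auto simp: BC A BC_mul_class BC_act_class wedge_BC_cocycles wedge_A_closed wedge_assoc add.assoc)
  show "BC_class \<A> J 0 (one_form0 \<A>) \<in> carrier (BC_cohomology \<A> J 0)"
    by (simp add: BC one_form0_BC_cocycle)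
  show "BC_mul 0 k (BC_class \<A> J 0 (one_form0 \<A>)) x = x" "BC_mul k 0 x (BC_class \<A> J 0 (one_form0 \<A>)) = x"
    if x: "x \<in> carrier (BC_cohomology \<A> J k)" for k x
  proof -
    obtain \<alpha> where \<alpha>: "\<alpha> \<in> BC_cocycles \<A> J k" "x = BC_class \<A> J k \<alpha>"
      using x by (auto simp: BC)
    then have "\<alpha> \<in> forms \<A> k" by (simp add: BC_cocycles_iff)
    with \<alpha> show "BC_mul 0 k (BC_class \<A> J 0 (one_form0 \<A>)) x = x" "BC_mul k 0 x (BC_class \<A> J 0 (one_form0 \<A>)) = x"
      by (simp_all add: BC_mul_class one_form0_BC_cocycle wedge_one_left wedge_one_right)
  qed
  show "BC_act 0 k (BC_class \<A> J 0 (one_form0 \<A>)) u = u" if u: "u \<in> carrier (A_cohomology \<A> J k)" for k u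
  proof -
    obtain \<gamma> where \<gamma>: "\<gamma> \<in> A_closed k" "u = A_class \<A> J k \<gamma>"
      using u by (auto simp: A)
    then have "\<gamma> \<in> forms \<A> k" by (simp add: A_closed_def)
    with \<gamma> show ?thesis
      by (simp add: BC_act_class one_form0_BC_cocycle wedge_one_left)
  qed
qed

end

theorem proposition3p6:
  fixes X :: "'m topology"
    and \<A> :: "('m, 'e::real_inner) chart set"
    and J :: "('m, 'e) endo_field"
    and m :: nat
  assumes "almost_complex_manifold m X \<A> J"
  shows "\<exists>mul act.
    graded_module complex_ring (BC_cohomology \<A> J) mul (BC_class \<A> J 0 (one_form0 \<A>))
      (A_cohomology \<A> J) act \<and>
    (\<forall>k l. \<forall>\<alpha>\<in>BC_cocycles \<A> J k. \<forall>\<beta>\<in>BC_cocycles \<A> J l.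
      mul k l (BC_class \<A> J k \<alpha>) (BC_class \<A> J l \<beta>) = BC_class \<A> J (k + l) (wedge \<alpha> \<beta>)) \<and>
    (\<forall>k l. \<forall>\<alpha>\<in>BC_cocycles \<A> J k. \<forall>\<gamma>\<in>forms \<A> l. C_class \<A> J l \<gamma> \<in> A_cocycles \<A> J l \<longrightarrow>
      act k l (BC_class \<A> J k \<alpha>) (A_class \<A> J l \<gamma>) = A_class \<A> J (k + l) (wedge \<alpha> \<gamma>))"
proof -
  interpret almost_complex m X \<A> J
    using assms by unfold_locales
  show ?thesis
    \<comment> \<open>\<open>A_cocycles_iff\<close> translates the condition on the class of
      \<open>\<gamma>\<close> into \<open>A_closed\<close>, as required by
      \<open>BC_act_class\<close>.\<close>
    using Aeppli_graded_module BC_mul_class BC_act_class A_cocycles_iff by blast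
qed

end
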